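(* Let $\Omega\subset\mathbb{C}^n$ be a bounded domain with $C^2$ boundary and let $1\leq q\leq n-1$. Suppose that for every $\varepsilon>0$ there is a constant $C_\varepsilon>0$ such that $$\varepsilon\left(\|\bar\partial f\|_{L^2(\Omega)}^2+\|\bar\partial^* f\|_{L^2(\Omega)}^2\right)+C_\varepsilon\|f\|^2_{W^{-1}(\Omega)}\geq \|f\|_{L^2(\Omega)}^2$$ for all $f\in L^2_{(0,q)}(\Omega)\cap\mathrm{Dom}\,\bar\partial\cap\mathrm{Dom}\,\bar\partial^*$. Then $$\limsup_{\varepsilon\rightarrow 0^+}\varepsilon^2 C_\varepsilon>0.$$
   Context: $L^2(\Omega)$ is the unweighted $L^2$ space; norms of $(0,q)$-forms are computed coefficientwise in the basis $d\bar z_J$ ($J$ strictly increasing). $\bar\partial$ is the maximal closed ($L^2$, distributional) extension and $\bar\partial^*$ its $L^2(\Omega)$ Hilbert space adjoint. $W^1_0(\Omega)$ is the completion of $C_0^\infty(\Omega)$ in the norm $\|g\|^2_{W^1(\Omega)}=\|g\|^2_{L^2(\Omega)}+\sum_{j=1}^n\|\partial g/\partial\bar z_j\|^2_{L^2(\Omega)}+\sum_{j=1}^n\|\partial g/\partial z_j\|^2_{L^2(\Omega)}$, and $W^{-1}(\Omega)$ is its dual with respect to the $L^2(\Omega)$ pairing, with the dual norm. *)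

theory Defs
  imports "HOL-Analysis.Analysis"
begin

section \<open>Smoothness, test functions, and domains with \<open>C\<^sup>k\<close> boundary\<close>

text \<open>\<open>C\<^sup>k\<close> on an open subset \<open>S\<close> of a Euclidean space; for \<open>k > 0\<close> this asks that all
  directional derivatives exist on \<open>S\<close> and are again \<open>C\<^sup>k\<^sup>-\<^sup>1\<close>.\<close>

fun Ck_on :: "nat \<Rightarrow> 'a::euclidean_space set \<Rightarrow> ('a \<Rightarrow> 'b::real_normed_vector) \<Rightarrow> bool" where
  "Ck_on 0 S f \<longleftrightarrow> continuous_on S f"
| "Ck_on (Suc k) S f \<longleftrightarrow>
     (\<forall>x\<in>S. f differentiable (at x)) \<and>
     (\<forall>v. Ck_on k S (\<lambda>x. frechet_derivative f (at x) v))"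

definition test_functions :: "(complex^'n) set \<Rightarrow> (complex^'n \<Rightarrow> complex) set" where
  "test_functions \<Omega> =
     {\<phi>. (\<forall>k. Ck_on k UNIV \<phi>) \<and> compact (closure {z. \<phi> z \<noteq> 0}) \<and> closure {z. \<phi> z \<noteq> 0} \<subseteq> \<Omega>}"

definition bounded_domain :: "'a::euclidean_space set \<Rightarrow> bool" where
  "bounded_domain \<Omega> \<longleftrightarrow> \<Omega> \<noteq> {} \<and> open \<Omega> \<and> connected \<Omega> \<and> bounded \<Omega>"

text \<open>Every boundary point has a neighbourhood with a \<open>C\<^sup>k\<close> local defining function
  (negative exactly inside \<open>\<Omega>\<close>, with nowhere vanishing differential).\<close>

definition Ck_boundary :: "nat \<Rightarrow> 'a::euclidean_space set \<Rightarrow> bool" where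
  "Ck_boundary k \<Omega> \<longleftrightarrow>
     (\<forall>p\<in>frontier \<Omega>. \<exists>U (\<rho> :: 'a \<Rightarrow> real).
        open U \<and> p \<in> U \<and> Ck_on k U \<rho> \<and>
        \<Omega> \<inter> U = {x\<in>U. \<rho> x < 0} \<and>
        (\<forall>x\<in>U. frechet_derivative \<rho> (at x) \<noteq> (\<lambda>v. 0)))"

section \<open>Wirtinger derivatives\<close>

text \<open>For \<open>z\<^sub>j = x\<^sub>j + \<i> y\<^sub>j\<close>, the real directions \<open>x\<^sub>j\<close> and \<open>y\<^sub>j\<close> are \<open>axis j 1\<close> and
  \<open>axis j \<i>\<close>.\<close>

definition d_z :: "'n \<Rightarrow> (complex^'n::finite \<Rightarrow> complex) \<Rightarrow> complex^'n \<Rightarrow> complex" where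
  "d_z j \<phi> z = (frechet_derivative \<phi> (at z) (axis j 1)
                 - \<i> * frechet_derivative \<phi> (at z) (axis j \<i>)) / 2"

definition d_zbar :: "'n \<Rightarrow> (complex^'n::finite \<Rightarrow> complex) \<Rightarrow> complex^'n \<Rightarrow> complex" where
  "d_zbar j \<phi> z = (frechet_derivative \<phi> (at z) (axis j 1)
                    + \<i> * frechet_derivative \<phi> (at z) (axis j \<i>)) / 2"

section \<open>The space \<open>L\<^sup>2(\<Omega>)\<close>\<close>

text \<open>Elements are functions on the whole space, of which only the restriction to \<open>\<Omega>\<close>
  matters; functions equal almost everywhere on \<open>\<Omega>\<close> are not identified.\<close>

definition L2 :: "(complex^'n) set \<Rightarrow> (complex^'n::finite \<Rightarrow> complex) set" where
  "L2 \<Omega> = {g. g \<in> borel_measurable (lebesgue_on \<Omega>) \<and>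
               integrable (lebesgue_on \<Omega>) (\<lambda>z. (cmod (g z))\<^sup>2)}"

definition L2_inner ::
    "(complex^'n) set \<Rightarrow> (complex^'n::finite \<Rightarrow> complex) \<Rightarrow> (complex^'n \<Rightarrow> complex) \<Rightarrow> complex" where
  "L2_inner \<Omega> f g = (LINT z|lebesgue_on \<Omega>. f z * cnj (g z))"

definition L2_norm :: "(complex^'n) set \<Rightarrow> (complex^'n::finite \<Rightarrow> complex) \<Rightarrow> real" where
  "L2_norm \<Omega> f = sqrt (LINT z|lebesgue_on \<Omega>. (cmod (f z))\<^sup>2)"

section \<open>The spaces \<open>W\<^sup>1\<^sub>0(\<Omega>)\<close> and \<open>W\<^sup>-\<^sup>1(\<Omega>)\<close>\<close>

text \<open>The completion of the test functions in the \<open>W\<^sup>1\<close> norm, realised inside \<open>L\<^sup>2\<close>: the map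
  sending \<open>\<phi>\<close> to \<open>\<phi>\<close> together with all \<open>d_zbar j \<phi>\<close> and \<open>d_z j \<phi>\<close> is isometric into a
  product of copies of \<open>L\<^sup>2\<close>, so the completion is the closure of its range. The triples
  \<open>(g, a, b)\<close> below form this closure; \<open>a j\<close> and \<open>b j\<close> are the derivatives of \<open>g\<close> with respect
  to the conjugate of \<open>z\<^sub>j\<close> and to \<open>z\<^sub>j\<close>.\<close>

definition in_W1_0 ::
    "(complex^'n) set \<Rightarrow> (complex^'n::finite \<Rightarrow> complex) \<Rightarrow>
     ('n \<Rightarrow> complex^'n \<Rightarrow> complex) \<Rightarrow> ('n \<Rightarrow> complex^'n \<Rightarrow> complex) \<Rightarrow> bool" where
  "in_W1_0 \<Omega> g a b \<longleftrightarrow>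
     g \<in> L2 \<Omega> \<and> (\<forall>j. a j \<in> L2 \<Omega>) \<and> (\<forall>j. b j \<in> L2 \<Omega>) \<and>
     (\<exists>\<phi> :: nat \<Rightarrow> complex^'n \<Rightarrow> complex.
        (\<forall>k. \<phi> k \<in> test_functions \<Omega>) \<and>
        (\<lambda>k. L2_norm \<Omega> (\<lambda>z. \<phi> k z - g z)) \<longlonglongrightarrow> 0 \<and>
        (\<forall>j. (\<lambda>k. L2_norm \<Omega> (\<lambda>z. d_zbar j (\<phi> k) z - a j z)) \<longlonglongrightarrow> 0) \<and>
        (\<forall>j. (\<lambda>k. L2_norm \<Omega> (\<lambda>z. d_z j (\<phi> k) z - b j z)) \<longlonglongrightarrow> 0))"

definition W1_norm ::
    "(complex^'n) set \<Rightarrow> (complex^'n::finite \<Rightarrow> complex) \<Rightarrow>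
     ('n \<Rightarrow> complex^'n \<Rightarrow> complex) \<Rightarrow> ('n \<Rightarrow> complex^'n \<Rightarrow> complex) \<Rightarrow> real" where
  "W1_norm \<Omega> g a b =
     sqrt ((L2_norm \<Omega> g)\<^sup>2 + (\<Sum>j\<in>UNIV. (L2_norm \<Omega> (a j))\<^sup>2) + (\<Sum>j\<in>UNIV. (L2_norm \<Omega> (b j))\<^sup>2))"

text \<open>The dual norm, for \<open>f \<in> L2 \<Omega>\<close>; the set is then bounded above by \<open>L2_norm \<Omega> f\<close>.\<close>

definition W_neg1_norm :: "(complex^'n) set \<Rightarrow> (complex^'n::finite \<Rightarrow> complex) \<Rightarrow> real" where
  "W_neg1_norm \<Omega> f =
     Sup {cmod (L2_inner \<Omega> f g) | g a b. in_W1_0 \<Omega> g a b \<and> W1_norm \<Omega> g a b \<le> 1}"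

section \<open>\<open>(0,q)\<close>-forms and the operators \<open>dbar\<close> and \<open>dbar\<^sup>*\<close>\<close>

text \<open>A strictly increasing multi-index is identified with the set of its entries, so a
  \<open>(0,q)\<close>-form is given by its coefficients \<open>f J\<close> for sets \<open>J\<close> of cardinality \<open>q\<close>; the values at
  other sets are irrelevant. The order on the index type \<open>'n\<close> is used for signs only.\<close>

type_synonym 'n form = "'n set \<Rightarrow> complex^'n \<Rightarrow> complex"

definition L2_forms :: "(complex^'n) set \<Rightarrow> nat \<Rightarrow> 'n form set" where
  "L2_forms \<Omega> q = {f. \<forall>J. card J = q \<longrightarrow> f J \<in> L2 \<Omega>}"

definition form_inner :: "(complex^'n) set \<Rightarrow> nat \<Rightarrow> 'n form \<Rightarrow> 'n form \<Rightarrow> complex" where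
  "form_inner \<Omega> q f g = (\<Sum>J | card J = q. L2_inner \<Omega> (f J) (g J))"

definition form_L2_norm :: "(complex^'n) set \<Rightarrow> nat \<Rightarrow> 'n form \<Rightarrow> real" where
  "form_L2_norm \<Omega> q f = sqrt (\<Sum>J | card J = q. (L2_norm \<Omega> (f J))\<^sup>2)"

definition form_W_neg1_norm :: "(complex^'n) set \<Rightarrow> nat \<Rightarrow> 'n form \<Rightarrow> real" where
  "form_W_neg1_norm \<Omega> q f = sqrt (\<Sum>J | card J = q. (W_neg1_norm \<Omega> (f J))\<^sup>2)"

text \<open>The graph of the maximal extension of \<open>dbar\<close> from \<open>(0,q)\<close>- to \<open>(0,q+1)\<close>-forms: \<open>f\<close> is in the
  domain and \<open>dbar f = g\<close> in the sense of distributions. The \<open>K\<close> coefficient of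
  \<open>\<Sum>\<^sub>J \<Sum>\<^sub>k d_zbar k (f J) dzbar\<^sub>k \<and> dzbar\<^sub>J\<close> collects the terms with \<open>J = K - {k}\<close>, and moving \<open>dzbar\<^sub>k\<close>
  into increasing position past the smaller indices in \<open>K\<close> gives the sign.\<close>

definition has_dbar ::
    "(complex^'n::{finite,linorder}) set \<Rightarrow> nat \<Rightarrow> 'n form \<Rightarrow> 'n form \<Rightarrow> bool" where
  "has_dbar \<Omega> q f g \<longleftrightarrow>
     f \<in> L2_forms \<Omega> q \<and> g \<in> L2_forms \<Omega> (Suc q) \<and>
     (\<forall>K. card K = Suc q \<longrightarrow> (\<forall>\<phi>\<in>test_functions \<Omega>.
        (LINT z|lebesgue_on \<Omega>. g K z * \<phi> z) =
        - (LINT z|lebesgue_on \<Omega>.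
             (\<Sum>k\<in>K. (-1) ^ card {i\<in>K. i < k} * f (K - {k}) z * d_zbar k \<phi> z))))"

text \<open>The graph of the Hilbert space adjoint of \<open>dbar\<close> acting on \<open>(0,q-1)\<close>-forms (\<open>q \<ge> 1\<close>): the
  \<open>(0,q)\<close>-form \<open>f\<close> is in the domain of \<open>dbar\<^sup>*\<close> and \<open>dbar\<^sup>*f = h\<close>.\<close>

definition has_dbar_adjoint ::
    "(complex^'n::{finite,linorder}) set \<Rightarrow> nat \<Rightarrow> 'n form \<Rightarrow> 'n form \<Rightarrow> bool" where
  "has_dbar_adjoint \<Omega> q f h \<longleftrightarrow>
     f \<in> L2_forms \<Omega> q \<and> h \<in> L2_forms \<Omega> (q - 1) \<and>
     (\<forall>u v. has_dbar \<Omega> (q - 1) u v \<longrightarrow> form_inner \<Omega> q v f = form_inner \<Omega> (q - 1) u h)"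

end

theory Submission
  imports Defs
begin

text \<open>The hypothesis is tested on forms that concentrate at a strictly convex boundary point. Let
\<open>p\<close> be a point of largest norm in the closure of \<open>\<Omega>\<close>. The function
\<open>h z = \<Sum>\<^sub>j cnj p\<^sub>j (z\<^sub>j - p\<^sub>j)\<close> is holomorphic and satisfies \<open>Re h \<le> - |z - p|\<^sup>2 / 2\<close> on \<open>\<Omega>\<close>, so
\<open>E = exp (\<tau> h)\<close> peaks at \<open>p\<close> when \<open>\<tau>\<close> is large. Let \<open>\<rho>\<close> be a \<open>C\<^sup>2\<close> defining function near \<open>p\<close>.
Contracting the vector \<open>(\<partial>\<rho>/\<partial>z\<^sub>k)\<close> into a constant form of degree \<open>q + 1\<close> and multiplying by a
bump at \<open>p\<close> gives \<open>C\<^sup>1\<close> coefficients \<open>A\<close>; such a form exists because \<open>q \<le> n - 1\<close>. The test form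
is \<open>f = E A\<close>. Write \<open>I\<close> for the integral of \<open>|E|\<^sup>2\<close> over \<open>\<Omega>\<close> and \<open>D\<close> for that of
\<open>|z - p|\<^sup>2 |E|\<^sup>2\<close>.

\<^item> A double contraction with the same vector is zero, so \<open>A\<close> is tangential to every level set
of \<open>\<rho>\<close>, not only to the boundary. Cutting \<open>f\<close> off by a function of \<open>\<rho>\<close> therefore produces no
error term in the formal adjoint, and \<open>f\<close> is in the domain of \<open>dbar\<^sup>*\<close>
(\<open>tangential_in_adjoint_domain\<close>).

\<^item> Since \<open>E\<close> is holomorphic, \<open>dbar f = E dbar A\<close> and \<open>\<parallel>dbar f\<parallel>\<^sup>2\<close> is at most a constant times \<open>I\<close>
(\<open>test_form_dbar_upper\<close>).

\<^item> In \<open>dbar\<^sup>* f\<close> the derivative of \<open>E\<close> brings out a factor \<open>\<tau>\<close> times the contraction of \<open>A\<close> with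
\<open>\<partial>h\<close>. At \<open>p\<close> the vectors \<open>\<partial>h\<close> and \<open>\<partial>\<rho>\<close> are proportional, so this contraction is \<open>O(|z - p|)\<close>
and \<open>\<parallel>dbar\<^sup>* f\<parallel>\<^sup>2\<close> is at most a constant times \<open>I + \<tau>\<^sup>2 D\<close> (\<open>test_form_adjoint_upper\<close>).

\<^item> If \<open>p\<^sub>n \<noteq> 0\<close>, then up to a term of relative size \<open>1/\<tau>\<close> the coefficients of \<open>f\<close> are
\<open>z\<^sub>n\<close>-derivatives of \<open>E A / (\<tau> cnj p\<^sub>n)\<close>. Functions in \<open>W\<^sup>1\<^sub>0\<close> absorb this derivative, which gives
\<open>\<parallel>f\<parallel>\<^sup>2 = O(I / \<tau>\<^sup>2)\<close> in \<open>W\<^sup>-\<^sup>1\<close> (\<open>W_neg1_norm_peak\<close>).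

\<^item> Finally \<open>\<parallel>f\<parallel>\<^sup>2 \<ge> c I - C D\<close> with \<open>c > 0\<close>, as \<open>A\<close> is Lipschitz and does not vanish at \<open>p\<close>
(\<open>test_form_norm_lower\<close>).

It remains to see that \<open>D = O(I / \<tau>)\<close>. Comparing the integrands gives \<open>D(\<tau>) \<le> (2/\<tau>) I(\<tau>/2)\<close>
(\<open>peak_moment_le\<close>). A ball of radius comparable to \<open>1/\<tau>\<close> in \<open>\<Omega>\<close> on which \<open>|E|\<close> is bounded below
shows that \<open>I\<close> decays at most polynomially (\<open>peak_mass_lower\<close>), and so \<open>I(\<tau>/2)\<close> is at most a fixed
multiple of \<open>I(\<tau>)\<close> for arbitrarily large \<open>\<tau>\<close> (\<open>doubling_scales\<close>). For these \<open>\<tau>\<close> put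
\<open>\<epsilon> = \<delta>/\<tau>\<close> with a small fixed \<open>\<delta>\<close>. Then \<open>\<epsilon> (\<parallel>dbar f\<parallel>\<^sup>2 + \<parallel>dbar\<^sup>* f\<parallel>\<^sup>2)\<close> is only a fraction of
\<open>\<parallel>f\<parallel>\<^sup>2\<close>, and the hypothesis forces \<open>C\<^sub>\<epsilon> / \<tau>\<^sup>2\<close>, hence \<open>\<epsilon>\<^sup>2 C\<^sub>\<epsilon>\<close>, to stay above a positive constant
(\<open>critical_scaling\<close>).\<close>

section \<open>Calculus of \<open>C\<^sup>k\<close> functions\<close>

lemma differentiableD: "f differentiable (at x) \<Longrightarrow> (f has_derivative frechet_derivative f (at x)) (at x)"
  using frechet_derivative_works by blast

lemma Ck_on_Suc_imp: "Ck_on (Suc k) S f \<Longrightarrow> Ck_on k S f"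
proof (induction k arbitrary: f)
  case 0
  then show ?case
    by (auto intro!: continuous_at_imp_continuous_on differentiable_imp_continuous_within)
next
  case (Suc k)
  then show ?case by (metis Ck_on.simps(2))
qed

lemma Ck_on_subset: "Ck_on k S f \<Longrightarrow> T \<subseteq> S \<Longrightarrow> Ck_on k T f"
proof (induction k arbitrary: f)
  case 0
  then show ?case by (auto intro: continuous_on_subset)
next
  case (Suc k)
  then show ?case by (auto simp: subset_iff)
qed

lemma Ck_on_cong:
  assumes "open S" and "\<And>x. x \<in> S \<Longrightarrow> f x = g x" and "Ck_on k S f"
  shows "Ck_on k S g"
  using assms(2,3)
proof (induction k arbitrary: f g)
  case 0
  then show ?case by (auto cong: continuous_on_cong)
next
  case (Suc k)
  have dg: "g differentiable (at x)" if "x \<in> S" for x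
    using Suc.prems that assms(1)
    unfolding differentiable_def
    by (metis Ck_on.simps(2) differentiableD has_derivative_transform_within_open)
  have "frechet_derivative f (at x) = frechet_derivative g (at x)" if "x \<in> S" for x
    using Suc.prems that assms(1)
    by (intro frechet_derivative_transform_within_open[where X = S]) auto
  then show ?case
    using Suc.prems dg Suc.IH[of "\<lambda>x. frechet_derivative f (at x) v" "\<lambda>x. frechet_derivative g (at x) v" for v]
    by auto
qed

lemma Ck_on_Un:
  assumes "open S" "open T" "Ck_on k S f" "Ck_on k T f"
  shows "Ck_on k (S \<union> T) f"
  using assms(3,4)
proof (induction k arbitrary: f)
  case 0
  then show ?case using assms(1,2) by (auto intro: continuous_on_open_Un)
qed auto

lemma Ck_on_SucI:
  assumes "open S" and "\<And>x. x \<in> S \<Longrightarrow> (f has_derivative f' x) (at x)"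
    and "\<And>v. Ck_on k S (\<lambda>x. f' x v)"
  shows "Ck_on (Suc k) S f"
proof -
  have "frechet_derivative f (at x) = f' x" if "x \<in> S" for x
    using frechet_derivative_at[OF assms(2)[OF that]] by simp
  then have "Ck_on k S (\<lambda>x. frechet_derivative f (at x) v)" for v
    by (intro Ck_on_cong[OF assms(1) _ assms(3)[of v]]) simp
  then show ?thesis using assms(2) by (auto simp: differentiable_def)
qed

lemma Ck_on_const: "Ck_on k S (\<lambda>x. c)"
proof (induction k arbitrary: c)
  case (Suc k)
  then show ?case by simp
qed simp

lemma Ck_on_bounded_linear:
  assumes "bounded_linear L"
  shows "Ck_on k S L"
proof (cases k)
  case 0
  then show ?thesis using assms by (simp add: linear_continuous_on)
next
  case (Suc k')
  have "frechet_derivative L (at x) = L" for x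
    using assms by (metis bounded_linear_imp_has_derivative frechet_derivative_at)
  then show ?thesis
    using assms Suc by (auto simp: Ck_on_const bounded_linear_imp_differentiable)
qed

lemma Ck_on_compose_linear:
  assumes "bounded_linear L" "open S" "Ck_on k S f"
  shows "Ck_on k S (\<lambda>x. L (f x))"
  using assms(3)
proof (induction k arbitrary: f)
  case 0
  then show ?case using assms(1) by (auto intro: bounded_linear.continuous_on)
next
  case (Suc k)
  then show ?case
    by (intro Ck_on_SucI[OF assms(2), where f' = "\<lambda>x v. L (frechet_derivative f (at x) v)"]
        bounded_linear.has_derivative[OF assms(1)] differentiableD) auto
qed

lemma Ck_on_add:
  assumes "open S" "Ck_on k S f" "Ck_on k S g"
  shows "Ck_on k S (\<lambda>x. f x + g x)"
  using assms(2,3)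
proof (induction k arbitrary: f g)
  case 0
  then show ?case by (auto intro: continuous_intros)
next
  case (Suc k)
  then show ?case
    by (intro Ck_on_SucI[OF assms(1), where f' = "\<lambda>x v. frechet_derivative f (at x) v + frechet_derivative g (at x) v"]
        has_derivative_add differentiableD) auto
qed

lemma Ck_on_sum:
  assumes "open S" "\<And>i. i \<in> I \<Longrightarrow> Ck_on k S (f i)"
  shows "Ck_on k S (\<lambda>x. \<Sum>i\<in>I. f i x)"
  using assms(2)
  by (induction I rule: infinite_finite_induct) (auto intro!: Ck_on_const Ck_on_add assms(1))

lemma Ck_on_bilinear:
  assumes "bounded_bilinear b" "open S" "Ck_on k S f" "Ck_on k S g"
  shows "Ck_on k S (\<lambda>x. b (f x) (g x))"
  using assms(3,4)
proof (induction k arbitrary: f g)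
  case 0
  then show ?case using assms(1) by (auto intro: bounded_bilinear.continuous_on)
next
  case (Suc k)
  then show ?case
    by (intro Ck_on_SucI[OF assms(2), where f' = "\<lambda>x v. b (f x) (frechet_derivative g (at x) v) + b (frechet_derivative f (at x) v) (g x)"]
        bounded_bilinear.FDERIV[OF assms(1)] differentiableD Ck_on_add[OF assms(2)] Suc.IH)
      (auto intro: Ck_on_Suc_imp)
qed

lemmas Ck_on_mult = Ck_on_bilinear[OF bounded_bilinear_mult]
lemmas Ck_on_cnj = Ck_on_compose_linear[OF bounded_linear_cnj]
lemmas Ck_on_of_real = Ck_on_compose_linear[OF bounded_linear_of_real]

text \<open>For coefficients built from a local defining function: \<open>b\<close> need only be regular near the support
of \<open>F\<close>, and its values elsewhere are multiplied by zero.\<close>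

lemma Ck_on_cutoff:
  fixes b :: "'a::euclidean_space \<Rightarrow> 'b::real_normed_algebra"
  assumes "open U" "closed K" "K \<subseteq> U" "Ck_on k U b" "Ck_on k UNIV F" "\<And>x. x \<notin> K \<Longrightarrow> F x = 0"
  shows "Ck_on k UNIV (\<lambda>x. b x * F x)"
proof -
  have "Ck_on k U (\<lambda>x. b x * F x)"
    using assms by (auto intro!: Ck_on_mult intro: Ck_on_subset)
  moreover have "Ck_on k (- K) (\<lambda>x. b x * F x)"
    by (rule Ck_on_cong[OF _ _ Ck_on_const[of k "- K" 0]]) (use assms in auto)
  ultimately have "Ck_on k (U \<union> - K) (\<lambda>x. b x * F x)"
    using assms by (intro Ck_on_Un) auto
  moreover have "U \<union> - K = UNIV" using assms by auto
  ultimately show ?thesis by simp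
qed

section \<open>A smooth bump function\<close>

text \<open>The functions \<open>P(1/t) exp(-1/t)\<close>, extended by zero to \<open>t \<le> 0\<close>. With a polynomial factor the
family is closed under differentiation, so that smoothness follows by induction on the order.
The case \<open>P = 1\<close> is the function used for cutoffs.\<close>

definition flat_poly :: "real poly \<Rightarrow> real \<Rightarrow> real" where
  "flat_poly p t = (if t > 0 then poly p (1 / t) * exp (- (1 / t)) else 0)"

lemma poly_times_exp_minus_tendsto_0: "((\<lambda>x. poly p x * exp (- x)) \<longlongrightarrow> (0::real)) at_top"
proof -
  have "((\<lambda>x. \<Sum>i\<le>degree p. coeff p i * (x ^ i / exp x)) \<longlongrightarrow> (\<Sum>i\<le>degree p. coeff p i * 0)) at_top"
    by (intro tendsto_intros tendsto_power_div_exp_0)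
  then show ?thesis
    by (simp add: poly_altdef exp_minus divide_inverse sum_distrib_right mult.assoc)
qed

lemma flat_poly_DERIV:
  "DERIV (flat_poly p) t :> flat_poly ([:0, 0, 1:] * (p - pderiv p)) t"
proof (cases "t = 0")
  case False
  show ?thesis
  proof (cases "t > 0")
    case True
    have inv: "((\<lambda>t. 1 / t) has_real_derivative - (1 / t\<^sup>2)) (at t)"
      using True by (auto intro!: derivative_eq_intros simp: power2_eq_square)
    have "((\<lambda>t. poly p (1 / t) * exp (- (1 / t))) has_real_derivative
        poly (pderiv p) (1 / t) * (- (1 / t\<^sup>2)) * exp (- (1 / t))
          + exp (- (1 / t)) * (- (- (1 / t\<^sup>2))) * poly p (1 / t)) (at t)"
      by (intro DERIV_mult' DERIV_mult DERIV_chain2[OF poly_DERIV inv] DERIV_fun_exp DERIV_minus inv)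
    moreover have "poly (pderiv p) (1 / t) * (- (1 / t\<^sup>2)) * exp (- (1 / t))
          + exp (- (1 / t)) * (- (- (1 / t\<^sup>2))) * poly p (1 / t)
        = flat_poly ([:0, 0, 1:] * (p - pderiv p)) t"
      using True by (simp add: flat_poly_def power2_eq_square algebra_simps)
    ultimately have "((\<lambda>t. poly p (1 / t) * exp (- (1 / t))) has_real_derivative
        flat_poly ([:0, 0, 1:] * (p - pderiv p)) t) (at t)" by simp
    then show ?thesis
      by (rule has_field_derivative_transform_within_open[where S = "{0<..}"])
        (use True in \<open>auto simp: flat_poly_def\<close>)
  next
    case False
    then have "t < 0" using \<open>t \<noteq> 0\<close> by simp
    have "((\<lambda>t. 0) has_real_derivative flat_poly ([:0, 0, 1:] * (p - pderiv p)) t) (at t)"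
      using \<open>t < 0\<close> by (simp add: flat_poly_def)
    then show ?thesis
      by (rule has_field_derivative_transform_within_open[where S = "{..<0}"])
        (use \<open>t < 0\<close> in \<open>auto simp: flat_poly_def\<close>)
  qed
next
  case True
  have "((\<lambda>h. flat_poly p h / h) \<longlongrightarrow> 0) (at 0)"
    unfolding filterlim_split_at_real[of _ _ "0::real"] filterlim_at_split
  proof
    show "((\<lambda>h. flat_poly p h / h) \<longlongrightarrow> 0) (at_left 0)"
      by (rule tendsto_eventually) (auto simp: flat_poly_def eventually_at_left_field intro!: exI[of _ "-1"])
    have "((\<lambda>h. poly ([:0, 1:] * p) (inverse h) * exp (- inverse h)) \<longlongrightarrow> 0) (at_right (0::real))"
      using filterlim_compose[OF poly_times_exp_minus_tendsto_0 filterlim_inverse_at_top_right] .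
    then show "((\<lambda>h. flat_poly p h / h) \<longlongrightarrow> 0) (at_right 0)"
      by (rule Lim_transform_eventually)
        (auto simp: flat_poly_def eventually_at_right_field inverse_eq_divide intro!: exI[of _ 1])
  qed
  then show ?thesis
    using True by (simp add: DERIV_def flat_poly_def)
qed

lemma flat_poly_has_derivative:
  assumes "(f has_derivative f') (at x)"
  shows "((\<lambda>x. flat_poly p (f x)) has_derivative
      (\<lambda>v. flat_poly ([:0, 0, 1:] * (p - pderiv p)) (f x) * f' v)) (at x)"
  using DERIV_compose_FDERIV[OF flat_poly_DERIV assms] by (simp add: mult.commute)

lemma Ck_on_flat_poly:
  assumes "open S" "\<And>k. Ck_on k S f"
  shows "Ck_on k S (\<lambda>x. flat_poly p (f x))"
proof (induction k arbitrary: p)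
  case 0
  have "isCont (flat_poly p) t" for t using flat_poly_DERIV DERIV_isCont by blast
  then have "continuous_on UNIV (flat_poly p)" by (simp add: continuous_at_imp_continuous_on)
  then show ?case
    using assms(2)[of 0] by (auto intro: continuous_on_compose2)
next
  case (Suc k)
  have d: "(f has_derivative frechet_derivative f (at x)) (at x)" if "x \<in> S" for x
    using assms(2)[of "Suc 0"] that by (auto intro: differentiableD)
  show ?case
    using assms(2)[of "Suc k"]
    by (intro Ck_on_SucI[OF assms(1) flat_poly_has_derivative[OF d]] Ck_on_mult[OF assms(1)] Suc.IH) auto
qed

text \<open>The version of the composition rule for cutoffs in a defining function, which does not have
derivatives of all orders.\<close>

lemma C1_on_flat_poly:
  assumes "open S" "Ck_on (Suc 0) S f"
  shows "Ck_on (Suc 0) S (\<lambda>x. flat_poly p (f x))"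
proof -
  have d: "(f has_derivative frechet_derivative f (at x)) (at x)" if "x \<in> S" for x
    using assms(2) that by (auto intro: differentiableD)
  have "isCont (flat_poly p) t" for p t using flat_poly_DERIV DERIV_isCont by blast
  then have c: "continuous_on UNIV (flat_poly p)" for p by (simp add: continuous_at_imp_continuous_on)
  have "continuous_on S f" using Ck_on_Suc_imp[OF assms(2)] by simp
  then show ?thesis
    using assms(2)
    by (intro Ck_on_SucI[OF assms(1) flat_poly_has_derivative[OF d]] Ck_on_mult[OF assms(1)])
      (auto intro: continuous_on_compose2[OF c])
qed

definition bump :: "'a::euclidean_space \<Rightarrow> real \<Rightarrow> 'a \<Rightarrow> real" where
  "bump c r x = flat_poly 1 (r\<^sup>2 - (x - c) \<bullet> (x - c))"

lemma bump_smooth: "Ck_on k UNIV (bump c r)"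
proof -
  have lin: "Ck_on k UNIV (\<lambda>x. x - c)" for k
    using Ck_on_add[OF open_UNIV Ck_on_bounded_linear[OF bounded_linear_ident] Ck_on_const[of _ _ "- c"]] by simp
  have "Ck_on k UNIV (\<lambda>x. r\<^sup>2 + - ((x - c) \<bullet> (x - c)))" for k
    by (intro Ck_on_add open_UNIV Ck_on_const Ck_on_compose_linear[OF bounded_linear_minus[OF bounded_linear_ident]]
        Ck_on_bilinear[OF bounded_bilinear_inner] lin)
  then show ?thesis
    unfolding bump_def[abs_def] by (intro Ck_on_flat_poly) auto
qed

lemma bump_nonneg: "bump c r x \<ge> 0"
  by (simp add: bump_def flat_poly_def)

lemma bump_center_pos: "r > 0 \<Longrightarrow> bump c r c > 0"
  by (simp add: bump_def flat_poly_def)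

lemma bump_eq_0: "r \<ge> 0 \<Longrightarrow> r \<le> norm (x - c) \<Longrightarrow> bump c r x = 0"
  by (auto simp: bump_def flat_poly_def power2_norm_eq_inner[symmetric] not_less intro: power_mono)

section \<open>Convolution and approximation by test functions\<close>

lemma frechet_derivative_eq_0_outside:
  assumes "closed K" "\<And>x. x \<notin> K \<Longrightarrow> F x = 0" "x \<notin> K"
  shows "(F has_derivative (\<lambda>v. 0)) (at x)" "frechet_derivative F (at x) = (\<lambda>v. 0)"
proof -
  show "(F has_derivative (\<lambda>v. 0)) (at x)"
    by (rule has_derivative_transform_within_open[of "\<lambda>x. 0" _ x UNIV "- K"]) (use assms in auto)
  then show "frechet_derivative F (at x) = (\<lambda>v. 0)"
    using frechet_derivative_at by metis
qed

text \<open>The parameter enters by translation of \<open>F\<close>. With \<open>\<tau> y = y\<close> this moves derivatives of a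
convolution onto the function that is mollified, with \<open>\<tau> y = - y\<close> onto the kernel, and with
weight one it yields the vanishing of the integral of a derivative.\<close>

lemma leibniz_translate:
  fixes F :: "'a::euclidean_space \<Rightarrow> complex" and \<tau> :: "'a \<Rightarrow> 'a"
  assumes F: "Ck_on (Suc 0) UNIV F" and w: "continuous_on (cbox a b) w"
    and \<tau>: "continuous_on (cbox a b) \<tau>"
  shows "((\<lambda>x. integral (cbox a b) (\<lambda>y. w y * F (x + \<tau> y))) has_derivative
     (\<lambda>v. integral (cbox a b) (\<lambda>y. w y * frechet_derivative F (at (x + \<tau> y)) v))) (at x)"
proof -
  define D where "D x y = Blinfun (\<lambda>v. w y * frechet_derivative F (at (x + \<tau> y)) v)" for x y
  have dF: "(F has_derivative frechet_derivative F (at x)) (at x)" for x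
    using F by (auto intro: differentiableD)
  have d: "((\<lambda>x. w y * F (x + \<tau> y)) has_derivative (\<lambda>v. w y * frechet_derivative F (at (x + \<tau> y)) v)) (at x)" for x y
  proof -
    have "((\<lambda>x. x + \<tau> y) has_derivative (\<lambda>v. v)) (at x)"
      by (auto intro!: derivative_eq_intros)
    from has_derivative_compose[OF this dF] show ?thesis
      by (intro has_derivative_mult_right) (simp add: o_def)
  qed
  have D: "blinfun_apply (D x y) = (\<lambda>v. w y * frechet_derivative F (at (x + \<tau> y)) v)" for x y
    unfolding D_def using d by (intro bounded_linear_Blinfun_apply has_derivative_bounded_linear)
  have cF: "continuous_on UNIV F" using Ck_on_Suc_imp[OF F] by simp
  have cD: "continuous_on UNIV (\<lambda>x. frechet_derivative F (at x) v)" for v using F by auto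
  have cont: "continuous_on (UNIV \<times> cbox a b) (\<lambda>(x, y). D x y)"
  proof (rule continuous_on_blinfun_componentwise)
    fix v :: 'a
    have "continuous_on (UNIV \<times> cbox a b) (\<lambda>p. w (snd p) * frechet_derivative F (at (fst p + \<tau> (snd p))) v)"
      by (intro continuous_intros continuous_on_compose2[OF w] continuous_on_compose2[OF cD]
          continuous_on_compose2[OF \<tau>]) auto
    then show "continuous_on (UNIV \<times> cbox a b) (\<lambda>p. blinfun_apply (case p of (x, y) \<Rightarrow> D x y) v)"
      by (simp add: D case_prod_beta)
  qed
  have "((\<lambda>x. integral (cbox a b) (\<lambda>y. w y * F (x + \<tau> y))) has_derivative
      blinfun_apply (integral (cbox a b) (D x))) (at x within UNIV)"
    by (rule leibniz_rule[OF _ _ cont])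
      (auto simp: D d intro!: integrable_continuous continuous_intros w continuous_on_compose2[OF cF] \<tau>)
  moreover have "D x integrable_on cbox a b"
  proof (rule integrable_continuous)
    show "continuous_on (cbox a b) (D x)"
      using continuous_on_compose2[OF cont continuous_on_Pair[OF continuous_on_const[of _ x] continuous_on_id], of "cbox a b"]
      by (simp add: image_subset_iff)
  qed
  then have "blinfun_apply (integral (cbox a b) (D x)) =
      (\<lambda>v. integral (cbox a b) (\<lambda>y. w y * frechet_derivative F (at (x + \<tau> y)) v))"
    by (intro ext) (simp add: blinfun_apply_integral D)
  ultimately show ?thesis by simp
qed

lemma Ck_on_leibniz_translate:
  fixes F :: "'a::euclidean_space \<Rightarrow> complex" and \<tau> :: "'a \<Rightarrow> 'a"
  assumes w: "continuous_on (cbox a b) w" and \<tau>: "continuous_on (cbox a b) \<tau>"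
    and "\<And>k. Ck_on k UNIV F"
  shows "Ck_on k UNIV (\<lambda>x. integral (cbox a b) (\<lambda>y. w y * F (x + \<tau> y)))"
  using assms(3)
proof (induction k arbitrary: F)
  case 0
  have "(\<lambda>x. integral (cbox a b) (\<lambda>y. w y * F (x + \<tau> y))) differentiable (at x)" for x
    using leibniz_translate[OF 0 w \<tau>] by (auto simp: differentiable_def)
  then show ?case
    by (auto intro!: continuous_at_imp_continuous_on differentiable_imp_continuous_within)
next
  case (Suc k)
  have "Ck_on k' UNIV (\<lambda>x. frechet_derivative F (at x) v)" for k' v
    using Suc.prems[of "Suc k'"] by simp
  then show ?case
    by (intro Ck_on_SucI[OF open_UNIV leibniz_translate[OF Suc.prems w \<tau>]] Suc.IH)
qed

lemma integral_compact_support: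
  fixes F :: "'a::euclidean_space \<Rightarrow> 'b::euclidean_space"
  assumes "continuous_on UNIV F" "\<And>x. x \<notin> cbox a b \<Longrightarrow> F x = 0"
  shows "integrable lborel F" "(LINT x|lborel. F x) = integral (cbox a b) F"
proof -
  have m: "F \<in> borel_measurable borel" using assms(1) by (rule borel_measurable_continuous_onI)
  have i: "integrable (lebesgue_on (cbox a b)) F"
    using assms(1) by (intro continuous_imp_integrable) (auto intro: continuous_on_subset)
  have e: "(\<lambda>x. indicat_real (cbox a b) x *\<^sub>R F x) = F" using assms(2) by (auto simp: indicator_def)
  have "integrable lebesgue F"
    using i integrable_restrict_space[of "cbox a b" lebesgue F] e by simp
  then show "integrable lborel F" using m by (simp add: integrable_completion)
  have "(LINT x|lborel. F x) = (LINT x|lebesgue. F x)"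
    using m by (simp add: integral_completion)
  also have "\<dots> = (LINT x|lebesgue_on (cbox a b). F x)"
    by (simp add: Bochner_Integration.integral_restrict_space e)
  also have "\<dots> = integral (cbox a b) F"
    by (rule lebesgue_integral_eq_integral[OF i]) auto
  finally show "(LINT x|lborel. F x) = integral (cbox a b) F" .
qed

lemma integral_lebesgue_on_support:
  fixes F :: "'a::euclidean_space \<Rightarrow> 'b::euclidean_space"
  assumes "continuous_on UNIV F" "\<And>x. x \<notin> S \<Longrightarrow> F x = 0" "S \<in> sets lebesgue"
  shows "(LINT x|lebesgue_on S. F x) = (LINT x|lborel. F x)"
proof -
  have e: "(\<lambda>x. indicat_real S x *\<^sub>R F x) = F" using assms(2) by (auto simp: indicator_def)
  have m: "F \<in> borel_measurable borel" using assms(1) by (rule borel_measurable_continuous_onI)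
  show ?thesis
    using assms(3) m by (simp add: Bochner_Integration.integral_restrict_space e integral_completion)
qed

lemma integral_lborel_translate:
  fixes F :: "'a::euclidean_space \<Rightarrow> 'b::euclidean_space"
  assumes "continuous_on UNIV F"
  shows "(LINT x|lborel. F (c + x)) = (LINT x|lborel. F x)"
proof -
  have "(LINT x|lborel. F x) = (LINT x|distr lborel borel ((+) c). F x)"
    by (simp add: lborel_distr_plus)
  also have "\<dots> = (LINT x|lborel. F (c + x))"
    using assms by (intro integral_distr) (auto intro: borel_measurable_continuous_onI)
  finally show ?thesis by simp
qed

lemma compact_enlarge_cbox:
  fixes K :: "'a::euclidean_space set"
  assumes "compact K"
  obtains a b where "{x + y |x y. x \<in> K \<and> y \<in> cball 0 r} \<subseteq> cbox a b"
proof -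
  have "compact {x + y |x y. x \<in> K \<and> y \<in> cball 0 r}"
    using assms by (intro compact_sums) auto
  then obtain c where "{x + y |x y. x \<in> K \<and> y \<in> cball 0 r} \<subseteq> cbox (- c) c"
    by (rule bounded_subset_cbox_symmetric[OF compact_imp_bounded])
  then show ?thesis by (rule that)
qed

text \<open>By translation invariance the integral of \<open>F(x + y)\<close> over \<open>y\<close> does not depend on \<open>x\<close>.
Differentiating in \<open>x\<close> at \<open>0\<close> under the integral sign gives the claim.\<close>

lemma integral_frechet_derivative_eq_0:
  fixes F :: "'a::euclidean_space \<Rightarrow> complex"
  assumes F: "Ck_on (Suc 0) UNIV F" and K: "compact K" "\<And>x. x \<notin> K \<Longrightarrow> F x = 0"
  shows "(LINT x|lborel. frechet_derivative F (at x) v) = 0"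
proof -
  \<comment> \<open>A box large enough to contain the support of every translate by less than one.\<close>
  obtain a b where ab: "{x + y |x y. x \<in> K \<and> y \<in> cball 0 1} \<subseteq> cbox a b"
    by (rule compact_enlarge_cbox[OF K(1)])
  have cF: "continuous_on UNIV F" using Ck_on_Suc_imp[OF F] by simp
  have KD: "frechet_derivative F (at x) v = 0" if "x \<notin> K" for x v
    using frechet_derivative_eq_0_outside(2)[of K F x] K that by (simp add: compact_imp_closed)
  have c: "integral (cbox a b) (\<lambda>y. 1 * F (x + y)) = (LINT y|lborel. F y)" if "x \<in> ball 0 1" for x
  proof -
    have "F (x + y) = 0" if "y \<notin> cbox a b" for y
    proof (rule ccontr)
      assume "F (x + y) \<noteq> 0"
      then have "x + y \<in> K" using K by auto
      moreover have "- x \<in> cball 0 1" using \<open>x \<in> ball 0 1\<close> by simp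
      ultimately have "(x + y) + - x \<in> cbox a b" using ab by blast
      then show False using that by simp
    qed
    then have "(LINT y|lborel. F (x + y)) = integral (cbox a b) (\<lambda>y. F (x + y))"
      by (intro integral_compact_support) (auto intro!: continuous_intros continuous_on_compose2[OF cF])
    then show ?thesis using integral_lborel_translate[OF cF, of x] by simp
  qed
  have "((\<lambda>x. integral (cbox a b) (\<lambda>y. 1 * F (x + y))) has_derivative
     (\<lambda>v. integral (cbox a b) (\<lambda>y. 1 * frechet_derivative F (at (0 + y)) v))) (at 0)"
    by (rule leibniz_translate[OF F]) auto
  moreover have "((\<lambda>x. integral (cbox a b) (\<lambda>y. 1 * F (x + y))) has_derivative (\<lambda>v. 0)) (at 0)"
    by (rule has_derivative_transform_within_open[of "\<lambda>x. (LINT y|lborel. F y)" _ _ _ "ball 0 1"])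
      (use c in auto)
  ultimately have "(\<lambda>v. integral (cbox a b) (\<lambda>y. 1 * frechet_derivative F (at (0 + y)) v)) = (\<lambda>v. 0)"
    by (rule has_derivative_unique)
  then have "integral (cbox a b) (\<lambda>y. frechet_derivative F (at y) v) = 0"
    by (metis (no_types, lifting) add_0 mult_1 Henstock_Kurzweil_Integration.integral_cong)
  moreover have "(LINT x|lborel. frechet_derivative F (at x) v) = integral (cbox a b) (\<lambda>y. frechet_derivative F (at y) v)"
  proof (rule integral_compact_support)
    show "continuous_on UNIV (\<lambda>x. frechet_derivative F (at x) v)" using F by simp
    show "frechet_derivative F (at x) v = 0" if "x \<notin> cbox a b" for x
    proof (rule KD)
      have "x \<in> cbox a b" if "x \<in> K"
      proof -
        have "x + 0 \<in> cbox a b" using that ab by (metis (mono_tags, lifting) CollectI centre_in_cball subsetD zero_le_one)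
        then show ?thesis by simp
      qed
      then show "x \<notin> K" using that by blast
    qed
  qed
  ultimately show ?thesis by simp
qed

lemma bounded_compact_support:
  fixes g :: "'a::euclidean_space \<Rightarrow> 'b::real_normed_vector"
  assumes "continuous_on UNIV g" "compact K" "\<And>x. x \<notin> K \<Longrightarrow> g x = 0"
  obtains B where "B \<ge> 0" "\<And>x. norm (g x) \<le> B"
proof -
  have "compact (g ` K)" using assms by (auto intro!: compact_continuous_image intro: continuous_on_subset)
  then obtain B where B: "\<And>x. x \<in> K \<Longrightarrow> norm (g x) \<le> B"
    using compact_imp_bounded bounded_iff by (metis image_eqI)
  have "norm (g x) \<le> \<bar>B\<bar>" for x using B[of x] assms(3)[of x] by (cases "x \<in> K") auto
  then show ?thesis using that[of "\<bar>B\<bar>"] by auto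
qed

text \<open>An average stays within \<open>e\<close> of \<open>c\<close> if the averaged values do. With \<open>c = 0\<close> this bounds a
mollified function, and with \<open>c = g x\<close> it gives convergence as the kernel shrinks.\<close>

lemma averaging_estimate:
  fixes g :: "'a::euclidean_space \<Rightarrow> complex" and \<eta> :: "'a \<Rightarrow> real"
  assumes \<eta>: "continuous_on UNIV \<eta>" "\<And>y. \<eta> y \<ge> 0" "\<And>y. norm y \<ge> \<delta> \<Longrightarrow> \<eta> y = 0" "(LINT y|lborel. \<eta> y) = 1"
    and g: "continuous_on UNIV g" and e: "\<And>y. y \<in> cball x \<delta> \<Longrightarrow> norm (g y - c) \<le> e"
  shows "norm ((LINT y|lborel. complex_of_real (\<eta> y) * g (x + y)) - c) \<le> e"
proof -
  obtain a b where ab: "cball 0 \<delta> \<subseteq> cbox a (b::'a)"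
    using bounded_subset_cbox_symmetric[OF bounded_cball] by blast
  have ze: "\<eta> y = 0" if "y \<notin> cbox a b" for y
    using that ab \<eta>(3)[of y] by force
  have i1: "integrable lborel \<eta>" by (rule integral_compact_support(1)[OF \<eta>(1) ze])
  have i2: "integrable lborel (\<lambda>y. complex_of_real (\<eta> y) * g (x + y))"
    by (rule integral_compact_support(1)[of _ a b])
      (auto simp: ze intro!: continuous_intros \<eta> continuous_on_compose2[OF g])
  have i3: "integrable lborel (\<lambda>y. complex_of_real (\<eta> y) * c)" using i1 by simp
  have "(LINT y|lborel. complex_of_real (\<eta> y) * g (x + y)) - c
      = (LINT y|lborel. complex_of_real (\<eta> y) * g (x + y)) - (LINT y|lborel. complex_of_real (\<eta> y) * c)"
    using \<eta>(4) by simp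
  also have "\<dots> = (LINT y|lborel. complex_of_real (\<eta> y) * g (x + y) - complex_of_real (\<eta> y) * c)"
    using i2 i3 by simp
  also have "norm \<dots> \<le> (LINT y|lborel. \<eta> y * e)"
  proof (rule Bochner_Integration.integral_norm_bound_integral)
    show "integrable lborel (\<lambda>y. complex_of_real (\<eta> y) * g (x + y) - complex_of_real (\<eta> y) * c)"
      using i2 i3 by simp
    show "integrable lborel (\<lambda>y. \<eta> y * e)" using i1 by simp
    fix y
    show "norm (complex_of_real (\<eta> y) * g (x + y) - complex_of_real (\<eta> y) * c) \<le> \<eta> y * e"
    proof (cases "norm y \<le> \<delta>")
      case True
      have "complex_of_real (\<eta> y) * g (x + y) - complex_of_real (\<eta> y) * c = complex_of_real (\<eta> y) * (g (x + y) - c)"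
        by (simp add: algebra_simps)
      then have "norm (complex_of_real (\<eta> y) * g (x + y) - complex_of_real (\<eta> y) * c) = \<eta> y * norm (g (x + y) - c)"
        using \<eta>(2) by (simp add: norm_mult)
      also have "\<dots> \<le> \<eta> y * e"
        using True by (intro mult_left_mono e \<eta>(2)) (simp add: dist_norm)
      finally show ?thesis .
    qed (use \<eta>(3) in simp)
  qed
  also have "\<dots> = e" using \<eta>(4) by simp
  finally show ?thesis .
qed

lemma smooth_kernel_exists:
  assumes "\<delta> > 0"
  obtains \<eta> :: "'a::euclidean_space \<Rightarrow> real" where "\<And>k. Ck_on k UNIV \<eta>" "\<And>y. \<eta> y \<ge> 0"
    "\<And>y. norm y \<ge> \<delta> \<Longrightarrow> \<eta> y = 0" "(LINT y|lborel. \<eta> y) = 1" "\<And>y. \<eta> (- y) = \<eta> y"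
proof -
  let ?b = "bump (0::'a) \<delta>"
  have c: "continuous_on UNIV ?b" using bump_smooth[of 0] by simp
  obtain a where a: "cball (0::'a) \<delta> \<subseteq> cbox (- a) a"
    using bounded_subset_cbox_symmetric[OF bounded_cball] by blast
  have z: "?b y = 0" if "y \<notin> cbox (- a) a" for y
    using bump_eq_0[of \<delta> y 0] assms that a by force
  have "ball (0::'a) \<delta> \<subseteq> box (- a) a"
    using a by (metis ball_subset_cball interior_cbox interior_maximal open_ball subset_trans)
  then have ne: "0 \<in> box (- a) a" using assms by (simp add: subset_iff)
  have "integral (cbox (- a) a) ?b \<noteq> 0"
  proof
    assume "integral (cbox (- a) a) ?b = 0"
    then have "\<forall>x\<in>cbox (- a) a. ?b x = 0"
      using ne by (subst (asm) integral_cbox_eq_0_iff)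
        (auto simp: bump_nonneg intro: continuous_on_subset[OF c])
    moreover have "0 \<in> cbox (- a) a" using ne box_subset_cbox by blast
    ultimately show False using bump_center_pos[OF assms, of "0::'a"] by auto
  qed
  then have I: "(LINT y|lborel. ?b y) \<noteq> 0"
    by (simp add: integral_compact_support(2)[OF c z])
  have "(LINT y|lborel. ?b y) \<ge> 0" by (intro Bochner_Integration.integral_nonneg) (simp add: bump_nonneg)
  with I have I': "(LINT y|lborel. ?b y) > 0" by simp
  have sym: "?b (- y) = ?b y" for y by (simp add: bump_def)
  show ?thesis
  proof (rule that[of "\<lambda>y. (1 / (LINT y|lborel. ?b y)) * ?b y"])
    show "Ck_on k UNIV (\<lambda>y. 1 / (LINT y|lborel. ?b y) * ?b y)" for k
      by (intro Ck_on_mult open_UNIV Ck_on_const bump_smooth)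
  qed (use I' assms bump_eq_0[of \<delta> _ 0] in \<open>auto simp: bump_nonneg sym\<close>)
qed

text \<open>The last two clauses say that \<open>\<Phi>\<close> and its derivatives are averages of \<open>\<phi>\<close> and its derivatives over
balls of radius \<open>\<delta>\<close>; both bounds and convergence follow from them.\<close>

lemma mollification:
  fixes \<phi> :: "'a::euclidean_space \<Rightarrow> complex"
  assumes \<phi>: "Ck_on (Suc 0) UNIV \<phi>" and K: "compact K" "\<And>x. x \<notin> K \<Longrightarrow> \<phi> x = 0" and "\<delta> > 0"
  shows "\<exists>\<Phi>. (\<forall>k. Ck_on k UNIV \<Phi>) \<and>
    (\<forall>x. \<Phi> x \<noteq> 0 \<longrightarrow> x \<in> {x + y |x y. x \<in> K \<and> y \<in> cball 0 \<delta>}) \<and>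
    (\<forall>x c e. (\<forall>y. y \<in> cball x \<delta> \<longrightarrow> norm (\<phi> y - c) \<le> e) \<longrightarrow> norm (\<Phi> x - c) \<le> e) \<and>
    (\<forall>x v c e. (\<forall>y. y \<in> cball x \<delta> \<longrightarrow> norm (frechet_derivative \<phi> (at y) v - c) \<le> e) \<longrightarrow>
        norm (frechet_derivative \<Phi> (at x) v - c) \<le> e)"
proof -
  obtain \<eta> :: "'a \<Rightarrow> real" where \<eta>: "\<And>k. Ck_on k UNIV \<eta>" "\<And>y. \<eta> y \<ge> 0"
    "\<And>y. norm y \<ge> \<delta> \<Longrightarrow> \<eta> y = 0" "(LINT y|lborel. \<eta> y) = 1" "\<And>y. \<eta> (- y) = \<eta> y"
    using smooth_kernel_exists[OF \<open>\<delta> > 0\<close>] by metis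
  have c\<eta>: "continuous_on UNIV \<eta>" using \<eta>(1)[of 0] by simp
  have c\<phi>: "continuous_on UNIV \<phi>" using Ck_on_Suc_imp[OF \<phi>] by simp
  have cd: "continuous_on UNIV (\<lambda>x. frechet_derivative \<phi> (at x) v)" for v using \<phi> by simp
  \<comment> \<open>Differentiating this form puts the derivative on \<open>\<phi>\<close>; the equivalent form below, with the translate
on the symmetric kernel, shows smoothness.\<close>
  define \<Phi> where "\<Phi> x = (LINT y|lborel. complex_of_real (\<eta> y) * \<phi> (x + y))" for x
  obtain a b where ab: "cball 0 \<delta> \<subseteq> cbox a (b::'a)"
    using bounded_subset_cbox_symmetric[OF bounded_cball] by blast
  have ze: "\<eta> y = 0" if "y \<notin> cbox a b" for y
    using that ab \<eta>(3)[of y] by force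
  obtain a' b' where ab': "K \<subseteq> cbox a' b'"
    using bounded_subset_cbox_symmetric[OF compact_imp_bounded[OF K(1)]] by blast
  have \<Phi>1: "\<Phi> = (\<lambda>x. integral (cbox a b) (\<lambda>y. complex_of_real (\<eta> y) * \<phi> (x + y)))"
    unfolding \<Phi>_def
    by (intro ext integral_compact_support(2))
      (auto simp: ze intro!: continuous_intros c\<eta> continuous_on_compose2[OF c\<phi>])
  have \<Phi>2: "\<Phi> x = integral (cbox a' b') (\<lambda>y. \<phi> y * complex_of_real (\<eta> (x + - y)))" for x
  proof -
    have c: "continuous_on UNIV (\<lambda>y. \<phi> y * complex_of_real (\<eta> (x + - y)))"
      by (intro continuous_intros c\<phi> continuous_on_compose2[OF c\<eta>]) auto
    have "\<Phi> x = (LINT y|lborel. \<phi> (x + y) * complex_of_real (\<eta> (x + - (x + y))))"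
      unfolding \<Phi>_def using \<eta>(5) by (intro Bochner_Integration.integral_cong) (auto simp: mult.commute)
    also have "\<dots> = (LINT y|lborel. \<phi> y * complex_of_real (\<eta> (x + - y)))"
      by (rule integral_lborel_translate[OF c])
    also have "\<dots> = integral (cbox a' b') (\<lambda>y. \<phi> y * complex_of_real (\<eta> (x + - y)))"
      using ab' K(2) by (intro integral_compact_support(2)[OF c]) auto
    finally show ?thesis .
  qed
  have D: "frechet_derivative \<Phi> (at x) v = (LINT y|lborel. complex_of_real (\<eta> y) * frechet_derivative \<phi> (at (x + y)) v)" for x v
  proof -
    have "(\<Phi> has_derivative (\<lambda>v. integral (cbox a b) (\<lambda>y. complex_of_real (\<eta> y) * frechet_derivative \<phi> (at (x + y)) v))) (at x)"
      unfolding \<Phi>1 by (rule leibniz_translate[OF \<phi>])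
        (auto intro!: continuous_intros intro: continuous_on_subset[OF c\<eta>])
    then have "frechet_derivative \<Phi> (at x) = (\<lambda>v. integral (cbox a b) (\<lambda>y. complex_of_real (\<eta> y) * frechet_derivative \<phi> (at (x + y)) v))"
      by (rule frechet_derivative_at[symmetric])
    moreover have "integral (cbox a b) (\<lambda>y. complex_of_real (\<eta> y) * frechet_derivative \<phi> (at (x + y)) v)
      = (LINT y|lborel. complex_of_real (\<eta> y) * frechet_derivative \<phi> (at (x + y)) v)"
      by (rule integral_compact_support(2)[symmetric])
        (auto simp: ze intro!: continuous_intros c\<eta> continuous_on_compose2[OF cd])
    ultimately show ?thesis by simp
  qed
  show ?thesis
  proof (intro exI[of _ \<Phi>] conjI allI impI)
    show "Ck_on k UNIV \<Phi>" for k
    proof -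
      have "\<Phi> = (\<lambda>x. integral (cbox a' b') (\<lambda>y. \<phi> y * complex_of_real (\<eta> (x + - y))))"
        using \<Phi>2 by auto
      moreover have "Ck_on k UNIV (\<lambda>x. integral (cbox a' b') (\<lambda>y. \<phi> y * (\<lambda>z. complex_of_real (\<eta> z)) (x + - y)))"
        by (intro Ck_on_leibniz_translate Ck_on_of_real open_UNIV \<eta>(1))
          (auto intro!: continuous_intros intro: continuous_on_subset[OF c\<phi>])
      ultimately show ?thesis by simp
    qed
    show "x \<in> {x + y |x y. x \<in> K \<and> y \<in> cball 0 \<delta>}" if "\<Phi> x \<noteq> 0" for x
    proof (rule ccontr)
      assume n: "x \<notin> {x + y |x y. x \<in> K \<and> y \<in> cball 0 \<delta>}"
      have "complex_of_real (\<eta> y) * \<phi> (x + y) = 0" for y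
      proof (cases "norm y \<le> \<delta>")
        case True
        have "x + y \<notin> K"
        proof
          assume "x + y \<in> K"
          moreover have "- y \<in> cball 0 \<delta>" using True by simp
          moreover have "x = (x + y) + - y" by simp
          ultimately show False using n by blast
        qed
        then show ?thesis using K by simp
      qed (use \<eta>(3) in simp)
      then have "(\<lambda>y. complex_of_real (\<eta> y) * \<phi> (x + y)) = (\<lambda>y. 0)" by blast
      then show False using that unfolding \<Phi>_def by (metis Bochner_Integration.integral_zero)
    qed
    show "norm (\<Phi> x - c) \<le> e" if "\<forall>y. y \<in> cball x \<delta> \<longrightarrow> norm (\<phi> y - c) \<le> e" for x c e
    proof (unfold \<Phi>_def, rule averaging_estimate[OF c\<eta> \<eta>(2-4) c\<phi>])
      fix y assume "y \<in> cball x \<delta>"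
      then show "norm (\<phi> y - c) \<le> e" using that by blast
    qed
    show "norm (frechet_derivative \<Phi> (at x) v - c) \<le> e"
      if "\<forall>y. y \<in> cball x \<delta> \<longrightarrow> norm (frechet_derivative \<phi> (at y) v - c) \<le> e" for x v c e
    proof (unfold D, rule averaging_estimate[OF c\<eta> \<eta>(2-4) cd])
      fix y assume "y \<in> cball x \<delta>"
      then show "norm (frechet_derivative \<phi> (at y) v - c) \<le> e" using that by blast
    qed
  qed
qed

lemma tendsto_by_shrinking_balls:
  fixes g :: "'a::euclidean_space \<Rightarrow> complex"
  assumes "continuous_on UNIV g" "\<delta> > 0"
    and "\<And>m c e. (\<And>y. y \<in> cball x (\<delta> / real (Suc m)) \<Longrightarrow> norm (g y - c) \<le> e) \<Longrightarrow> norm (G m - c) \<le> e"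
  shows "G \<longlonglongrightarrow> g x"
proof (rule LIMSEQ_I)
  fix r :: real assume "r > 0"
  have "isCont g x" using assms(1) by (simp add: continuous_on_eq_continuous_at)
  then obtain d where d: "d > 0" "\<And>y. dist y x < d \<Longrightarrow> dist (g y) (g x) < r / 2"
    using \<open>r > 0\<close> unfolding continuous_at_eps_delta by (metis half_gt_zero)
  have "(\<lambda>m. \<delta> / real (Suc m)) \<longlonglongrightarrow> 0"
    by (intro LIMSEQ_Suc[OF lim_const_over_n])
  then obtain N where N: "\<And>m. m \<ge> N \<Longrightarrow> \<delta> / real (Suc m) < d"
    using d(1) \<open>\<delta> > 0\<close> by (force simp: lim_sequentially dist_real_def)
  have "norm (G m - g x) < r" if "m \<ge> N" for m
  proof -
    have "norm (G m - g x) \<le> r / 2"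
    proof (rule assms(3))
      fix y assume "y \<in> cball x (\<delta> / real (Suc m))"
      then have "dist y x < d" using N[OF that] by (simp add: dist_commute)
      then show "norm (g y - g x) \<le> r / 2" using d(2)[of y] by (simp add: dist_norm)
    qed
    then show ?thesis using \<open>r > 0\<close> by simp
  qed
  then show "\<exists>no. \<forall>n\<ge>no. norm (G n - g x) < r" by blast
qed

text \<open>Pointwise convergence of the functions and of all directional derivatives, each dominated by a
constant. The bound for the functions themselves is stored at the direction \<open>0\<close>, where the
derivative gives no information.\<close>

definition C1_approximation ::
    "(complex^'n) set \<Rightarrow> (complex^'n::finite \<Rightarrow> complex) \<Rightarrow> (nat \<Rightarrow> complex^'n \<Rightarrow> complex) \<Rightarrow> (complex^'n \<Rightarrow> real) \<Rightarrow> bool" where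
  "C1_approximation \<Omega> \<phi> \<Phi> B \<longleftrightarrow> (\<forall>m. \<Phi> m \<in> test_functions \<Omega>) \<and>
    (\<forall>x. (\<lambda>m. \<Phi> m x) \<longlonglongrightarrow> \<phi> x) \<and>
    (\<forall>x v. (\<lambda>m. frechet_derivative (\<Phi> m) (at x) v) \<longlonglongrightarrow> frechet_derivative \<phi> (at x) v) \<and>
    (\<forall>m x. norm (\<Phi> m x) \<le> B 0) \<and>
    (\<forall>m x v. norm (frechet_derivative (\<Phi> m) (at x) v) \<le> B v)"

lemma C1_approx_test_functions:
  fixes \<phi> :: "complex^'n::finite \<Rightarrow> complex"
  assumes \<phi>: "Ck_on (Suc 0) UNIV \<phi>" and K: "compact K" "\<And>x. x \<notin> K \<Longrightarrow> \<phi> x = 0"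
    and \<Omega>: "open \<Omega>" "K \<subseteq> \<Omega>"
  shows "\<exists>\<Phi> B. C1_approximation \<Omega> \<phi> \<Phi> B"
proof -
  have c\<phi>: "continuous_on UNIV \<phi>" using Ck_on_Suc_imp[OF \<phi>] by simp
  have cd: "continuous_on UNIV (\<lambda>x. frechet_derivative \<phi> (at x) v)" for v using \<phi> by simp
  obtain \<delta> where \<delta>: "\<delta> > 0" "(\<Union>x\<in>K. cball x \<delta>) \<subseteq> \<Omega>"
    by (rule compact_subset_open_imp_cball_epsilon_subset[OF K(1) \<Omega>])
  define d where "d m = \<delta> / real (Suc m)" for m
  have d: "d m > 0" "d m \<le> \<delta>" for m using \<delta> by (auto simp: d_def divide_simps mult_left_mono)
  define P where "P m \<Phi> \<longleftrightarrow> (\<forall>k. Ck_on k UNIV \<Phi>) \<and>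
     (\<forall>x. \<Phi> x \<noteq> 0 \<longrightarrow> x \<in> {x + y |x y. x \<in> K \<and> y \<in> cball 0 (d m)}) \<and>
     (\<forall>x c e. (\<forall>y. y \<in> cball x (d m) \<longrightarrow> norm (\<phi> y - c) \<le> e) \<longrightarrow> norm (\<Phi> x - c) \<le> e) \<and>
     (\<forall>x v c e. (\<forall>y. y \<in> cball x (d m) \<longrightarrow> norm (frechet_derivative \<phi> (at y) v - c) \<le> e) \<longrightarrow>
        norm (frechet_derivative \<Phi> (at x) v - c) \<le> e)" for m \<Phi>
  have "\<exists>\<Phi>. P m \<Phi>" for m
    unfolding P_def by (rule mollification[OF \<phi> K d(1)[of m]])
  then obtain \<Phi> where P: "\<And>m. P m (\<Phi> m)" by metis
  have \<Phi>: "Ck_on k UNIV (\<Phi> m)"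
     "\<Phi> m x \<noteq> 0 \<Longrightarrow> x \<in> {x + y |x y. x \<in> K \<and> y \<in> cball 0 (d m)}"
     "(\<And>y. y \<in> cball x (d m) \<Longrightarrow> norm (\<phi> y - c) \<le> e) \<Longrightarrow> norm (\<Phi> m x - c) \<le> e"
     "(\<And>y. y \<in> cball x (d m) \<Longrightarrow> norm (frechet_derivative \<phi> (at y) v - c) \<le> e) \<Longrightarrow>
        norm (frechet_derivative (\<Phi> m) (at x) v - c) \<le> e" for m k x v c e
    using P[of m] unfolding P_def by simp_all
  have KD: "frechet_derivative \<phi> (at x) v = 0" if "x \<notin> K" for x v
    using frechet_derivative_eq_0_outside(2)[of K \<phi> x] K that by (simp add: compact_imp_closed)
  obtain B1 where B1: "B1 \<ge> 0" "\<And>x. norm (\<phi> x) \<le> B1" using bounded_compact_support[OF c\<phi> K] by metis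
  have "\<exists>B. \<forall>x. norm (frechet_derivative \<phi> (at x) v) \<le> B" for v
    using bounded_compact_support[OF cd K(1) KD] by metis
  then obtain B2 where B2: "\<And>v x. norm (frechet_derivative \<phi> (at x) v) \<le> B2 v" by metis
  have cp: "compact {x + y |x y. x \<in> K \<and> y \<in> cball 0 \<delta>}" using K by (intro compact_sums) auto
  have sub: "{x + y |x y. x \<in> K \<and> y \<in> cball 0 \<delta>} \<subseteq> \<Omega>"
    using \<delta>(2) by (fastforce simp: dist_norm)
  show ?thesis
    unfolding C1_approximation_def
  proof (rule exI[of _ \<Phi>], rule exI[of _ "\<lambda>v. B1 + B2 v"], intro conjI allI)
    fix m x v
    have "{z. \<Phi> m z \<noteq> 0} \<subseteq> {x + y |x y. x \<in> K \<and> y \<in> cball 0 \<delta>}"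
      using \<Phi>(2)[of m] d(2)[of m] by fastforce
    then have cl: "closure {z. \<Phi> m z \<noteq> 0} \<subseteq> {x + y |x y. x \<in> K \<and> y \<in> cball 0 \<delta>}"
      using cp by (intro closure_minimal compact_imp_closed)
    then have "compact (closure {z. \<Phi> m z \<noteq> 0})"
      using bounded_subset[OF compact_imp_bounded[OF cp] cl] by (simp add: compact_eq_bounded_closed)
    then show "\<Phi> m \<in> test_functions \<Omega>"
      using \<Phi>(1) cl sub by (auto simp: test_functions_def)
    show "norm (frechet_derivative (\<Phi> m) (at x) v) \<le> B1 + B2 v"
      using \<Phi>(4)[of x m v 0 "B2 v"] B2 B1(1) by (simp add: add_increasing)
    have "B2 v \<ge> 0" for v using order_trans[OF norm_ge_zero B2[of 0 v]] .
    then show "norm (\<Phi> m x) \<le> B1 + B2 0"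
      using \<Phi>(3)[of x m 0 B1] B1(2) by (simp add: add_increasing2)
  next
    fix x v
    show "(\<lambda>m. \<Phi> m x) \<longlonglongrightarrow> \<phi> x"
      by (rule tendsto_by_shrinking_balls[OF c\<phi> \<delta>(1)]) (use \<Phi>(3) in \<open>simp add: d_def\<close>)
    show "(\<lambda>m. frechet_derivative (\<Phi> m) (at x) v) \<longlonglongrightarrow> frechet_derivative \<phi> (at x) v"
      by (rule tendsto_by_shrinking_balls[OF cd \<delta>(1)]) (use \<Phi>(4) in \<open>simp add: d_def\<close>)
  qed
qed

section \<open>Square integrable functions\<close>

lemma finite_measure_lebesgue_on:
  fixes \<Omega> :: "'a::euclidean_space set"
  assumes "bounded \<Omega>" "open \<Omega>"
  shows "finite_measure (lebesgue_on \<Omega>)" "\<Omega> \<in> sets lebesgue"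
proof -
  have l: "\<Omega> \<in> lmeasurable" using lmeasurable_open[OF assms] .
  then show "\<Omega> \<in> sets lebesgue" by auto
  show "finite_measure (lebesgue_on \<Omega>)"
    using l by (intro finite_measureI) (auto simp: emeasure_restrict_space fmeasurable_def space_restrict_space)
qed

lemma measurable_lebesgue_on_continuous:
  assumes "continuous_on UNIV F" "open \<Omega>"
  shows "F \<in> borel_measurable (lebesgue_on \<Omega>)"
  using assms by (intro continuous_imp_measurable_on_sets_lebesgue) (auto intro: continuous_on_subset)

lemma integrable_bounded_continuous:
  fixes F :: "'a::euclidean_space \<Rightarrow> 'b::euclidean_space"
  assumes "bounded \<Omega>" "open \<Omega>" "F \<in> borel_measurable (lebesgue_on \<Omega>)" "\<And>z. z \<in> \<Omega> \<Longrightarrow> norm (F z) \<le> B"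
  shows "integrable (lebesgue_on \<Omega>) F"
proof -
  interpret finite_measure "lebesgue_on \<Omega>" by (rule finite_measure_lebesgue_on(1)[OF assms(1,2)])
  have "AE z in lebesgue_on \<Omega>. norm (F z) \<le> B"
    by (rule AE_I2) (use assms(4) in \<open>simp add: space_restrict_space\<close>)
  then show ?thesis using assms(3) by (rule integrable_const_bound)
qed

lemma L2_bounded:
  assumes "bounded \<Omega>" "open \<Omega>" "F \<in> borel_measurable (lebesgue_on \<Omega>)" "\<And>z. z \<in> \<Omega> \<Longrightarrow> cmod (F z) \<le> B"
  shows "F \<in> L2 \<Omega>"
proof -
  have "integrable (lebesgue_on \<Omega>) (\<lambda>z. (cmod (F z))\<^sup>2)"
  proof (rule integrable_bounded_continuous[OF assms(1,2)])
    show "(\<lambda>z. (cmod (F z))\<^sup>2) \<in> borel_measurable (lebesgue_on \<Omega>)"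
      using assms(3) by measurable
    show "norm ((cmod (F z))\<^sup>2) \<le> B\<^sup>2" if "z \<in> \<Omega>" for z
      using power_mono[OF assms(4)[OF that], of 2] by simp
  qed
  then show ?thesis using assms(3) by (simp add: L2_def)
qed

lemma borel_measurable_cnj [measurable (raw)]:
  "f \<in> borel_measurable M \<Longrightarrow> (\<lambda>x. cnj (f x)) \<in> borel_measurable M"
  by (rule measurable_compose[OF _ borel_measurable_continuous_onI]) (auto intro: continuous_intros)

lemma L2_mult_integrable:
  assumes "u \<in> L2 \<Omega>" "v \<in> L2 \<Omega>"
  shows "integrable (lebesgue_on \<Omega>) (\<lambda>z. cmod (u z) * cmod (v z))" "integrable (lebesgue_on \<Omega>) (\<lambda>z. u z * cnj (v z))"
    "integrable (lebesgue_on \<Omega>) (\<lambda>z. u z * v z)"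
proof -
  have [measurable]: "u \<in> borel_measurable (lebesgue_on \<Omega>)" "v \<in> borel_measurable (lebesgue_on \<Omega>)"
    using assms by (auto simp: L2_def)
  have i: "integrable (lebesgue_on \<Omega>) (\<lambda>z. (cmod (u z))\<^sup>2 + (cmod (v z))\<^sup>2)"
    using assms by (auto simp: L2_def)
  have b: "x * y \<le> x\<^sup>2 + y\<^sup>2" for x y :: real
    using sum_squares_bound[of x y] zero_le_power2[of x] zero_le_power2[of y]
    by linarith
  show "integrable (lebesgue_on \<Omega>) (\<lambda>z. cmod (u z) * cmod (v z))"
    by (rule Bochner_Integration.integrable_bound[OF i]) (auto intro!: AE_I2 b)
  show "integrable (lebesgue_on \<Omega>) (\<lambda>z. u z * cnj (v z))"
    by (rule Bochner_Integration.integrable_bound[OF i]) (use b in \<open>auto intro!: AE_I2 simp: norm_mult\<close>)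
  show "integrable (lebesgue_on \<Omega>) (\<lambda>z. u z * v z)"
    by (rule Bochner_Integration.integrable_bound[OF i]) (use b in \<open>auto intro!: AE_I2 simp: norm_mult\<close>)
qed

lemma L2_const: "bounded \<Omega> \<Longrightarrow> open \<Omega> \<Longrightarrow> (\<lambda>z. c) \<in> L2 \<Omega>"
  by (rule L2_bounded[where B = "cmod c"]) auto

lemma L2_integrable:
  assumes "bounded \<Omega>" "open \<Omega>" "u \<in> L2 \<Omega>"
  shows "integrable (lebesgue_on \<Omega>) u"
  using L2_mult_integrable(3)[OF assms(3) L2_const[OF assms(1,2), of 1]] by simp

lemma L2_diff:
  assumes "u \<in> L2 \<Omega>" "v \<in> L2 \<Omega>"
  shows "(\<lambda>z. u z - v z) \<in> L2 \<Omega>"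
proof -
  have [measurable]: "u \<in> borel_measurable (lebesgue_on \<Omega>)" "v \<in> borel_measurable (lebesgue_on \<Omega>)"
    using assms by (auto simp: L2_def)
  have i: "integrable (lebesgue_on \<Omega>) (\<lambda>z. 2 * (cmod (u z))\<^sup>2 + 2 * (cmod (v z))\<^sup>2)"
    using assms by (auto simp: L2_def)
  have b: "(cmod (x - y))\<^sup>2 \<le> 2 * (cmod x)\<^sup>2 + 2 * (cmod y)\<^sup>2" for x y
  proof -
    have "(cmod (x - y))\<^sup>2 \<le> (cmod x + cmod y)\<^sup>2" by (intro power_mono norm_triangle_ineq4) auto
    also have "\<dots> \<le> 2 * (cmod x)\<^sup>2 + 2 * (cmod y)\<^sup>2"
      using sum_squares_bound[of "cmod x" "cmod y"] by (simp add: power2_sum)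
    finally show ?thesis .
  qed
  have "integrable (lebesgue_on \<Omega>) (\<lambda>z. (cmod (u z - v z))\<^sup>2)"
    by (rule Bochner_Integration.integrable_bound[OF i]) (auto intro!: AE_I2 order_trans[OF b])
  then show ?thesis by (auto simp: L2_def)
qed

lemma L2_norm_nonneg: "L2_norm \<Omega> f \<ge> 0"
  by (simp add: L2_norm_def)

lemma L2_norm_power2: "(L2_norm \<Omega> f)\<^sup>2 = (LINT z|lebesgue_on \<Omega>. (cmod (f z))\<^sup>2)"
  by (simp add: L2_norm_def)

text \<open>Integrate \<open>2 |u v| \<le> t |u|\<^sup>2 + |v|\<^sup>2 / t\<close> and optimise over \<open>t\<close>.\<close>

lemma L2_Cauchy_Schwarz:
  assumes "u \<in> L2 \<Omega>" "v \<in> L2 \<Omega>"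
  shows "cmod (L2_inner \<Omega> u v) \<le> L2_norm \<Omega> u * L2_norm \<Omega> v"
proof -
  define a b where "a = L2_norm \<Omega> u" and "b = L2_norm \<Omega> v"
  have ab: "a \<ge> 0" "b \<ge> 0" by (auto simp: a_def b_def L2_norm_nonneg)
  have iu: "integrable (lebesgue_on \<Omega>) (\<lambda>z. (cmod (u z))\<^sup>2)" and iv: "integrable (lebesgue_on \<Omega>) (\<lambda>z. (cmod (v z))\<^sup>2)"
    using assms by (auto simp: L2_def)
  have t: "cmod (L2_inner \<Omega> u v) \<le> (t * a\<^sup>2 + b\<^sup>2 / t) / 2" if "t > 0" for t
  proof -
    have "cmod (L2_inner \<Omega> u v) \<le> (LINT z|lebesgue_on \<Omega>. (t * (cmod (u z))\<^sup>2 + (cmod (v z))\<^sup>2 / t) / 2)"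
      unfolding L2_inner_def
    proof (rule Bochner_Integration.integral_norm_bound_integral)
      show "integrable (lebesgue_on \<Omega>) (\<lambda>z. u z * cnj (v z))" by (rule L2_mult_integrable[OF assms])
      show "integrable (lebesgue_on \<Omega>) (\<lambda>z. (t * (cmod (u z))\<^sup>2 + (cmod (v z))\<^sup>2 / t) / 2)"
        using iu iv by simp
      fix z
      have "0 \<le> (t * cmod (u z) - cmod (v z))\<^sup>2 / t" using that by simp
      also have "\<dots> = t * (cmod (u z))\<^sup>2 + (cmod (v z))\<^sup>2 / t - 2 * (cmod (u z) * cmod (v z))"
        using that by (simp add: power2_eq_square field_simps)
      finally show "norm (u z * cnj (v z)) \<le> (t * (cmod (u z))\<^sup>2 + (cmod (v z))\<^sup>2 / t) / 2"
        by (simp add: norm_mult)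
    qed
    also have "\<dots> = (t * a\<^sup>2 + b\<^sup>2 / t) / 2"
      using iu iv by (simp add: a_def b_def L2_norm_power2)
    finally show ?thesis .
  qed
  have d: "cmod (L2_inner \<Omega> u v) \<le> (a + d) * (b + d)" if "d > 0" for d
  proof -
    \<comment> \<open>The optimal value is \<open>b / a\<close>; the positive \<open>d\<close> keeps it meaningful when a norm is zero.\<close>
    define t where "t = (b + d) / (a + d)"
    have "t > 0" using ab that by (simp add: t_def)
    have "t * a\<^sup>2 \<le> t * (a + d)\<^sup>2" using \<open>t > 0\<close> ab that by (intro mult_left_mono power_mono) auto
    also have "\<dots> = (a + d) * (b + d)" using ab that by (simp add: t_def power2_eq_square)
    finally have 1: "t * a\<^sup>2 \<le> (a + d) * (b + d)" .
    have "b\<^sup>2 / t \<le> (b + d)\<^sup>2 / t" using \<open>t > 0\<close> ab that by (intro divide_right_mono power_mono) auto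
    also have "\<dots> = (a + d) * (b + d)" using ab that by (simp add: t_def power2_eq_square field_simps)
    finally show ?thesis using 1 t[OF \<open>t > 0\<close>] by simp
  qed
  have "((\<lambda>d. (a + d) * (b + d)) \<longlongrightarrow> (a + 0) * (b + 0)) (at_right 0)"
    by (intro tendsto_intros)
  then have "cmod (L2_inner \<Omega> u v) \<le> (a + 0) * (b + 0)"
    by (rule tendsto_lowerbound) (use d in \<open>auto simp: eventually_at_right_field intro!: exI[of _ 1]\<close>)
  then show ?thesis by (simp add: a_def b_def)
qed

lemma L2_inner_diff_right:
  assumes "u \<in> L2 \<Omega>" "v \<in> L2 \<Omega>" "w \<in> L2 \<Omega>"
  shows "L2_inner \<Omega> u (\<lambda>z. v z - w z) = L2_inner \<Omega> u v - L2_inner \<Omega> u w"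
  unfolding L2_inner_def
  using Bochner_Integration.integral_diff[OF L2_mult_integrable(2)[OF assms(1,2)] L2_mult_integrable(2)[OF assms(1,3)]]
  by (simp only: complex_cnj_diff right_diff_distrib)

lemma L2_inner_tendsto:
  assumes "u \<in> L2 \<Omega>" "\<And>k. v k \<in> L2 \<Omega>" "w \<in> L2 \<Omega>" "(\<lambda>k. L2_norm \<Omega> (\<lambda>z. v k z - w z)) \<longlonglongrightarrow> 0"
  shows "(\<lambda>k. L2_inner \<Omega> u (v k)) \<longlonglongrightarrow> L2_inner \<Omega> u w"
proof -
  have 1: "(\<lambda>k. L2_norm \<Omega> u * L2_norm \<Omega> (\<lambda>z. v k z - w z)) \<longlonglongrightarrow> 0"
    by (rule tendsto_mult_right_zero[OF assms(4)])
  have 2: "norm (L2_inner \<Omega> u (v k) - L2_inner \<Omega> u w) \<le> L2_norm \<Omega> u * L2_norm \<Omega> (\<lambda>z. v k z - w z)" for k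
    using L2_Cauchy_Schwarz[OF assms(1) L2_diff[OF assms(2,3)], of k]
    by (simp only: L2_inner_diff_right[OF assms(1,2,3)])
  have "(\<lambda>k. L2_inner \<Omega> u (v k) - L2_inner \<Omega> u w) \<longlonglongrightarrow> 0"
    by (rule Lim_null_comparison[OF always_eventually[OF allI[OF 2]] 1])
  then show ?thesis by (rule LIM_zero_cancel)
qed

section \<open>Wirtinger calculus and integration by parts\<close>

lemma frechet_derivative_mult:
  fixes f g :: "'a::real_normed_vector \<Rightarrow> complex"
  assumes "f differentiable (at z)" "g differentiable (at z)"
  shows "frechet_derivative (\<lambda>z. f z * g z) (at z) v =
     f z * frechet_derivative g (at z) v + frechet_derivative f (at z) v * g z"
proof -
  have "((\<lambda>z. f z * g z) has_derivative (\<lambda>v. f z * frechet_derivative g (at z) v + frechet_derivative f (at z) v * g z)) (at z)"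
    using assms by (intro has_derivative_mult differentiableD)
  from fun_cong[OF frechet_derivative_at[OF this], of v] show ?thesis by simp
qed

lemma frechet_derivative_linear_comp:
  assumes "bounded_linear L" "f differentiable (at z)"
  shows "frechet_derivative (\<lambda>z. L (f z)) (at z) v = L (frechet_derivative f (at z) v)"
proof -
  have "((\<lambda>z. L (f z)) has_derivative (\<lambda>v. L (frechet_derivative f (at z) v))) (at z)"
    using assms by (intro bounded_linear.has_derivative[OF assms(1)] differentiableD)
  from fun_cong[OF frechet_derivative_at[OF this], of v] show ?thesis by simp
qed

lemmas frechet_derivative_cnj = frechet_derivative_linear_comp[OF bounded_linear_cnj]
lemmas frechet_derivative_of_real = frechet_derivative_linear_comp[OF bounded_linear_of_real]

lemma d_zbar_mult:
  assumes "f differentiable (at z)" "g differentiable (at z)"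
  shows "d_zbar k (\<lambda>z. f z * g z) z = f z * d_zbar k g z + d_zbar k f z * g z"
  by (simp add: d_zbar_def frechet_derivative_mult[OF assms] field_simps)

lemma d_z_mult:
  assumes "f differentiable (at z)" "g differentiable (at z)"
  shows "d_z k (\<lambda>z. f z * g z) z = f z * d_z k g z + d_z k f z * g z"
  by (simp add: d_z_def frechet_derivative_mult[OF assms] field_simps)

lemma d_z_cnj:
  assumes "f differentiable (at z)"
  shows "d_z k (\<lambda>z. cnj (f z)) z = cnj (d_zbar k f z)" "d_zbar k (\<lambda>z. cnj (f z)) z = cnj (d_z k f z)"
  by (simp_all add: d_z_def d_zbar_def frechet_derivative_cnj[OF assms])

lemma d_z_continuous:
  assumes "Ck_on (Suc 0) S f"
  shows "continuous_on S (d_z k f)" "continuous_on S (d_zbar k f)"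
  unfolding d_z_def[abs_def] d_zbar_def[abs_def] using assms by (auto intro!: continuous_intros)

lemma d_z_eq_0_outside:
  assumes "closed K" "\<And>x. x \<notin> K \<Longrightarrow> F x = 0" "x \<notin> K"
  shows "d_z k F x = 0" "d_zbar k F x = 0"
  using frechet_derivative_eq_0_outside(2)[of K F x, OF assms] by (simp_all add: d_z_def d_zbar_def)

lemma integrable_compact_support_on:
  fixes F :: "'a::euclidean_space \<Rightarrow> complex"
  assumes "continuous_on UNIV F" "bounded \<Omega>" "open \<Omega>" "compact K" "\<And>x. x \<notin> K \<Longrightarrow> F x = 0"
  shows "integrable (lebesgue_on \<Omega>) F"
proof -
  obtain B where "B \<ge> 0" "\<And>x. norm (F x) \<le> B" 
    using bounded_compact_support[OF assms(1,4,5)] by metis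
  then show ?thesis
    using assms by (intro integrable_bounded_continuous measurable_lebesgue_on_continuous) auto
qed

lemma integral_by_parts_direction:
  fixes F :: "'a::euclidean_space \<Rightarrow> complex"
  assumes F: "Ck_on (Suc 0) UNIV F" and \<phi>: "Ck_on (Suc 0) UNIV \<phi>"
    and K: "compact K" "\<And>x. x \<notin> K \<Longrightarrow> \<phi> x = 0" and \<Omega>: "bounded \<Omega>" "open \<Omega>" "K \<subseteq> \<Omega>"
  shows "(LINT z|lebesgue_on \<Omega>. frechet_derivative F (at z) v * \<phi> z)
     = - (LINT z|lebesgue_on \<Omega>. F z * frechet_derivative \<phi> (at z) v)" (is "integral\<^sup>L _ ?a = - integral\<^sup>L _ ?b")
    and "integrable (lebesgue_on \<Omega>) (\<lambda>z. frechet_derivative F (at z) v * \<phi> z)"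
    and "integrable (lebesgue_on \<Omega>) (\<lambda>z. F z * frechet_derivative \<phi> (at z) v)"
proof -
  have c: "continuous_on UNIV F" "continuous_on UNIV \<phi>" using Ck_on_Suc_imp[OF F] Ck_on_Suc_imp[OF \<phi>] by auto
  have cd: "continuous_on UNIV (\<lambda>x. frechet_derivative F (at x) v)" "continuous_on UNIV (\<lambda>x. frechet_derivative \<phi> (at x) v)"
    using F \<phi> by auto
  have KD: "frechet_derivative \<phi> (at x) v = 0" if "x \<notin> K" for x
    using frechet_derivative_eq_0_outside(2)[of K \<phi> x] K that by (simp add: compact_imp_closed)
  show ia: "integrable (lebesgue_on \<Omega>) ?a"
    by (rule integrable_compact_support_on[OF _ \<Omega>(1,2) K(1)]) (auto intro!: continuous_intros c cd K)
  show ib: "integrable (lebesgue_on \<Omega>) ?b"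
    by (rule integrable_compact_support_on[OF _ \<Omega>(1,2) K(1)]) (auto intro!: continuous_intros c cd KD)
  have notK: "z \<notin> K" if "z \<notin> \<Omega>" for z using that \<Omega>(3) by blast
  have P: "Ck_on (Suc 0) UNIV (\<lambda>z. F z * \<phi> z)" by (intro Ck_on_mult open_UNIV F \<phi>)
  have e: "frechet_derivative (\<lambda>z. F z * \<phi> z) (at z) v = ?b z + ?a z" for z
    using F \<phi> by (intro frechet_derivative_mult) auto
  have "(LINT z|lebesgue_on \<Omega>. ?b z + ?a z) = (LINT z|lborel. ?b z + ?a z)"
    using \<Omega> by (intro integral_lebesgue_on_support)
      (auto intro!: continuous_intros c cd simp: K KD notK finite_measure_lebesgue_on)
  also have "\<dots> = (LINT z|lborel. frechet_derivative (\<lambda>z. F z * \<phi> z) (at z) v)" by (simp only: e)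
  also have "\<dots> = 0"
    by (rule integral_frechet_derivative_eq_0[OF P K(1)]) (simp add: K)
  finally show "integral\<^sup>L (lebesgue_on \<Omega>) ?a = - integral\<^sup>L (lebesgue_on \<Omega>) ?b"
    using ia ib by (simp add: eq_neg_iff_add_eq_0 add.commute)
qed

lemma integral_by_parts:
  assumes F: "Ck_on (Suc 0) UNIV F" and \<phi>: "Ck_on (Suc 0) UNIV \<phi>"
    and K: "compact K" "\<And>x. x \<notin> K \<Longrightarrow> \<phi> x = 0" and \<Omega>: "bounded \<Omega>" "open \<Omega>" "K \<subseteq> \<Omega>"
  shows "(LINT z|lebesgue_on \<Omega>. d_zbar k F z * \<phi> z) = - (LINT z|lebesgue_on \<Omega>. F z * d_zbar k \<phi> z)"
    and "(LINT z|lebesgue_on \<Omega>. d_z k F z * \<phi> z) = - (LINT z|lebesgue_on \<Omega>. F z * d_z k \<phi> z)"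
proof -
  note P = integral_by_parts_direction[OF F \<phi> K \<Omega>]
  have l: "d_zbar k F z * \<phi> z = (1/2) * (frechet_derivative F (at z) (axis k 1) * \<phi> z) + (\<i> / 2) * (frechet_derivative F (at z) (axis k \<i>) * \<phi> z)"
    "F z * d_zbar k \<phi> z = (1/2) * (F z * frechet_derivative \<phi> (at z) (axis k 1)) + (\<i> / 2) * (F z * frechet_derivative \<phi> (at z) (axis k \<i>))"
    "d_z k F z * \<phi> z = (1/2) * (frechet_derivative F (at z) (axis k 1) * \<phi> z) - (\<i> / 2) * (frechet_derivative F (at z) (axis k \<i>) * \<phi> z)"
    "F z * d_z k \<phi> z = (1/2) * (F z * frechet_derivative \<phi> (at z) (axis k 1)) - (\<i> / 2) * (F z * frechet_derivative \<phi> (at z) (axis k \<i>))" for z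
    by (simp_all add: d_zbar_def d_z_def field_simps)
  show "(LINT z|lebesgue_on \<Omega>. d_zbar k F z * \<phi> z) = - (LINT z|lebesgue_on \<Omega>. F z * d_zbar k \<phi> z)"
    and "(LINT z|lebesgue_on \<Omega>. d_z k F z * \<phi> z) = - (LINT z|lebesgue_on \<Omega>. F z * d_z k \<phi> z)"
    unfolding l using P(2,3) by (simp_all add: P(1))
qed

lemma test_functionsD:
  assumes "\<phi> \<in> test_functions \<Omega>"
  shows "Ck_on k UNIV \<phi>" "compact (closure {z. \<phi> z \<noteq> 0})" "closure {z. \<phi> z \<noteq> 0} \<subseteq> \<Omega>"
    "x \<notin> closure {z. \<phi> z \<noteq> 0} \<Longrightarrow> \<phi> x = 0"
  using assms closure_subset[of "{z. \<phi> z \<noteq> 0}"] by (auto simp: test_functions_def)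

section \<open>The weak Cauchy--Riemann operator on \<open>C\<^sup>1\<close> data\<close>

text \<open>Classical and distributional derivatives agree for \<open>C\<^sup>1\<close> coefficients. The coefficients may be
nonzero on the boundary of \<open>\<Omega>\<close>, since the test functions are not.\<close>

lemma has_dbar_C1:
  fixes f :: "'n::{finite,linorder} form"
  assumes \<Omega>: "bounded \<Omega>" "open \<Omega>"
    and f: "\<And>J. card J = q \<Longrightarrow> Ck_on (Suc 0) UNIV (f J)"
    and K: "compact K" "\<And>J x. card J = q \<Longrightarrow> x \<notin> K \<Longrightarrow> f J x = 0"
  shows "has_dbar \<Omega> q f (\<lambda>J z. \<Sum>k\<in>J. (-1) ^ card {i\<in>J. i < k} * d_zbar k (f (J - {k})) z)"
proof -
  have cJ: "card (J - {k}) = q" if "card J = Suc q" "k \<in> J" for J :: "'n set" and k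
    using that by simp
  have L2c: "F \<in> L2 \<Omega>" if c: "continuous_on UNIV F" and z: "\<And>x. x \<notin> K \<Longrightarrow> F x = 0" for F :: "(complex, 'n) vec \<Rightarrow> complex"
  proof -
    obtain B where "B \<ge> 0" "\<And>x. cmod (F x) \<le> B" 
      using bounded_compact_support[OF c K(1)] z by metis
    then show ?thesis using \<Omega> c by (intro L2_bounded measurable_lebesgue_on_continuous) auto
  qed
  have cf: "continuous_on UNIV (f J)" if "card J = q" for J
    using Ck_on_Suc_imp[OF f[OF that]] by simp
  have z: "d_zbar k (f J) x = 0" if "card J = q" "x \<notin> K" for J k x
    by (rule d_z_eq_0_outside(2)[OF compact_imp_closed[OF K(1)] K(2)[OF that(1)] that(2)])
  show ?thesis
    unfolding has_dbar_def
  proof (intro conjI allI impI ballI)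
    show "f \<in> L2_forms \<Omega> q"
      using cf K(2) by (auto simp: L2_forms_def intro!: L2c)
    show "(\<lambda>J z. \<Sum>k\<in>J. (-1) ^ card {i\<in>J. i < k} * d_zbar k (f (J - {k})) z) \<in> L2_forms \<Omega> (Suc q)"
      by (auto simp: L2_forms_def z cJ intro!: L2c continuous_intros d_z_continuous f sum.neutral)
    fix J :: "'n set" and \<phi> assume J: "card J = Suc q" and \<phi>: "\<phi> \<in> test_functions \<Omega>"
    obtain S where \<phi>': "\<And>k. Ck_on k UNIV \<phi>" "compact S" "S \<subseteq> \<Omega>" "\<And>x. x \<notin> S \<Longrightarrow> \<phi> x = 0"
      using test_functionsD[OF \<phi>] by blast
    have c\<phi>: "continuous_on UNIV \<phi>" "continuous_on UNIV (d_zbar k \<phi>)" for k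
      using \<phi>'(1)[of 0] d_z_continuous[OF \<phi>'(1)] by auto
    have z\<phi>: "d_zbar k \<phi> x = 0" if "x \<notin> S" for k x
      by (rule d_z_eq_0_outside(2)[OF compact_imp_closed[OF \<phi>'(2)] \<phi>'(4) that])
    have i1: "integrable (lebesgue_on \<Omega>) (\<lambda>z. d_zbar k (f (J - {k})) z * \<phi> z)" if "k \<in> J" for k
      by (rule integrable_compact_support_on[OF _ \<Omega> \<phi>'(2)],
          rule continuous_on_mult[OF d_z_continuous(2)[OF f[OF cJ[OF J that]]] c\<phi>(1)]) (simp add: \<phi>'(4))
    have i2: "integrable (lebesgue_on \<Omega>) (\<lambda>z. f (J - {k}) z * d_zbar k \<phi> z)" if "k \<in> J" for k
      by (rule integrable_compact_support_on[OF _ \<Omega> \<phi>'(2)],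
          rule continuous_on_mult[OF cf[OF cJ[OF J that]] c\<phi>(2)]) (simp add: z\<phi>)
    have "(LINT z|lebesgue_on \<Omega>. (\<Sum>k\<in>J. (-1) ^ card {i\<in>J. i < k} * d_zbar k (f (J - {k})) z) * \<phi> z)
      = (LINT z|lebesgue_on \<Omega>. (\<Sum>k\<in>J. (-1) ^ card {i\<in>J. i < k} * (d_zbar k (f (J - {k})) z * \<phi> z)))"
      by (simp add: sum_distrib_right mult.assoc)
    also have "\<dots> = (\<Sum>k\<in>J. (-1) ^ card {i\<in>J. i < k} * (LINT z|lebesgue_on \<Omega>. d_zbar k (f (J - {k})) z * \<phi> z))"
      using i1 by (subst Bochner_Integration.integral_sum) auto
    also have "\<dots> = (\<Sum>k\<in>J. (-1) ^ card {i\<in>J. i < k} * - (LINT z|lebesgue_on \<Omega>. f (J - {k}) z * d_zbar k \<phi> z))"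
      using cJ[OF J] \<phi>' by (intro sum.cong refl arg_cong2[where f = "(*)"] integral_by_parts(1)[OF f _ _ _ \<Omega>]) auto
    also have "\<dots> = - (LINT z|lebesgue_on \<Omega>. (\<Sum>k\<in>J. (-1) ^ card {i\<in>J. i < k} * (f (J - {k}) z * d_zbar k \<phi> z)))"
      using i2 by (subst Bochner_Integration.integral_sum) (auto simp: sum_negf)
    finally show "(LINT z|lebesgue_on \<Omega>. (\<Sum>k\<in>J. (-1) ^ card {i\<in>J. i < k} * d_zbar k (f (J - {k})) z) * \<phi> z)
       = - (LINT z|lebesgue_on \<Omega>. (\<Sum>k\<in>J. (-1) ^ card {i\<in>J. i < k} * f (J - {k}) z * d_zbar k \<phi> z))"
      by (simp add: mult.assoc)
  qed
qed

lemma has_dbar_L2: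
  assumes "has_dbar \<Omega> q u v"
  shows "card J = q \<Longrightarrow> u J \<in> L2 \<Omega>" "card J = Suc q \<Longrightarrow> v J \<in> L2 \<Omega>"
proof -
  have *: "u \<in> L2_forms \<Omega> q \<and> v \<in> L2_forms \<Omega> (Suc q)" using assms unfolding has_dbar_def by argo
  show "card J = q \<Longrightarrow> u J \<in> L2 \<Omega>" "card J = Suc q \<Longrightarrow> v J \<in> L2 \<Omega>"
    using * by (simp_all add: L2_forms_def)
qed

lemma has_dbar_weak:
  assumes "has_dbar \<Omega> q u v" "card J = Suc q" "\<phi> \<in> test_functions \<Omega>"
  shows "(LINT z|lebesgue_on \<Omega>. v J z * \<phi> z) =
     - (LINT z|lebesgue_on \<Omega>. (\<Sum>k\<in>J. (-1) ^ card {i\<in>J. i < k} * u (J - {k}) z * d_zbar k \<phi> z))"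
  using conjunct2[OF conjunct2[OF assms(1)[unfolded has_dbar_def]], rule_format, OF assms(2,3)] .

text \<open>The weak equation extends from test functions to \<open>C\<^sup>1\<close> functions with compact support in \<open>\<Omega>\<close>, by
mollification and dominated convergence. This is needed because a \<open>C\<^sup>2\<close> boundary gives test
forms that are only \<open>C\<^sup>1\<close>.\<close>

lemma has_dbar_test_C1:
  fixes u v :: "'n::{finite,linorder} form"
  assumes uv: "has_dbar \<Omega> q u v" and \<Omega>: "bounded \<Omega>" "open \<Omega>" and J: "card J = Suc q"
    and \<phi>: "Ck_on (Suc 0) UNIV \<phi>" and K: "compact K" "\<And>x. x \<notin> K \<Longrightarrow> \<phi> x = 0" "K \<subseteq> \<Omega>"
  shows "(LINT z|lebesgue_on \<Omega>. v J z * \<phi> z)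
     = - (LINT z|lebesgue_on \<Omega>. (\<Sum>k\<in>J. (-1) ^ card {i\<in>J. i < k} * u (J - {k}) z * d_zbar k \<phi> z))"
proof -
  have cJ: "card (J - {k}) = q" if "k \<in> J" for k
    using that J by simp
  have uL: "u (J - {k}) \<in> L2 \<Omega>" if "k \<in> J" for k
    by (rule has_dbar_L2(1)[OF uv cJ[OF that]])
  have vL: "v J \<in> L2 \<Omega>" by (rule has_dbar_L2(2)[OF uv J])
  have [measurable]: "v J \<in> borel_measurable (lebesgue_on \<Omega>)" using vL by (simp add: L2_def)
  have mu: "u (J - {k}) \<in> borel_measurable (lebesgue_on \<Omega>)" if "k \<in> J" for k
    using uL[OF that] by (simp add: L2_def)
  have "\<exists>\<Phi> B. C1_approximation \<Omega> \<phi> \<Phi> B"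
    by (rule C1_approx_test_functions[OF \<phi> K(1,2) \<Omega>(2) K(3)])
  then obtain \<Phi> B where "C1_approximation \<Omega> \<phi> \<Phi> B" by blast
  then have \<Phi>: "\<And>m. \<Phi> m \<in> test_functions \<Omega>"
    "\<And>x. (\<lambda>m. \<Phi> m x) \<longlonglongrightarrow> \<phi> x"
    "\<And>x v. (\<lambda>m. frechet_derivative (\<Phi> m) (at x) v) \<longlonglongrightarrow> frechet_derivative \<phi> (at x) v"
    "\<And>m x. norm (\<Phi> m x) \<le> B 0"
    "\<And>m x v. norm (frechet_derivative (\<Phi> m) (at x) v) \<le> B v"
    by (simp_all add: C1_approximation_def)
  have c\<Phi>: "continuous_on UNIV (\<Phi> m)" "continuous_on UNIV (d_zbar k (\<Phi> m))" for m k
    using test_functionsD(1)[OF \<Phi>(1), of 0] d_z_continuous[OF test_functionsD(1)[OF \<Phi>(1)]] by auto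
  have c\<phi>: "continuous_on UNIV \<phi>" "continuous_on UNIV (d_zbar k \<phi>)" for k
    using Ck_on_Suc_imp[OF \<phi>] d_z_continuous[OF \<phi>] by auto
  note m = measurable_lebesgue_on_continuous[OF c\<Phi>(1) \<Omega>(2)] measurable_lebesgue_on_continuous[OF c\<Phi>(2) \<Omega>(2)]
    measurable_lebesgue_on_continuous[OF c\<phi>(1) \<Omega>(2)] measurable_lebesgue_on_continuous[OF c\<phi>(2) \<Omega>(2)]
  have dt: "(\<lambda>m. d_zbar k (\<Phi> m) z) \<longlonglongrightarrow> d_zbar k \<phi> z" for k z
    unfolding d_zbar_def by (intro tendsto_intros \<Phi>) auto
  have db: "cmod (d_zbar k (\<Phi> m) z) \<le> B (axis k 1) + B (axis k \<i>)" for k m z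
  proof -
    let ?x = "frechet_derivative (\<Phi> m) (at z) (axis k 1)" and ?y = "frechet_derivative (\<Phi> m) (at z) (axis k \<i>)"
    have "cmod (d_zbar k (\<Phi> m) z) = cmod (?x + \<i> * ?y) / 2"
      unfolding d_zbar_def by (simp add: norm_divide)
    also have "\<dots> \<le> cmod (?x + \<i> * ?y)" by simp
    also have "\<dots> \<le> cmod ?x + cmod ?y"
      using norm_triangle_ineq[of ?x "\<i> * ?y"] by (simp add: norm_mult)
    also have "\<dots> \<le> B (axis k 1) + B (axis k \<i>)"
      by (intro add_mono \<Phi>(5))
    finally show ?thesis .
  qed
  have 1: "(\<lambda>m. LINT z|lebesgue_on \<Omega>. v J z * \<Phi> m z) \<longlonglongrightarrow> (LINT z|lebesgue_on \<Omega>. v J z * \<phi> z)"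
  proof (rule integral_dominated_convergence[where w = "\<lambda>z. cmod (v J z) * B 0"])
    show "integrable (lebesgue_on \<Omega>) (\<lambda>z. cmod (v J z) * B 0)"
      using L2_integrable[OF \<Omega> vL] by simp
  qed (use m \<Phi> in \<open>auto intro!: AE_I2 tendsto_intros mult_left_mono simp: norm_mult\<close>)
  have 2: "(\<lambda>m. LINT z|lebesgue_on \<Omega>. (\<Sum>k\<in>J. (-1) ^ card {i\<in>J. i < k} * u (J - {k}) z * d_zbar k (\<Phi> m) z))
     \<longlonglongrightarrow> (LINT z|lebesgue_on \<Omega>. (\<Sum>k\<in>J. (-1) ^ card {i\<in>J. i < k} * u (J - {k}) z * d_zbar k \<phi> z))"
  proof (rule integral_dominated_convergence[where w = "\<lambda>z. \<Sum>k\<in>J. cmod (u (J - {k}) z) * (B (axis k 1) + B (axis k \<i>))"])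
    show "integrable (lebesgue_on \<Omega>) (\<lambda>z. \<Sum>k\<in>J. cmod (u (J - {k}) z) * (B (axis k 1) + B (axis k \<i>)))"
      using L2_integrable[OF \<Omega> uL] by (intro Bochner_Integration.integrable_sum) auto
  qed (use m mu db dt in \<open>auto intro!: AE_I2 tendsto_intros mult_left_mono sum_norm_le borel_measurable_sum borel_measurable_times
      simp: norm_mult norm_power\<close>)
  have "(LINT z|lebesgue_on \<Omega>. v J z * \<Phi> m z)
     = - (LINT z|lebesgue_on \<Omega>. (\<Sum>k\<in>J. (-1) ^ card {i\<in>J. i < k} * u (J - {k}) z * d_zbar k (\<Phi> m) z))" for m
    by (rule has_dbar_weak[OF uv J \<Phi>(1)])
  then have "(\<lambda>m. LINT z|lebesgue_on \<Omega>. v J z * \<Phi> m z)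
     \<longlonglongrightarrow> - (LINT z|lebesgue_on \<Omega>. (\<Sum>k\<in>J. (-1) ^ card {i\<in>J. i < k} * u (J - {k}) z * d_zbar k \<phi> z))"
    using tendsto_minus[OF 2] by simp
  with 1 show ?thesis by (rule LIMSEQ_unique)
qed

section \<open>Tangential forms lie in the domain of the adjoint\<close>

definition insertion_sign :: "'n::{finite,linorder} \<Rightarrow> 'n set \<Rightarrow> complex" where
  "insertion_sign k J = (-1) ^ card {i\<in>J. i < k}"

text \<open>The \<open>L\<close> coefficient of the interior product of the form \<open>a\<close> with the vector \<open>x\<close>. With
\<open>x\<^sub>k = \<partial>\<rho>/\<partial>z\<^sub>k\<close> on the boundary it is the complex normal component of \<open>a\<close>.\<close>

definition contract :: "('n::{finite,linorder} \<Rightarrow> complex) \<Rightarrow> ('n set \<Rightarrow> complex) \<Rightarrow> 'n set \<Rightarrow> complex" where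
  "contract x a L = (\<Sum>k\<in>-L. insertion_sign k (insert k L) * x k * a (insert k L))"

definition formal_adjoint :: "'n::{finite,linorder} form \<Rightarrow> 'n form" where
  "formal_adjoint f L z = - (\<Sum>k\<in>-L. insertion_sign k (insert k L) * d_z k (f (insert k L)) z)"

lemma cnj_insertion_sign: "cnj (insertion_sign k J) = insertion_sign k J"
  by (simp add: insertion_sign_def)

lemma norm_insertion_sign: "cmod (insertion_sign k J) = 1"
  by (simp add: insertion_sign_def norm_power)

text \<open>Pairs of a set with one of its elements correspond to pairs of a smaller set with an element
outside it. This is the summation by parts that passes from \<open>dbar\<close> to its formal adjoint.\<close>

lemma sum_remove_insert:
  fixes X :: "'n::finite set \<Rightarrow> 'n \<Rightarrow> 'n set \<Rightarrow> complex"
  shows "(\<Sum>J | card J = Suc q. \<Sum>k\<in>J. X (J - {k}) k J) = (\<Sum>L | card L = q. \<Sum>k\<in>-L. X L k (insert k L))"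
proof -
  have "(\<Sum>J | card J = Suc q. \<Sum>k\<in>J. X (J - {k}) k J) = (\<Sum>(J, k)\<in>(SIGMA J:{J. card J = Suc q}. J). X (J - {k}) k J)"
    by (rule sum.Sigma) auto
  also have "\<dots> = (\<Sum>(L, k)\<in>(SIGMA L:{L. card L = q}. - L). X L k (insert k L))"
    by (rule sum.reindex_bij_witness[where i = "\<lambda>(L, k). (insert k L, k)" and j = "\<lambda>(J, k). (J - {k}, k)"])
      (auto simp: insert_absorb)
  also have "\<dots> = (\<Sum>L | card L = q. \<Sum>k\<in>-L. X L k (insert k L))"
    by (rule sum.Sigma[symmetric]) auto
  finally show ?thesis .
qed

lemma L2_compact_support:
  fixes F :: "complex^'n::finite \<Rightarrow> complex"
  assumes "bounded \<Omega>" "open \<Omega>" "continuous_on UNIV F" "compact K" "\<And>x. x \<notin> K \<Longrightarrow> F x = 0"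
  shows "F \<in> L2 \<Omega>"
proof -
  obtain B where "\<And>x. cmod (F x) \<le> B"
    using bounded_compact_support[OF assms(3,4)] assms(5) by metis
  then show ?thesis using assms by (intro L2_bounded measurable_lebesgue_on_continuous) auto
qed

lemma formal_adjoint_continuous:
  assumes "\<And>J. card J = Suc q \<Longrightarrow> Ck_on (Suc 0) UNIV (f J)" "card L = q"
  shows "continuous_on UNIV (formal_adjoint f L)"
proof -
  have "continuous_on UNIV (d_z k (f (insert k L)))" if "k \<in> - L" for k
    using assms that by (intro d_z_continuous) auto
  then show ?thesis unfolding formal_adjoint_def[abs_def] by (intro continuous_intros) auto
qed

text \<open>A function of \<open>\<rho>\<close> that vanishes where \<open>\<rho> \<ge> - 1 / (m + 1)\<close> and tends to one where \<open>\<rho> < 0\<close>.\<close>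

definition interior_cutoff :: "('a \<Rightarrow> real) \<Rightarrow> nat \<Rightarrow> 'a \<Rightarrow> real" where
  "interior_cutoff \<rho> m z = flat_poly 1 (- 1 + (- real (Suc m)) * \<rho> z)"

lemma interior_cutoff_bounds: "0 \<le> interior_cutoff \<rho> m z" "interior_cutoff \<rho> m z \<le> 1"
  by (auto simp: interior_cutoff_def flat_poly_def)

lemma interior_cutoff_tendsto:
  assumes "\<rho> z < 0"
  shows "(\<lambda>m. interior_cutoff \<rho> m z) \<longlonglongrightarrow> 1"
proof -
  have "filterlim (\<lambda>m. (- \<rho> z) * real (Suc m)) at_top sequentially"
    using assms
    by (intro filterlim_tendsto_pos_mult_at_top[OF tendsto_const] filterlim_compose[OF filterlim_real_sequentially filterlim_Suc]) auto
  moreover have "(\<lambda>m. (- \<rho> z) * real (Suc m)) = (\<lambda>m. (- real (Suc m)) * \<rho> z)"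
    by (simp add: fun_eq_iff algebra_simps)
  ultimately have *: "filterlim (\<lambda>m. - 1 + (- real (Suc m)) * \<rho> z) at_top sequentially"
    by (intro filterlim_tendsto_add_at_top[OF tendsto_const]) simp
  have "((\<lambda>t. exp (- (1 / t))) \<longlongrightarrow> exp (- 0)) (at_top :: real filter)"
    by (intro tendsto_intros tendsto_divide_0[OF tendsto_const] filterlim_at_top_imp_at_infinity filterlim_ident)
  then have "((\<lambda>t. exp (- (1 / t))) \<longlongrightarrow> 1) (at_top :: real filter)" by simp
  then have "(flat_poly 1 \<longlongrightarrow> 1) at_top"
    by (rule Lim_transform_eventually)
      (auto simp: flat_poly_def eventually_at_top_dense intro!: exI[of _ 0])
  from filterlim_compose[OF this *] show ?thesis by (simp add: interior_cutoff_def)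
qed

lemma interior_cutoff_C1:
  assumes "open U" "Ck_on (Suc 0) U \<rho>"
  shows "Ck_on (Suc 0) U (interior_cutoff \<rho> m)"
  unfolding interior_cutoff_def[abs_def]
proof (rule C1_on_flat_poly[OF assms(1)])
  show "Ck_on (Suc 0) U (\<lambda>z. - 1 + (- real (Suc m)) * \<rho> z)"
    by (intro Ck_on_add Ck_on_mult Ck_on_const assms)
qed

text \<open>The gradient of the cutoff is a real multiple of the gradient of \<open>\<rho>\<close>; only the direction matters,
since tangential forms annihilate it.\<close>

lemma interior_cutoff_d_zbar:
  assumes "\<rho> differentiable (at z)"
  obtains c where "\<And>k. d_zbar k (\<lambda>z. complex_of_real (interior_cutoff \<rho> m z)) z = complex_of_real c * d_zbar k (\<lambda>z. complex_of_real (\<rho> z)) z"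
proof -
  let ?D = "frechet_derivative \<rho> (at z)"
  have "((\<lambda>z. - 1 + (- real (Suc m)) * \<rho> z) has_derivative (\<lambda>v. (- real (Suc m)) * ?D v)) (at z)"
    using differentiableD[OF assms] by (auto intro!: derivative_eq_intros)
  from flat_poly_has_derivative[OF this, of 1]
  have h: "(interior_cutoff \<rho> m has_derivative (\<lambda>v. flat_poly ([:0, 0, 1:] * (1 - pderiv 1)) (- 1 + (- real (Suc m)) * \<rho> z) * ((- real (Suc m)) * ?D v))) (at z)"
    unfolding interior_cutoff_def[abs_def] .
  define c where "c = flat_poly ([:0, 0, 1:] * (1 - pderiv 1)) (- 1 + (- real (Suc m)) * \<rho> z) * (- real (Suc m))"
  have e: "frechet_derivative (interior_cutoff \<rho> m) (at z) v = c * ?D v" for v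
    using fun_cong[OF frechet_derivative_at[OF h], of v] by (simp only: c_def mult.assoc)
  have d: "interior_cutoff \<rho> m differentiable (at z)" using h by (auto simp: differentiable_def)
  show ?thesis
  proof (rule that[of c])
    show "d_zbar k (\<lambda>z. complex_of_real (interior_cutoff \<rho> m z)) z = complex_of_real c * d_zbar k (\<lambda>z. complex_of_real (\<rho> z)) z" for k
      by (simp add: d_zbar_def frechet_derivative_of_real[OF d] frechet_derivative_of_real[OF assms] e field_simps)
  qed
qed

text \<open>Cut \<open>f\<close> off inside \<open>\<Omega>\<close> by a function of \<open>\<rho>\<close> and use it as a test form for \<open>dbar u = v\<close>. The
derivatives of the cutoff enter only through the contraction of \<open>f\<close> with \<open>\<partial>\<rho>\<close>, which is zero.
Hence the identity for the truncated form has no boundary error, and dominated convergence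
removes the truncation.\<close>

lemma tangential_in_adjoint_domain:
  fixes f :: "'n::{finite,linorder} form"
  assumes \<Omega>: "bounded \<Omega>" "open \<Omega>"
    and f: "\<And>J. card J = Suc q \<Longrightarrow> Ck_on (Suc 0) UNIV (f J)"
    and K: "compact K" "K \<subseteq> U" "\<And>J x. card J = Suc q \<Longrightarrow> x \<notin> K \<Longrightarrow> f J x = 0"
    and U: "open U" "Ck_on (Suc 0) U \<rho>" "\<Omega> \<inter> U = {x\<in>U. \<rho> x < 0}"
    and tangential: "\<And>L z. card L = q \<Longrightarrow> z \<in> K \<Longrightarrow>
      contract (\<lambda>k. d_z k (\<lambda>z. complex_of_real (\<rho> z)) z) (\<lambda>J. f J z) L = 0"
  shows "has_dbar_adjoint \<Omega> (Suc q) f (formal_adjoint f)"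
proof -
  let ?\<psi> = "\<lambda>m z. complex_of_real (interior_cutoff \<rho> m z)"
  define \<phi> where "\<phi> m J z = ?\<psi> m z * cnj (f J z)" for m J z
  have K': "closed K" using K(1) by (rule compact_imp_closed)
  have cf: "continuous_on UNIV (f J)" if "card J = Suc q" for J
    using Ck_on_Suc_imp[OF f[OF that]] by simp
  have cI: "card (insert k L) = Suc q" if "card L = q" "k \<in> - L" for k and L :: "'n set"
    using that by simp
  have zd: "d_z k (f J) x = 0" if "card J = Suc q" "x \<notin> K" for J k x
    by (rule d_z_eq_0_outside(1)[OF K' K(3)[OF that(1)] that(2)])
  have zh: "formal_adjoint f L x = 0" if "card L = q" "x \<notin> K" for L x
    using that by (simp add: formal_adjoint_def zd cI)
  have fL: "f J \<in> L2 \<Omega>" if "card J = Suc q" for J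
    by (rule L2_compact_support[OF \<Omega> cf[OF that] K(1) K(3)[OF that]])
  have hL: "formal_adjoint f L \<in> L2 \<Omega>" if "card L = q" for L
    by (rule L2_compact_support[OF \<Omega> formal_adjoint_continuous[OF f that] K(1) zh[OF that]])
  have \<phi>1: "Ck_on (Suc 0) UNIV (\<phi> m J)" if "card J = Suc q" for m J
    unfolding \<phi>_def[abs_def]
    by (rule Ck_on_cutoff[OF U(1) K' K(2) Ck_on_of_real[OF U(1) interior_cutoff_C1[OF U(1,2)]] Ck_on_cnj[OF open_UNIV f[OF that]]])
      (simp add: K(3)[OF that])
  have sum_lin: "(\<Sum>k\<in>T. a * cnj (A k) + b * cnj (B k)) = a * cnj (\<Sum>k\<in>T. A k) + b * cnj (\<Sum>k\<in>T. B k)"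
    for a b A B and T :: "'n set"
    by (simp add: sum.distrib sum_distrib_left)
  \<comment> \<open>It contains the support of the truncated form and is a compact subset of \<open>\<Omega>\<close>, since \<open>\<rho> < 0\<close> there.\<close>
  define S where "S m = {z\<in>K. 1 \<le> (- real (Suc m)) * \<rho> z}" for m
  have cS: "compact (S m)" for m
  proof -
    have "continuous_on K \<rho>"
      using Ck_on_Suc_imp[OF U(2)] K(2) by (auto intro: continuous_on_subset)
    then have "continuous_on K (\<lambda>z. (- real (Suc m)) * \<rho> z)" by (intro continuous_intros)
    then have "closed (S m)"
      unfolding S_def by (rule continuous_on_closed_Collect_le[OF continuous_on_const _ K'])
    moreover have "K \<inter> S m = S m" by (auto simp: S_def)
    ultimately show ?thesis using compact_Int_closed[OF K(1), of "S m"] by simp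
  qed
  have SU: "S m \<subseteq> \<Omega>" for m
  proof
    fix z assume z: "z \<in> S m"
    have "\<rho> z < 0"
    proof (rule ccontr)
      assume "\<not> \<rho> z < 0"
      then have "0 \<le> real (Suc m) * \<rho> z" by (intro mult_nonneg_nonneg) auto
      then show False using z by (simp add: S_def del: of_nat_Suc)
    qed
    moreover have "z \<in> U" using z K(2) by (auto simp: S_def)
    ultimately show "z \<in> \<Omega>" using U(3) by blast
  qed
  have \<phi>0: "\<phi> m J z = 0" if "card J = Suc q" "z \<notin> S m" for m J z
  proof (cases "z \<in> K")
    case True
    then have "interior_cutoff \<rho> m z = 0" using that(2) by (simp add: S_def interior_cutoff_def flat_poly_def del: of_nat_Suc)
    then show ?thesis by (simp add: \<phi>_def)
  qed (simp add: \<phi>_def K(3)[OF that(1)])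
  have vanish: "\<phi> m J z = 0" "d_zbar k (\<phi> m J) z = 0" if "card J = Suc q" "z \<notin> K" for m J k z
  proof -
    have "x \<notin> K \<Longrightarrow> \<phi> m J x = 0" for x using K(3)[OF that(1)] by (simp add: \<phi>_def)
    then show "\<phi> m J z = 0" "d_zbar k (\<phi> m J) z = 0"
      using that(2) d_z_eq_0_outside(2)[OF K', of "\<phi> m J" z] by auto
  qed
  have "form_inner \<Omega> (Suc q) v f = form_inner \<Omega> q u (formal_adjoint f)" if uv: "has_dbar \<Omega> q u v" for u v
  proof -
    have uL: "u L \<in> L2 \<Omega>" if "card L = q" for L by (rule has_dbar_L2(1)[OF uv that])
    have vL: "v J \<in> L2 \<Omega>" if "card J = Suc q" for J by (rule has_dbar_L2(2)[OF uv that])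
    \<comment> \<open>The truncated identity says that \<open>P m\<close> has integral zero; the claim is that \<open>G\<close> has. They are
related by \<open>P m = (cutoff) G\<close>.\<close>
    define G where "G z = (\<Sum>J | card J = Suc q. v J z * cnj (f J z)) - (\<Sum>L | card L = q. u L z * cnj (formal_adjoint f L z))" for z
    define P where "P m z = (\<Sum>J | card J = Suc q. v J z * \<phi> m J z) +
        (\<Sum>J | card J = Suc q. \<Sum>k\<in>J. insertion_sign k J * u (J - {k}) z * d_zbar k (\<phi> m J) z)" for m z
    have \<phi>L: "\<phi> m J \<in> L2 \<Omega>" "d_zbar k (\<phi> m J) \<in> L2 \<Omega>" if "card J = Suc q" for m J k
    proof -
      have "continuous_on UNIV (\<phi> m J)" using Ck_on_Suc_imp[OF \<phi>1[OF that]] by simp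
      then show "\<phi> m J \<in> L2 \<Omega>"
        by (rule L2_compact_support[OF \<Omega> _ K(1)]) (rule vanish(1)[OF that])
      show "d_zbar k (\<phi> m J) \<in> L2 \<Omega>"
        by (rule L2_compact_support[OF \<Omega> d_z_continuous(2)[OF \<phi>1[OF that]] K(1)]) (rule vanish(2)[OF that])
    qed
    have i1: "integrable (lebesgue_on \<Omega>) (\<lambda>z. v J z * \<phi> m J z)" if "card J = Suc q" for m J
      by (rule L2_mult_integrable(3)[OF vL[OF that] \<phi>L(1)[OF that]])
    have i2: "integrable (lebesgue_on \<Omega>) (\<lambda>z. insertion_sign k J * u (J - {k}) z * d_zbar k (\<phi> m J) z)"
      if "card J = Suc q" "k \<in> J" for m J k
    proof -
      have "card (J - {k}) = q" using that by simp
      from L2_mult_integrable(3)[OF uL[OF this] \<phi>L(2)[OF that(1)]]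
      show ?thesis by (simp add: mult.assoc)
    qed
    have i3: "integrable (lebesgue_on \<Omega>) (\<lambda>z. \<Sum>k\<in>J. insertion_sign k J * u (J - {k}) z * d_zbar k (\<phi> m J) z)"
      if "card J = Suc q" for m J
      using i2[OF that] by (rule Bochner_Integration.integrable_sum)
    have P_int: "integrable (lebesgue_on \<Omega>) (P m)" for m
      unfolding P_def by (intro Bochner_Integration.integrable_add Bochner_Integration.integrable_sum i1 i3) auto
    have P0: "(LINT z|lebesgue_on \<Omega>. P m z) = 0" for m
    proof -
      have "(LINT z|lebesgue_on \<Omega>. P m z) = (\<Sum>J | card J = Suc q. (LINT z|lebesgue_on \<Omega>. v J z * \<phi> m J z)) +
        (\<Sum>J | card J = Suc q. (LINT z|lebesgue_on \<Omega>. (\<Sum>k\<in>J. insertion_sign k J * u (J - {k}) z * d_zbar k (\<phi> m J) z)))"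
        unfolding P_def
        by (subst Bochner_Integration.integral_add, (intro Bochner_Integration.integrable_sum i1 i3; simp)+,
            subst (1 2) Bochner_Integration.integral_sum) (auto intro: i1 i3)
      also have "\<dots> = (\<Sum>J | card J = Suc q. (LINT z|lebesgue_on \<Omega>. v J z * \<phi> m J z) +
         (LINT z|lebesgue_on \<Omega>. (\<Sum>k\<in>J. insertion_sign k J * u (J - {k}) z * d_zbar k (\<phi> m J) z)))"
        by (rule sum.distrib[symmetric])
      also have "\<dots> = 0"
      proof (rule sum.neutral, intro ballI)
        fix J :: "'n set" assume "J \<in> {J. card J = Suc q}"
        then have J: "card J = Suc q" by simp
        show "(LINT z|lebesgue_on \<Omega>. v J z * \<phi> m J z) +
         (LINT z|lebesgue_on \<Omega>. (\<Sum>k\<in>J. insertion_sign k J * u (J - {k}) z * d_zbar k (\<phi> m J) z)) = 0"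
          using has_dbar_test_C1[OF uv \<Omega> J \<phi>1[OF J] cS \<phi>0[OF J] SU, of m]
          by (simp add: insertion_sign_def)
      qed
      finally show ?thesis .
    qed
    have PG: "P m z = ?\<psi> m z * G z" for m z
    proof (cases "z \<in> K")
      case False
      have "P m z = 0" using False by (simp add: P_def vanish)
      moreover have "G z = 0" using False by (simp add: G_def K(3) zh)
      ultimately show ?thesis by simp
    next
      case True
      then have "z \<in> U" using K(2) by blast
      then have \<rho>d: "\<rho> differentiable (at z)" using U(2) by simp
      have \<psi>d: "?\<psi> m differentiable (at z)"
      proof -
        have "Ck_on (Suc 0) U (?\<psi> m)" by (rule Ck_on_of_real[OF U(1) interior_cutoff_C1[OF U(1,2)]])
        then show ?thesis using \<open>z \<in> U\<close> by simp
      qed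
      obtain c where c: "\<And>k. d_zbar k (?\<psi> m) z = complex_of_real c * d_zbar k (\<lambda>z. complex_of_real (\<rho> z)) z"
        using interior_cutoff_d_zbar[OF \<rho>d, of m] by metis
      have \<rho>c: "d_zbar k (\<lambda>z. complex_of_real (\<rho> z)) z = cnj (d_z k (\<lambda>z. complex_of_real (\<rho> z)) z)" for k
        by (simp add: d_zbar_def d_z_def frechet_derivative_of_real[OF \<rho>d])
      have d\<phi>: "d_zbar k (\<phi> m J) z = ?\<psi> m z * cnj (d_z k (f J) z) + c * cnj (d_z k (\<lambda>z. complex_of_real (\<rho> z)) z) * cnj (f J z)"
        if "card J = Suc q" for k J
      proof -
        have fd: "f J differentiable (at z)" using f[OF that] by simp
        have cfd: "(\<lambda>z. cnj (f J z)) differentiable (at z)"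
          using Ck_on_cnj[OF open_UNIV f[OF that]] by simp
        show ?thesis
          unfolding \<phi>_def[abs_def] d_zbar_mult[OF \<psi>d cfd] d_z_cnj(2)[OF fd] c \<rho>c by simp
      qed
      have "(\<Sum>J | card J = Suc q. \<Sum>k\<in>J. insertion_sign k J * u (J - {k}) z * d_zbar k (\<phi> m J) z)
        = (\<Sum>L | card L = q. \<Sum>k\<in>-L. insertion_sign k (insert k L) * u L z * d_zbar k (\<phi> m (insert k L)) z)"
        by (rule sum_remove_insert)
      also have "\<dots> = (\<Sum>L | card L = q. - (?\<psi> m z * (u L z * cnj (formal_adjoint f L z))))"
      proof (rule sum.cong[OF refl])
        fix L :: "'n set" assume "L \<in> {L. card L = q}"
        then have L: "card L = q" by simp
        have "(\<Sum>k\<in>-L. insertion_sign k (insert k L) * u L z * d_zbar k (\<phi> m (insert k L)) z)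
          = (\<Sum>k\<in>-L. ?\<psi> m z * u L z * cnj (insertion_sign k (insert k L) * d_z k (f (insert k L)) z)
             + c * u L z * cnj (insertion_sign k (insert k L) * d_z k (\<lambda>z. complex_of_real (\<rho> z)) z * f (insert k L) z))"
          by (intro sum.cong refl) (simp add: d\<phi> L cnj_insertion_sign algebra_simps)
        also have "\<dots> = - (?\<psi> m z * (u L z * cnj (formal_adjoint f L z)))
           + c * u L z * cnj (contract (\<lambda>k. d_z k (\<lambda>z. complex_of_real (\<rho> z)) z) (\<lambda>J. f J z) L)"
          unfolding sum_lin formal_adjoint_def contract_def by simp
        also have "\<dots> = - (?\<psi> m z * (u L z * cnj (formal_adjoint f L z)))"
          by (simp add: tangential[OF L True])
        finally show "(\<Sum>k\<in>-L. insertion_sign k (insert k L) * u L z * d_zbar k (\<phi> m (insert k L)) z)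
          = - (?\<psi> m z * (u L z * cnj (formal_adjoint f L z)))" .
      qed
      finally show ?thesis
        by (simp add: P_def G_def \<phi>_def sum_negf sum_distrib_left algebra_simps)
    qed
    have iG1: "integrable (lebesgue_on \<Omega>) (\<lambda>z. v J z * cnj (f J z))" if "card J = Suc q" for J
      by (rule L2_mult_integrable(2)[OF vL[OF that] fL[OF that]])
    have iG2: "integrable (lebesgue_on \<Omega>) (\<lambda>z. u L z * cnj (formal_adjoint f L z))" if "card L = q" for L
      by (rule L2_mult_integrable(2)[OF uL[OF that] hL[OF that]])
    have G_int: "integrable (lebesgue_on \<Omega>) G"
      unfolding G_def[abs_def] by (intro Bochner_Integration.integrable_diff Bochner_Integration.integrable_sum iG1 iG2) auto
    have lim: "(\<lambda>m. P m z) \<longlonglongrightarrow> G z" if "z \<in> \<Omega>" for z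
    proof (cases "z \<in> K")
      case True
      then have "\<rho> z < 0" using that K(2) U(3) by blast
      then have "(\<lambda>m. ?\<psi> m z * G z) \<longlonglongrightarrow> complex_of_real 1 * G z"
        by (intro tendsto_intros interior_cutoff_tendsto)
      then show ?thesis by (simp add: PG)
    next
      case False
      have "G z = 0" using False by (simp add: G_def K(3) zh)
      then show ?thesis by (simp add: PG)
    qed
    have "(\<lambda>m. LINT z|lebesgue_on \<Omega>. P m z) \<longlonglongrightarrow> (LINT z|lebesgue_on \<Omega>. G z)"
    proof (rule integral_dominated_convergence[where w = "\<lambda>z. cmod (G z)"])
      show "AE z in lebesgue_on \<Omega>. (\<lambda>m. P m z) \<longlonglongrightarrow> G z"
        by (rule AE_I2) (simp add: space_restrict_space lim)
      show "AE z in lebesgue_on \<Omega>. norm (P m z) \<le> cmod (G z)" for m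
        by (rule AE_I2) (simp add: PG norm_mult interior_cutoff_bounds mult_left_le_one_le)
    qed (use P_int G_int in auto)
    then have "(LINT z|lebesgue_on \<Omega>. G z) = 0" by (simp add: P0 LIMSEQ_const_iff)
    moreover have "(LINT z|lebesgue_on \<Omega>. G z) = (\<Sum>J | card J = Suc q. (LINT z|lebesgue_on \<Omega>. v J z * cnj (f J z)))
        - (\<Sum>L | card L = q. (LINT z|lebesgue_on \<Omega>. u L z * cnj (formal_adjoint f L z)))"
      unfolding G_def
      by (subst Bochner_Integration.integral_diff, (intro Bochner_Integration.integrable_sum iG1 iG2; simp)+,
          subst (1 2) Bochner_Integration.integral_sum) (auto intro: iG1 iG2)
    ultimately show ?thesis by (simp add: form_inner_def L2_inner_def)
  qed
  then show ?thesis
    using fL hL by (auto simp: has_dbar_adjoint_def L2_forms_def)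
qed

definition contracted_basis_form :: "('n::{finite,linorder} \<Rightarrow> complex) \<Rightarrow> 'n set \<Rightarrow> 'n set \<Rightarrow> complex" where
  "contracted_basis_form x M J = contract x (\<lambda>N. if N = M then 1 else 0) J"

lemma contracted_basis_form_remove:
  assumes "k \<in> M"
  shows "contracted_basis_form x M (M - {k}) = insertion_sign k M * x k"
proof -
  have "(\<Sum>j\<in>-(M - {k}). insertion_sign j (insert j (M - {k})) * x j * (if insert j (M - {k}) = M then 1 else 0))
    = (\<Sum>j\<in>-(M - {k}). if j = k then insertion_sign k M * x k else 0)"
    using assms by (intro sum.cong refl) (auto simp: insert_absorb)
  then show ?thesis using assms by (simp add: contracted_basis_form_def contract_def)
qed

lemma contracted_basis_form_eq_0:
  assumes "\<And>k. k \<in> M \<Longrightarrow> J \<noteq> M - {k}"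
  shows "contracted_basis_form x M J = 0"
proof -
  have "insert j J \<noteq> M" if "j \<in> - J" for j using assms[of j] that by auto
  then show ?thesis by (auto simp: contracted_basis_form_def contract_def)
qed

text \<open>Interior product with a fixed vector squares to zero. Only \<open>L = M - {k, l}\<close> contributes, and there
the two orders of removing \<open>k < l\<close> differ in sign: \<open>k\<close> is counted in the position of \<open>l\<close>, but \<open>l\<close>
is not counted in that of \<open>k\<close>.\<close>

lemma contract_contracted_basis_form:
  "contract x (contracted_basis_form x M) L = 0"
proof (cases "\<exists>k l. k < l \<and> k \<in> M \<and> l \<in> M \<and> L = M - {k, l}")
  case True
  then obtain k l where kl: "k < l" "k \<in> M" "l \<in> M" "L = M - {k, l}" by blast
  have ins: "insert k L = M - {l}" "insert l L = M - {k}" using kl by auto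
  have z: "contracted_basis_form x M (insert j L) = 0" if "j \<notin> M" for j
    by (rule contracted_basis_form_eq_0) (use that in auto)
  have "contract x (contracted_basis_form x M) L
     = (\<Sum>j\<in>{k, l}. insertion_sign j (insert j L) * x j * contracted_basis_form x M (insert j L))"
    unfolding contract_def
    by (rule sum.mono_neutral_right) (use kl z in auto)
  also have "\<dots> = insertion_sign k (M - {l}) * x k * (insertion_sign l M * x l)
      + insertion_sign l (M - {k}) * x l * (insertion_sign k M * x k)"
    using kl(1-3) by (simp add: ins contracted_basis_form_remove)
  also have "insertion_sign k (M - {l}) = insertion_sign k M"
  proof -
    have "{i \<in> M - {l}. i < k} = {i \<in> M. i < k}" using kl by auto
    then show ?thesis by (simp add: insertion_sign_def)
  qed
  also have "insertion_sign l (M - {k}) = - insertion_sign l M"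
  proof -
    have "{i \<in> M. i < l} = insert k {i \<in> M - {k}. i < l}" using kl by auto
    then have "card {i \<in> M. i < l} = Suc (card {i \<in> M - {k}. i < l})" by simp
    then show ?thesis by (simp add: insertion_sign_def)
  qed
  finally show ?thesis by simp
next
  case False
  have "contracted_basis_form x M (insert j L) = 0" if "j \<in> - L" for j
  proof (rule contracted_basis_form_eq_0)
    fix k assume k: "k \<in> M"
    show "insert j L \<noteq> M - {k}"
    proof
      assume e: "insert j L = M - {k}"
      then have "j \<noteq> k" "j \<in> M" "L = M - {j, k}" "L = M - {k, j}" using that by auto
      then show False using False k by (metis linorder_neqE)
    qed
  qed
  then show ?thesis by (simp add: contract_def)
qed

section \<open>Holomorphic exponentials peaking at a point\<close>

text \<open>For \<open>p\<close> of largest norm in a set, the complex affine function whose real part supports the set at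
\<open>p\<close>; it is the Hermitian product of \<open>z - p\<close> with \<open>p\<close>.\<close>

definition hol_support :: "complex^'n \<Rightarrow> complex^'n::finite \<Rightarrow> complex" where
  "hol_support p z = (\<Sum>j\<in>UNIV. cnj (p $ j) * (z $ j - p $ j))"

definition peak :: "complex^'n \<Rightarrow> real \<Rightarrow> complex^'n::finite \<Rightarrow> complex" where
  "peak p \<tau> z = exp (of_real \<tau> * hol_support p z)"

lemma Re_hol_support: "Re (hol_support p z) = (z - p) \<bullet> p"
  by (simp add: hol_support_def inner_vec_def inner_complex_def algebra_simps)

lemma cmod_peak_power2: "(cmod (peak p \<tau> z))\<^sup>2 = exp (2 * \<tau> * ((z - p) \<bullet> p))"
  by (simp add: peak_def norm_exp_eq_Re Re_hol_support exp_double[symmetric] mult.assoc)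

text \<open>The ball of radius \<open>norm p\<close> is uniformly convex, so the supporting hyperplane at \<open>p\<close> is left
quadratically.\<close>

lemma inner_le_of_norm_le:
  fixes p z :: "'a::real_inner"
  assumes "norm z \<le> norm p"
  shows "(z - p) \<bullet> p \<le> - (norm (z - p))\<^sup>2 / 2"
proof -
  have "z \<bullet> z \<le> p \<bullet> p" using assms by (metis norm_le)
  moreover have "(norm (z - p))\<^sup>2 = z \<bullet> z - 2 * (z \<bullet> p) + p \<bullet> p"
    by (simp add: power2_norm_eq_inner inner_diff_left inner_diff_right inner_commute)
  ultimately show ?thesis by (simp add: inner_diff_left)
qed

lemma peak_has_derivative:
  "(peak p \<tau> has_derivative (\<lambda>v. peak p \<tau> z * (of_real \<tau> * (\<Sum>j\<in>UNIV. cnj (p $ j) * (v $ j))))) (at z)"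
proof -
  have "(hol_support p has_derivative (\<lambda>v. \<Sum>j\<in>UNIV. cnj (p $ j) * (v $ j))) (at z)"
    unfolding hol_support_def[abs_def]
    by (auto intro!: derivative_eq_intros bounded_linear.has_derivative[OF bounded_linear_vec_nth])
  then have "((\<lambda>z. of_real \<tau> * hol_support p z) has_derivative (\<lambda>v. of_real \<tau> * (\<Sum>j\<in>UNIV. cnj (p $ j) * (v $ j)))) (at z)"
    by (rule has_derivative_mult_right)
  from has_derivative_compose[OF this DERIV_exp[unfolded has_field_derivative_def]] show ?thesis
    by (simp add: peak_def[abs_def])
qed

lemma peak_continuous: "continuous_on UNIV (peak p \<tau>)"
  by (intro continuous_at_imp_continuous_on ballI has_derivative_continuous[OF peak_has_derivative])

lemma peak_C1: "Ck_on (Suc 0) UNIV (peak p \<tau>)"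
  by (rule Ck_on_SucI[OF open_UNIV peak_has_derivative]) (auto intro!: continuous_intros peak_continuous)

lemma sum_axis: "(\<Sum>j\<in>UNIV. c j * (axis k x $ j)) = c k * (x::complex)"
  by (simp add: axis_def if_distrib[of "\<lambda>y. _ * y"] cong: if_cong)

lemma d_z_peak: "d_z k (peak p \<tau>) z = of_real \<tau> * cnj (p $ k) * peak p \<tau> z" "d_zbar k (peak p \<tau>) z = 0"
proof -
  have "frechet_derivative (peak p \<tau>) (at z) v = peak p \<tau> z * (of_real \<tau> * (\<Sum>j\<in>UNIV. cnj (p $ j) * (v $ j)))" for v
    using fun_cong[OF frechet_derivative_at[OF peak_has_derivative], of p \<tau> z v] by simp
  then show "d_z k (peak p \<tau>) z = of_real \<tau> * cnj (p $ k) * peak p \<tau> z" "d_zbar k (peak p \<tau>) z = 0"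
    by (simp_all add: d_z_def d_zbar_def sum_axis algebra_simps)
qed

lemma peak_differentiable: "peak p \<tau> differentiable (at z)"
  using peak_C1[of p \<tau>] by simp

text \<open>All norms of the test forms are compared with these two integrals. The moment is smaller
than the mass by a factor of order \<open>1/\<tau>\<close> at suitable scales, which reflects that the peak has
width \<open>\<tau>\<close> to the power \<open>-1/2\<close>.\<close>

definition peak_mass :: "(complex^'n::finite) set \<Rightarrow> complex^'n \<Rightarrow> real \<Rightarrow> real" where
  "peak_mass \<Omega> p \<tau> = (LINT z|lebesgue_on \<Omega>. (cmod (peak p \<tau> z))\<^sup>2)"

definition peak_moment :: "(complex^'n::finite) set \<Rightarrow> complex^'n \<Rightarrow> real \<Rightarrow> real" where
  "peak_moment \<Omega> p \<tau> = (LINT z|lebesgue_on \<Omega>. (norm (z - p))\<^sup>2 * (cmod (peak p \<tau> z))\<^sup>2)"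

lemma continuous_integrable_bounded_open:
  fixes F :: "'a::euclidean_space \<Rightarrow> 'b::euclidean_space"
  assumes "bounded \<Omega>" "open \<Omega>" "continuous_on UNIV F"
  shows "integrable (lebesgue_on \<Omega>) F"
proof -
  have "compact (F ` closure \<Omega>)"
    using assms by (intro compact_continuous_image) (auto intro: continuous_on_subset)
  then obtain B where B: "\<forall>x\<in>F ` closure \<Omega>. norm x \<le> B"
    using bounded_iff[THEN iffD1, OF compact_imp_bounded] by blast
  have "norm (F z) \<le> B" if "z \<in> \<Omega>" for z
    using B that closure_subset[of \<Omega>] by blast
  then show ?thesis
    using assms by (intro integrable_bounded_continuous measurable_lebesgue_on_continuous) auto
qed

lemma continuous_L2_bounded_open:
  assumes "bounded \<Omega>" "open \<Omega>" "continuous_on UNIV F"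
  shows "F \<in> L2 \<Omega>"
proof -
  have "integrable (lebesgue_on \<Omega>) (\<lambda>z. (cmod (F z))\<^sup>2)"
    using assms by (intro continuous_integrable_bounded_open continuous_intros)
  then show ?thesis using measurable_lebesgue_on_continuous[OF assms(3,2)] by (simp add: L2_def)
qed

lemma peak_integrable:
  assumes "bounded \<Omega>" "open \<Omega>"
  shows "integrable (lebesgue_on \<Omega>) (\<lambda>z. (cmod (peak p \<tau> z))\<^sup>2)"
    "integrable (lebesgue_on \<Omega>) (\<lambda>z. (norm (z - p))\<^sup>2 * (cmod (peak p \<tau> z))\<^sup>2)"
  by (intro continuous_integrable_bounded_open[OF assms] continuous_intros peak_continuous)+

lemma peak_mass_nonneg: "peak_mass \<Omega> p \<tau> \<ge> 0"
  unfolding peak_mass_def by (rule Bochner_Integration.integral_nonneg) simp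

lemma L2_norm_peak_upper:
  assumes "bounded \<Omega>" "open \<Omega>" "a \<ge> 0" "b \<ge> 0"
    and "\<And>z. (cmod (F z))\<^sup>2 \<le> (a + b * (norm (z - p))\<^sup>2) * (cmod (peak p \<tau> z))\<^sup>2"
  shows "(L2_norm \<Omega> F)\<^sup>2 \<le> a * peak_mass \<Omega> p \<tau> + b * peak_moment \<Omega> p \<tau>"
proof -
  have "(L2_norm \<Omega> F)\<^sup>2 \<le> (LINT z|lebesgue_on \<Omega>. a * (cmod (peak p \<tau> z))\<^sup>2 + b * ((norm (z - p))\<^sup>2 * (cmod (peak p \<tau> z))\<^sup>2))"
    unfolding L2_norm_power2
    using peak_integrable[OF assms(1,2)] assms(3-5)
    by (intro Bochner_Integration.integral_mono') (auto simp: algebra_simps)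
  also have "\<dots> = a * peak_mass \<Omega> p \<tau> + b * peak_moment \<Omega> p \<tau>"
    using peak_integrable[OF assms(1,2)] by (simp add: peak_mass_def peak_moment_def)
  finally show ?thesis .
qed

lemma L2_norm_peak_lower:
  assumes "bounded \<Omega>" "open \<Omega>" "F \<in> L2 \<Omega>"
    and "\<And>z. (cmod (F z))\<^sup>2 \<ge> (a - b * (norm (z - p))\<^sup>2) * (cmod (peak p \<tau> z))\<^sup>2"
  shows "(L2_norm \<Omega> F)\<^sup>2 \<ge> a * peak_mass \<Omega> p \<tau> - b * peak_moment \<Omega> p \<tau>"
proof -
  have "a * peak_mass \<Omega> p \<tau> - b * peak_moment \<Omega> p \<tau>
      = (LINT z|lebesgue_on \<Omega>. a * (cmod (peak p \<tau> z))\<^sup>2 - b * ((norm (z - p))\<^sup>2 * (cmod (peak p \<tau> z))\<^sup>2))"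
    using peak_integrable[OF assms(1,2)] by (simp add: peak_mass_def peak_moment_def)
  also have "\<dots> \<le> (L2_norm \<Omega> F)\<^sup>2"
    unfolding L2_norm_power2
    using peak_integrable[OF assms(1,2)] assms(3,4)
    by (intro Bochner_Integration.integral_mono) (auto simp: algebra_simps L2_def)
  finally show ?thesis .
qed

text \<open>The directional derivatives along a basis are continuous with compact support, hence bounded, and
they control the operator norm of the derivative.\<close>

lemma C1_compact_support_Lipschitz:
  fixes F :: "'a::euclidean_space \<Rightarrow> complex"
  assumes F: "Ck_on (Suc 0) UNIV F" and K: "compact K" "\<And>x. x \<notin> K \<Longrightarrow> F x = 0"
  obtains C where "C \<ge> 0" "\<And>x y. norm (F x - F y) \<le> C * norm (x - y)"
proof -
  have cd: "continuous_on UNIV (\<lambda>x. frechet_derivative F (at x) v)" for v using F by simp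
  have KD: "frechet_derivative F (at x) v = 0" if "x \<notin> K" for x v
    using frechet_derivative_eq_0_outside(2)[of K F x] K that by (simp add: compact_imp_closed)
  have "\<exists>B. B \<ge> 0 \<and> (\<forall>x. norm (frechet_derivative F (at x) v) \<le> B)" for v
    using bounded_compact_support[OF cd K(1) KD] by metis
  then obtain B where B: "\<And>v. B v \<ge> 0" "\<And>v x. norm (frechet_derivative F (at x) v) \<le> B v" by metis
  define C where "C = (\<Sum>b\<in>Basis. B b)"
  have dF: "(F has_derivative frechet_derivative F (at x)) (at x)" for x
    using F by (auto intro: differentiableD)
  have o: "onorm (frechet_derivative F (at x)) \<le> C" for x
  proof (rule onorm_le)
    fix v
    have lin: "linear (frechet_derivative F (at x))" using dF has_derivative_linear by blast
    have "frechet_derivative F (at x) v = (\<Sum>b\<in>Basis. (v \<bullet> b) *\<^sub>R frechet_derivative F (at x) b)"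
      by (subst euclidean_representation[of v, symmetric], subst linear_sum[OF lin]) (simp add: linear_scale[OF lin])
    also have "norm \<dots> \<le> (\<Sum>b\<in>Basis. norm v * B b)"
      using B by (intro sum_norm_le) (simp add: mult_mono Basis_le_norm)
    also have "\<dots> = C * norm v" by (simp add: C_def sum_distrib_left mult.commute)
    finally show "norm (frechet_derivative F (at x) v) \<le> C * norm v" .
  qed
  show ?thesis
  proof (rule that[of C])
    show "C \<ge> 0" using B by (auto simp: C_def intro: sum_nonneg)
    show "norm (F x - F y) \<le> C * norm (x - y)" for x y
      by (rule differentiable_bound[of UNIV F "\<lambda>x. frechet_derivative F (at x)"]) (use dF o in auto)
  qed
qed

section \<open>Negative Sobolev norm of the test forms\<close>

text \<open>Multiplication by \<open>A\<close> costs a bounded factor, while \<open>E = d_z n (E / c)\<close> with \<open>c = \<tau> cnj p\<^sub>n\<close>. Testing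
against \<open>\<phi>\<close> with compact support, the derivative moves to \<open>\<phi>\<close> without a boundary
term, and the factor \<open>1/c\<close> remains. The constant \<open>M\<close> is independent of \<open>\<tau>\<close>.\<close>

lemma W_neg1_norm_peak:
  fixes A :: "complex^'n::finite \<Rightarrow> complex"
  assumes \<Omega>: "bounded \<Omega>" "open \<Omega>" and A: "Ck_on (Suc 0) UNIV A" "compact K" "\<And>x. x \<notin> K \<Longrightarrow> A x = 0"
    and n: "p $ n \<noteq> 0"
  obtains M where "M \<ge> 0" "\<And>\<tau>. \<tau> > 0 \<Longrightarrow>
    (W_neg1_norm \<Omega> (\<lambda>z. peak p \<tau> z * A z))\<^sup>2 \<le> M / \<tau>\<^sup>2 * peak_mass \<Omega> p \<tau>"
proof -
  have cA: "continuous_on UNIV A" using Ck_on_Suc_imp[OF A(1)] by simp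
  have cdA: "continuous_on UNIV (d_z n A)" by (rule d_z_continuous[OF A(1)])
  have zA: "d_z n A x = 0" if "x \<notin> K" for x
    by (rule d_z_eq_0_outside(1)[OF compact_imp_closed[OF A(2)] A(3) that])
  obtain B0 where B0: "B0 \<ge> 0" "\<And>x. cmod (A x) \<le> B0"
    using bounded_compact_support[OF cA A(2)] A(3) by metis
  obtain B1 where B1: "B1 \<ge> 0" "\<And>x. cmod (d_z n A x) \<le> B1"
    using bounded_compact_support[OF cdA A(2)] zA by metis
  define M where "M = ((B0 + B1) / cmod (p $ n))\<^sup>2"
  show ?thesis
  proof (rule that[of M])
    show "M \<ge> 0" by (simp add: M_def)
    fix \<tau> :: real assume \<tau>: "\<tau> > 0"
    define c where "c = of_real \<tau> * cnj (p $ n)"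
    have c: "c \<noteq> 0" "cmod c = \<tau> * cmod (p $ n)" using \<tau> n by (auto simp: c_def norm_mult)
    define I where "I = sqrt (peak_mass \<Omega> p \<tau>)"
    have I: "I \<ge> 0" "I\<^sup>2 = peak_mass \<Omega> p \<tau>" using peak_mass_nonneg by (auto simp: I_def)
    define f where "f z = peak p \<tau> z * A z" for z
    \<comment> \<open>By the product rule \<open>d_z n F = f + R\<close>, and both \<open>F\<close> and \<open>R\<close> carry the small factor \<open>1 / c\<close>.\<close>
    define F where "F z = f z / c" for z
    define R where "R z = peak p \<tau> z * d_z n A z / c" for z
    have F1: "Ck_on (Suc 0) UNIV F"
      unfolding F_def f_def divide_inverse by (intro Ck_on_mult open_UNIV peak_C1 A Ck_on_const)
    have dF: "d_z n F z = f z + R z" for z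
    proof -
      have fe: "F = (\<lambda>z. (peak p \<tau> z * A z) * inverse c)" by (simp add: F_def f_def fun_eq_iff divide_inverse)
      have 1: "(\<lambda>z. peak p \<tau> z * A z) differentiable (at z)"
        using Ck_on_mult[OF open_UNIV peak_C1 A(1)] by simp
      have 2: "d_z n (\<lambda>z. inverse c) z = 0" by (simp add: d_z_def frechet_derivative_const)
      have 3: "A differentiable (at z)" using A(1) by simp
      show ?thesis
        unfolding fe d_z_mult[OF 1 differentiable_const] d_z_mult[OF peak_differentiable 3] d_z_peak 2
        using c by (simp add: f_def R_def c_def field_simps)
    qed
    have cont: "continuous_on UNIV f" "continuous_on UNIV F" "continuous_on UNIV R"
      unfolding f_def F_def R_def using c by (intro continuous_intros peak_continuous cA cdA; simp)+
    have L2s: "f \<in> L2 \<Omega>" "F \<in> L2 \<Omega>" "R \<in> L2 \<Omega>"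
      using cont by (auto intro: continuous_L2_bounded_open[OF \<Omega>])
    have nF: "L2_norm \<Omega> F \<le> B0 / cmod c * I"
    proof (rule power2_le_imp_le)
      have "(L2_norm \<Omega> F)\<^sup>2 \<le> (B0 / cmod c)\<^sup>2 * peak_mass \<Omega> p \<tau> + 0 * peak_moment \<Omega> p \<tau>"
      proof (rule L2_norm_peak_upper[OF \<Omega>])
        fix z
        have "cmod (F z) = cmod (A z) * cmod (peak p \<tau> z) / cmod c"
          by (simp add: F_def f_def norm_divide norm_mult)
        also have "\<dots> \<le> B0 * cmod (peak p \<tau> z) / cmod c"
          by (intro divide_right_mono mult_right_mono B0(2)) auto
        finally have "cmod (F z) \<le> B0 / cmod c * cmod (peak p \<tau> z)" by simp
        from power_mono[OF this norm_ge_zero, of 2]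
        show "(cmod (F z))\<^sup>2 \<le> ((B0 / cmod c)\<^sup>2 + 0 * (norm (z - p))\<^sup>2) * (cmod (peak p \<tau> z))\<^sup>2"
          by (simp add: power_mult_distrib power_divide)
      qed auto
      then show "(L2_norm \<Omega> F)\<^sup>2 \<le> (B0 / cmod c * I)\<^sup>2" by (simp add: power_mult_distrib power_divide I)
      show "0 \<le> B0 / cmod c * I" using B0 I by simp
    qed
    have nR: "L2_norm \<Omega> R \<le> B1 / cmod c * I"
    proof (rule power2_le_imp_le)
      have "(L2_norm \<Omega> R)\<^sup>2 \<le> (B1 / cmod c)\<^sup>2 * peak_mass \<Omega> p \<tau> + 0 * peak_moment \<Omega> p \<tau>"
      proof (rule L2_norm_peak_upper[OF \<Omega>])
        fix z
        have "cmod (R z) = cmod (d_z n A z) * cmod (peak p \<tau> z) / cmod c"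
          by (simp add: R_def norm_divide norm_mult)
        also have "\<dots> \<le> B1 * cmod (peak p \<tau> z) / cmod c"
          by (intro divide_right_mono mult_right_mono B1(2)) auto
        finally have "cmod (R z) \<le> B1 / cmod c * cmod (peak p \<tau> z)" by simp
        from power_mono[OF this norm_ge_zero, of 2]
        show "(cmod (R z))\<^sup>2 \<le> ((B1 / cmod c)\<^sup>2 + 0 * (norm (z - p))\<^sup>2) * (cmod (peak p \<tau> z))\<^sup>2"
          by (simp add: power_mult_distrib power_divide)
      qed auto
      then show "(L2_norm \<Omega> R)\<^sup>2 \<le> (B1 / cmod c * I)\<^sup>2" by (simp add: power_mult_distrib power_divide I)
      show "0 \<le> B1 / cmod c * I" using B1 I by simp
    qed
    have test: "L2_inner \<Omega> f \<phi> = - L2_inner \<Omega> F (d_zbar n \<phi>) - L2_inner \<Omega> R \<phi>" if \<phi>: "\<phi> \<in> test_functions \<Omega>" for \<phi>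
    proof -
      obtain S where \<phi>': "Ck_on (Suc 0) UNIV \<phi>" "compact S" "S \<subseteq> \<Omega>" "\<And>x. x \<notin> S \<Longrightarrow> \<phi> x = 0"
        using test_functionsD[OF \<phi>] by blast
      have \<phi>L: "\<phi> \<in> L2 \<Omega>" using Ck_on_Suc_imp[OF \<phi>'(1)] by (intro continuous_L2_bounded_open[OF \<Omega>]) simp
      have c0: "cnj (\<phi> x) = 0" if "x \<notin> S" for x using \<phi>'(4)[OF that] by simp
      have \<phi>d: "\<phi> differentiable (at z)" for z using \<phi>'(1) by simp
      have "(LINT z|lebesgue_on \<Omega>. d_z n F z * cnj (\<phi> z)) = - (LINT z|lebesgue_on \<Omega>. F z * d_z n (\<lambda>z. cnj (\<phi> z)) z)"
        by (rule integral_by_parts(2)[OF F1 Ck_on_cnj[OF open_UNIV \<phi>'(1)] \<phi>'(2) c0 \<Omega> \<phi>'(3)])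
      moreover have "(LINT z|lebesgue_on \<Omega>. d_z n F z * cnj (\<phi> z)) = L2_inner \<Omega> f \<phi> + L2_inner \<Omega> R \<phi>"
        unfolding L2_inner_def dF distrib_right
        by (rule Bochner_Integration.integral_add[OF L2_mult_integrable(2)[OF L2s(1) \<phi>L] L2_mult_integrable(2)[OF L2s(3) \<phi>L]])
      moreover have "(LINT z|lebesgue_on \<Omega>. F z * d_z n (\<lambda>z. cnj (\<phi> z)) z) = L2_inner \<Omega> F (d_zbar n \<phi>)"
        by (simp add: L2_inner_def d_z_cnj(1)[OF \<phi>d])
      ultimately show ?thesis by (simp add: algebra_simps)
    qed
    have bound: "cmod (L2_inner \<Omega> f g) \<le> (B0 + B1) / cmod c * I"
      if g: "in_W1_0 \<Omega> g a b" "W1_norm \<Omega> g a b \<le> 1" for g a b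
    proof -
      have gL: "g \<in> L2 \<Omega>" "a n \<in> L2 \<Omega>" using g(1) by (auto simp: in_W1_0_def)
      obtain \<phi> where \<phi>: "\<And>k. \<phi> k \<in> test_functions \<Omega>"
        "(\<lambda>k. L2_norm \<Omega> (\<lambda>z. \<phi> k z - g z)) \<longlonglongrightarrow> 0"
        "(\<lambda>k. L2_norm \<Omega> (\<lambda>z. d_zbar n (\<phi> k) z - a n z)) \<longlonglongrightarrow> 0"
        using g(1) unfolding in_W1_0_def by blast
      have \<phi>L: "\<phi> k \<in> L2 \<Omega>" "d_zbar n (\<phi> k) \<in> L2 \<Omega>" for k
      proof -
        have "continuous_on UNIV (\<phi> k)" using test_functionsD(1)[OF \<phi>(1)[of k], of 0] by simp
        then show "\<phi> k \<in> L2 \<Omega>" by (rule continuous_L2_bounded_open[OF \<Omega>])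
        show "d_zbar n (\<phi> k) \<in> L2 \<Omega>"
          by (rule continuous_L2_bounded_open[OF \<Omega> d_z_continuous(2)[OF test_functionsD(1)[OF \<phi>(1)]]])
      qed
      have "(\<lambda>k. - L2_inner \<Omega> F (d_zbar n (\<phi> k)) - L2_inner \<Omega> R (\<phi> k)) \<longlonglongrightarrow> - L2_inner \<Omega> F (a n) - L2_inner \<Omega> R g"
        by (intro tendsto_intros L2_inner_tendsto L2s \<phi>L gL \<phi>)
      then have "(\<lambda>k. L2_inner \<Omega> f (\<phi> k)) \<longlonglongrightarrow> - L2_inner \<Omega> F (a n) - L2_inner \<Omega> R g"
        by (simp add: test[OF \<phi>(1)])
      moreover have "(\<lambda>k. L2_inner \<Omega> f (\<phi> k)) \<longlonglongrightarrow> L2_inner \<Omega> f g"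
        by (intro L2_inner_tendsto L2s \<phi>L gL \<phi>)
      ultimately have e: "L2_inner \<Omega> f g = - L2_inner \<Omega> F (a n) - L2_inner \<Omega> R g"
        by (metis LIMSEQ_unique)
      have W: "(L2_norm \<Omega> g)\<^sup>2 + (\<Sum>j\<in>UNIV. (L2_norm \<Omega> (a j))\<^sup>2) + (\<Sum>j\<in>UNIV. (L2_norm \<Omega> (b j))\<^sup>2) \<le> 1"
        using g(2) by (simp add: W1_norm_def)
      have "(L2_norm \<Omega> (a n))\<^sup>2 \<le> (\<Sum>j\<in>UNIV. (L2_norm \<Omega> (a j))\<^sup>2)"
        by (rule member_le_sum) auto
      moreover have "0 \<le> (\<Sum>j\<in>UNIV. (L2_norm \<Omega> (b j))\<^sup>2)" "0 \<le> (\<Sum>j\<in>UNIV. (L2_norm \<Omega> (a j))\<^sup>2)" "0 \<le> (L2_norm \<Omega> g)\<^sup>2"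
        by (auto intro: sum_nonneg)
      ultimately have "(L2_norm \<Omega> (a n))\<^sup>2 \<le> 1" "(L2_norm \<Omega> g)\<^sup>2 \<le> 1" using W by linarith+
      then have n1: "L2_norm \<Omega> (a n) \<le> 1" "L2_norm \<Omega> g \<le> 1"
        by (auto simp: power2_le_imp_le[of _ 1])
      have "cmod (L2_inner \<Omega> f g) \<le> cmod (L2_inner \<Omega> F (a n)) + cmod (L2_inner \<Omega> R g)"
        unfolding e using norm_triangle_ineq4[of "- L2_inner \<Omega> F (a n)" "L2_inner \<Omega> R g"] by simp
      also have "\<dots> \<le> L2_norm \<Omega> F * L2_norm \<Omega> (a n) + L2_norm \<Omega> R * L2_norm \<Omega> g"
        by (intro add_mono L2_Cauchy_Schwarz L2s gL)
      also have "\<dots> \<le> L2_norm \<Omega> F * 1 + L2_norm \<Omega> R * 1"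
        by (intro add_mono mult_left_mono n1 L2_norm_nonneg)
      also have "\<dots> \<le> (B0 + B1) / cmod c * I" using nF nR by (simp add: add_divide_distrib distrib_right)
      finally show ?thesis .
    qed
    \<comment> \<open>The zero function shows that the supremum is over a nonempty set and is not negative.\<close>
    let ?S = "{cmod (L2_inner \<Omega> f g) | g a b. in_W1_0 \<Omega> g a b \<and> W1_norm \<Omega> g a b \<le> 1}"
    have z0: "L2_norm \<Omega> (\<lambda>z. 0) = 0" by (simp add: L2_norm_def)
    have "in_W1_0 \<Omega> (\<lambda>z. 0) (\<lambda>j z. 0) (\<lambda>j z. 0)"
    proof -
      have t0: "(\<lambda>z. 0) \<in> test_functions \<Omega>" by (simp add: test_functions_def Ck_on_const)
      have d0: "d_z j (\<lambda>z. 0) z = 0" "d_zbar j (\<lambda>z. 0) z = 0" for j and z :: "complex^'n"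
        by (simp_all add: d_z_def d_zbar_def frechet_derivative_const)
      show ?thesis
        unfolding in_W1_0_def
        by (intro conjI allI L2_const[OF \<Omega>] exI[of _ "\<lambda>k z. 0"]) (simp_all add: t0 d0 z0)
    qed
    moreover have "W1_norm \<Omega> (\<lambda>z. 0) (\<lambda>j z. 0) (\<lambda>j z. 0) \<le> 1" by (simp add: W1_norm_def z0)
    ultimately have mem: "cmod (L2_inner \<Omega> f (\<lambda>z. 0)) \<in> ?S" by blast
    have ub: "x \<le> (B0 + B1) / cmod c * I" if "x \<in> ?S" for x using that bound by blast
    have "W_neg1_norm \<Omega> f \<le> (B0 + B1) / cmod c * I"
      unfolding W_neg1_norm_def using mem ub by (intro cSup_least) blast+
    moreover have "0 \<le> W_neg1_norm \<Omega> f"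
    proof -
      have "cmod (L2_inner \<Omega> f (\<lambda>z. 0)) \<le> W_neg1_norm \<Omega> f"
        unfolding W_neg1_norm_def by (rule cSup_upper[OF mem bdd_aboveI[OF ub]])
      then show ?thesis by (rule order_trans[OF norm_ge_zero])
    qed
    ultimately have "(W_neg1_norm \<Omega> f)\<^sup>2 \<le> ((B0 + B1) / cmod c * I)\<^sup>2" by (intro power_mono)
    also have "\<dots> = M / \<tau>\<^sup>2 * peak_mass \<Omega> p \<tau>"
      using \<tau> by (simp add: power_mult_distrib power_divide I c(2) M_def)
    finally show "(W_neg1_norm \<Omega> (\<lambda>z. peak p \<tau> z * A z))\<^sup>2 \<le> M / \<tau>\<^sup>2 * peak_mass \<Omega> p \<tau>"
      by (simp add: f_def[abs_def])
  qed
qed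

section \<open>Estimates for the test forms\<close>

lemma sum_uniform_bound:
  fixes X :: "'i \<Rightarrow> real \<Rightarrow> real"
  assumes "finite S" "\<And>J. J \<in> S \<Longrightarrow> \<exists>C\<ge>0. \<forall>\<tau>>0. X J \<tau> \<le> C * Y \<tau>"
  shows "\<exists>C\<ge>0. \<forall>\<tau>>0. (\<Sum>J\<in>S. X J \<tau>) \<le> C * Y \<tau>"
proof -
  have "\<forall>J\<in>S. \<exists>C. C \<ge> 0 \<and> (\<forall>\<tau>>0. X J \<tau> \<le> C * Y \<tau>)" using assms(2) by blast
  from bchoice[OF this] obtain C where C: "\<And>J. J \<in> S \<Longrightarrow> C J \<ge> 0" "\<And>J \<tau>. J \<in> S \<Longrightarrow> \<tau> > 0 \<Longrightarrow> X J \<tau> \<le> C J * Y \<tau>"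
    by blast
  have "(\<Sum>J\<in>S. X J \<tau>) \<le> (\<Sum>J\<in>S. C J) * Y \<tau>" if "\<tau> > 0" for \<tau>
    unfolding sum_distrib_right by (intro sum_mono C that)
  moreover have "(\<Sum>J\<in>S. C J) \<ge> 0" by (intro sum_nonneg C)
  ultimately show ?thesis by blast
qed

lemma form_L2_norm_power2: "(form_L2_norm \<Omega> q f)\<^sup>2 = (\<Sum>J | card J = q. (L2_norm \<Omega> (f J))\<^sup>2)"
  by (simp add: form_L2_norm_def sum_nonneg)

lemma form_W_neg1_norm_power2: "(form_W_neg1_norm \<Omega> q f)\<^sup>2 = (\<Sum>J | card J = q. (W_neg1_norm \<Omega> (f J))\<^sup>2)"
  by (simp add: form_W_neg1_norm_def sum_nonneg)

locale peak_coefficients =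
  fixes \<Omega> :: "(complex^'n::{finite,linorder}) set" and q :: nat and A :: "'n form"
    and K :: "(complex, 'n) vec set" and p :: "(complex, 'n) vec"
  assumes \<Omega>: "bounded \<Omega>" "open \<Omega>"
    and A_C1: "\<And>J. card J = q \<Longrightarrow> Ck_on (Suc 0) UNIV (A J)"
    and K: "compact K" and A_zero: "\<And>J x. card J = q \<Longrightarrow> x \<notin> K \<Longrightarrow> A J x = 0"
begin

definition test_form :: "real \<Rightarrow> 'n form" where
  "test_form \<tau> J z = peak p \<tau> z * A J z"

lemma A_diff: "card J = q \<Longrightarrow> A J differentiable (at z)"
  using A_C1[of J] by simp

lemma dA_bound:
  assumes "card J = q"
  shows "\<exists>B\<ge>0. \<forall>x. cmod (d_zbar k (A J) x) \<le> B" "\<exists>B\<ge>0. \<forall>x. cmod (d_z k (A J) x) \<le> B"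
proof -
  have z: "d_zbar k (A J) x = 0" "d_z k (A J) x = 0" if "x \<notin> K" for x
    by (rule d_z_eq_0_outside[OF compact_imp_closed[OF K] A_zero[OF assms] that]; assumption)+
  show "\<exists>B\<ge>0. \<forall>x. cmod (d_zbar k (A J) x) \<le> B"
    using bounded_compact_support[OF d_z_continuous(2)[OF A_C1[OF assms]] K] z(1) by metis
  show "\<exists>B\<ge>0. \<forall>x. cmod (d_z k (A J) x) \<le> B"
    using bounded_compact_support[OF d_z_continuous(1)[OF A_C1[OF assms]] K] z(2) by metis
qed

lemma test_form_C1: "card J = q \<Longrightarrow> Ck_on (Suc 0) UNIV (test_form \<tau> J)"
  unfolding test_form_def[abs_def] by (intro Ck_on_mult open_UNIV peak_C1 A_C1)

lemma test_form_zero: "card J = q \<Longrightarrow> x \<notin> K \<Longrightarrow> test_form \<tau> J x = 0"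
  by (simp add: test_form_def A_zero)

lemma d_test_form:
  assumes "card J = q"
  shows "d_zbar k (test_form \<tau> J) z = peak p \<tau> z * d_zbar k (A J) z"
    "d_z k (test_form \<tau> J) z = peak p \<tau> z * (of_real \<tau> * cnj (p $ k) * A J z + d_z k (A J) z)"
  unfolding test_form_def[abs_def] d_zbar_mult[OF peak_differentiable A_diff[OF assms]] d_z_mult[OF peak_differentiable A_diff[OF assms]] d_z_peak
  by (simp_all add: algebra_simps)

text \<open>One coefficient suffices. It is Lipschitz, so \<open>|A z|\<^sup>2 \<ge> |A p|\<^sup>2 / 2 - C\<^sup>2 |z - p|\<^sup>2\<close>
everywhere, and the region away from \<open>p\<close> is paid for by the moment.\<close>

lemma test_form_norm_lower:
  assumes "card J = q" "A J p \<noteq> 0"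
  shows "\<exists>c>0. \<exists>C\<ge>0. \<forall>\<tau>. c * peak_mass \<Omega> p \<tau> - C * peak_moment \<Omega> p \<tau> \<le> (form_L2_norm \<Omega> q (test_form \<tau>))\<^sup>2"
proof -
  obtain C where C: "C \<ge> 0" "\<And>x y. cmod (A J x - A J y) \<le> C * norm (x - y)"
    using C1_compact_support_Lipschitz[OF A_C1[OF assms(1)] K] A_zero[OF assms(1)] by metis
  define c where "c = (cmod (A J p))\<^sup>2 / 2"
  have "c > 0" using assms(2) by (simp add: c_def)
  have low: "c - C\<^sup>2 * (norm (z - p))\<^sup>2 \<le> (cmod (A J z))\<^sup>2" for z
  proof -
    have "cmod (A J p) \<le> cmod (A J z) + C * norm (z - p)"
      using C(2)[of p z] norm_triangle_sub[of "A J p" "A J z"] by (simp add: norm_minus_commute)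
    then have "(cmod (A J p))\<^sup>2 \<le> (cmod (A J z) + C * norm (z - p))\<^sup>2" by (intro power_mono) auto
    also have "\<dots> \<le> 2 * (cmod (A J z))\<^sup>2 + 2 * (C * norm (z - p))\<^sup>2"
      using sum_squares_bound[of "cmod (A J z)" "C * norm (z - p)"] by (simp add: power2_sum)
    finally show ?thesis by (simp add: c_def power_mult_distrib)
  qed
  have "c * peak_mass \<Omega> p \<tau> - C\<^sup>2 * peak_moment \<Omega> p \<tau> \<le> (form_L2_norm \<Omega> q (test_form \<tau>))\<^sup>2" for \<tau>
  proof -
    have "continuous_on UNIV (test_form \<tau> J)" using Ck_on_Suc_imp[OF test_form_C1[OF assms(1)]] by simp
    then have "test_form \<tau> J \<in> L2 \<Omega>" by (rule continuous_L2_bounded_open[OF \<Omega>])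
    then have "c * peak_mass \<Omega> p \<tau> - C\<^sup>2 * peak_moment \<Omega> p \<tau> \<le> (L2_norm \<Omega> (test_form \<tau> J))\<^sup>2"
    proof (rule L2_norm_peak_lower[OF \<Omega>])
      show "(c - C\<^sup>2 * (norm (z - p))\<^sup>2) * (cmod (peak p \<tau> z))\<^sup>2 \<le> (cmod (test_form \<tau> J z))\<^sup>2" for z
        using mult_right_mono[OF low, of "(cmod (peak p \<tau> z))\<^sup>2" z]
        by (simp add: test_form_def norm_mult power_mult_distrib mult.commute)
    qed
    also have "\<dots> \<le> (form_L2_norm \<Omega> q (test_form \<tau>))\<^sup>2"
      unfolding form_L2_norm_power2 using assms(1) by (intro member_le_sum) auto
    finally show ?thesis .
  qed
  then show ?thesis using \<open>c > 0\<close> zero_le_power2[of C] by blast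
qed

lemma test_form_dbar_upper:
  "\<exists>C\<ge>0. \<forall>\<tau>>0. (form_L2_norm \<Omega> (Suc q) (\<lambda>J z. \<Sum>k\<in>J. (-1) ^ card {i\<in>J. i < k} * d_zbar k (test_form \<tau> (J - {k})) z))\<^sup>2
      \<le> C * peak_mass \<Omega> p \<tau>"
  unfolding form_L2_norm_power2
proof (rule sum_uniform_bound)
  fix J :: "'n set" assume "J \<in> {J. card J = Suc q}"
  then have cJ: "card (J - {k}) = q" if "k \<in> J" for k using that by simp
  have "\<forall>k\<in>J. \<exists>B\<ge>0. \<forall>x. cmod (d_zbar k (A (J - {k})) x) \<le> B" using dA_bound(1)[OF cJ] by blast
  from bchoice[OF this] obtain B where B: "\<forall>k\<in>J. B k \<ge> 0 \<and> (\<forall>x. cmod (d_zbar k (A (J - {k})) x) \<le> B k)" by blast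
  define b where "b = (\<Sum>k\<in>J. B k)"
  have b: "b \<ge> 0" unfolding b_def using B by (intro sum_nonneg) auto
  have "(L2_norm \<Omega> (\<lambda>z. \<Sum>k\<in>J. (-1) ^ card {i\<in>J. i < k} * d_zbar k (test_form \<tau> (J - {k})) z))\<^sup>2 \<le> b\<^sup>2 * peak_mass \<Omega> p \<tau>" for \<tau>
  proof -
    have "(L2_norm \<Omega> (\<lambda>z. \<Sum>k\<in>J. (-1) ^ card {i\<in>J. i < k} * d_zbar k (test_form \<tau> (J - {k})) z))\<^sup>2
        \<le> b\<^sup>2 * peak_mass \<Omega> p \<tau> + 0 * peak_moment \<Omega> p \<tau>"
    proof (rule L2_norm_peak_upper[OF \<Omega>])
      fix z
      have "cmod (\<Sum>k\<in>J. (-1) ^ card {i\<in>J. i < k} * d_zbar k (test_form \<tau> (J - {k})) z) \<le> (\<Sum>k\<in>J. B k * cmod (peak p \<tau> z))"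
      proof (rule sum_norm_le)
        fix k assume "k \<in> J"
        then have "cmod (d_zbar k (A (J - {k})) z) \<le> B k" using B by blast
        then show "norm ((-1) ^ card {i\<in>J. i < k} * d_zbar k (test_form \<tau> (J - {k})) z) \<le> B k * cmod (peak p \<tau> z)"
          unfolding d_test_form[OF cJ[OF \<open>k \<in> J\<close>]]
          using mult_right_mono[of "cmod (d_zbar k (A (J - {k})) z)" "B k" "cmod (peak p \<tau> z)"]
          by (simp add: norm_mult norm_power mult.commute)
      qed
      also have "\<dots> = b * cmod (peak p \<tau> z)" by (simp add: b_def sum_distrib_right)
      finally have "cmod (\<Sum>k\<in>J. (-1) ^ card {i\<in>J. i < k} * d_zbar k (test_form \<tau> (J - {k})) z) \<le> b * cmod (peak p \<tau> z)" .
      from power_mono[OF this norm_ge_zero, of 2]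
      show "(cmod (\<Sum>k\<in>J. (-1) ^ card {i\<in>J. i < k} * d_zbar k (test_form \<tau> (J - {k})) z))\<^sup>2
          \<le> (b\<^sup>2 + 0 * (norm (z - p))\<^sup>2) * (cmod (peak p \<tau> z))\<^sup>2"
        by (simp add: power_mult_distrib)
    qed auto
    then show ?thesis by simp
  qed
  then show "\<exists>C\<ge>0. \<forall>\<tau>>0. (L2_norm \<Omega> (\<lambda>z. \<Sum>k\<in>J. (-1) ^ card {i\<in>J. i < k} * d_zbar k (test_form \<tau> (J - {k})) z))\<^sup>2 \<le> C * peak_mass \<Omega> p \<tau>"
    using zero_le_power2[of b] by blast
qed simp

lemma test_form_W_neg1_upper:
  assumes "p $ n \<noteq> 0"
  shows "\<exists>C\<ge>0. \<forall>\<tau>>0. (form_W_neg1_norm \<Omega> q (test_form \<tau>))\<^sup>2 \<le> C * (peak_mass \<Omega> p \<tau> / \<tau>\<^sup>2)"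
  unfolding form_W_neg1_norm_power2
proof (rule sum_uniform_bound)
  fix J :: "'n set" assume "J \<in> {J. card J = q}"
  then have J: "card J = q" by simp
  obtain M where M: "M \<ge> 0" "\<And>\<tau>. \<tau> > 0 \<Longrightarrow> (W_neg1_norm \<Omega> (\<lambda>z. peak p \<tau> z * A J z))\<^sup>2 \<le> M / \<tau>\<^sup>2 * peak_mass \<Omega> p \<tau>"
    using W_neg1_norm_peak[OF \<Omega> A_C1[OF J] K _ assms] A_zero[OF J] by metis
  then have "(W_neg1_norm \<Omega> (test_form \<tau> J))\<^sup>2 \<le> M * (peak_mass \<Omega> p \<tau> / \<tau>\<^sup>2)" if "\<tau> > 0" for \<tau>
    using M(2)[OF that] by (simp add: test_form_def[abs_def])
  then show "\<exists>C\<ge>0. \<forall>\<tau>>0. (W_neg1_norm \<Omega> (test_form \<tau> J))\<^sup>2 \<le> C * (peak_mass \<Omega> p \<tau> / \<tau>\<^sup>2)"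
    using M(1) by blast
qed simp

text \<open>The term with the factor \<open>\<tau>\<close> is the contraction of \<open>A\<close> with \<open>\<partial>h\<close>. It vanishes at \<open>p\<close> by hypothesis
and is Lipschitz, which turns \<open>\<tau>\<^sup>2\<close> times the mass into \<open>\<tau>\<^sup>2\<close> times the moment.\<close>

lemma test_form_adjoint_upper:
  assumes q: "q = Suc r"
    and tangential: "\<And>L. card L = r \<Longrightarrow> contract (\<lambda>k. cnj (p $ k)) (\<lambda>J. A J p) L = 0"
  shows "\<exists>C\<ge>0. \<forall>\<tau>>0. (form_L2_norm \<Omega> r (formal_adjoint (test_form \<tau>)))\<^sup>2
      \<le> C * (peak_mass \<Omega> p \<tau> + \<tau>\<^sup>2 * peak_moment \<Omega> p \<tau>)"
  unfolding form_L2_norm_power2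
proof (rule sum_uniform_bound)
  fix L :: "'n set" assume "L \<in> {L. card L = r}"
  then have L: "card L = r" by simp
  have cL: "card (insert k L) = q" if "k \<in> - L" for k using that L q by simp
  define S where "S z = contract (\<lambda>k. cnj (p $ k)) (\<lambda>J. A J z) L" for z
  have S1: "Ck_on (Suc 0) UNIV S"
    unfolding S_def contract_def by (intro Ck_on_sum Ck_on_mult open_UNIV Ck_on_const A_C1 cL)
  have S0: "S z = 0" if "z \<notin> K" for z
    using that by (simp add: S_def contract_def A_zero L q)
  obtain C where C: "C \<ge> 0" "\<And>x y. cmod (S x - S y) \<le> C * norm (x - y)"
    using C1_compact_support_Lipschitz[OF S1 K] S0 by metis
  have Sp: "cmod (S z) \<le> C * norm (z - p)" for z
    using C(2)[of z p] tangential[OF L] by (simp add: S_def)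
  have "\<forall>k\<in>-L. \<exists>B\<ge>0. \<forall>x. cmod (d_z k (A (insert k L)) x) \<le> B" using dA_bound(2)[OF cL] by blast
  from bchoice[OF this] obtain B where B: "\<forall>k\<in>-L. B k \<ge> 0 \<and> (\<forall>x. cmod (d_z k (A (insert k L)) x) \<le> B k)" by blast
  define b where "b = (\<Sum>k\<in>-L. B k)"
  have b: "b \<ge> 0" unfolding b_def using B by (intro sum_nonneg) auto
  define R where "R z = (\<Sum>k\<in>-L. insertion_sign k (insert k L) * d_z k (A (insert k L)) z)" for z
  have R: "cmod (R z) \<le> b" for z
    unfolding R_def b_def using B by (intro sum_norm_le) (simp add: norm_mult norm_insertion_sign)
  have fe: "formal_adjoint (test_form \<tau>) L z = - (peak p \<tau> z * (of_real \<tau> * S z + R z))" for \<tau> z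
  proof -
    have "(\<Sum>k\<in>-L. insertion_sign k (insert k L) * d_z k (test_form \<tau> (insert k L)) z)
       = (\<Sum>k\<in>-L. peak p \<tau> z * of_real \<tau> * (insertion_sign k (insert k L) * cnj (p $ k) * A (insert k L) z)
            + peak p \<tau> z * (insertion_sign k (insert k L) * d_z k (A (insert k L)) z))"
      by (intro sum.cong refl) (simp add: d_test_form(2)[OF cL] algebra_simps)
    also have "\<dots> = peak p \<tau> z * (of_real \<tau> * S z + R z)"
      by (simp add: sum.distrib S_def R_def contract_def sum_distrib_left distrib_left mult.assoc)
    finally show ?thesis by (simp add: formal_adjoint_def)
  qed
  define M where "M = 2 * C\<^sup>2 + 2 * b\<^sup>2"
  have "(L2_norm \<Omega> (formal_adjoint (test_form \<tau>) L))\<^sup>2 \<le> M * (peak_mass \<Omega> p \<tau> + \<tau>\<^sup>2 * peak_moment \<Omega> p \<tau>)" for \<tau>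
  proof -
    have "(L2_norm \<Omega> (formal_adjoint (test_form \<tau>) L))\<^sup>2 \<le> M * peak_mass \<Omega> p \<tau> + (M * \<tau>\<^sup>2) * peak_moment \<Omega> p \<tau>"
    proof (rule L2_norm_peak_upper[OF \<Omega>])
      fix z
      have "cmod (of_real \<tau> * S z + R z) \<le> \<bar>\<tau>\<bar> * (C * norm (z - p)) + b"
        by (rule norm_triangle_le) (auto simp: norm_mult intro!: add_mono mult_left_mono Sp R)
      then have "(cmod (of_real \<tau> * S z + R z))\<^sup>2 \<le> (\<bar>\<tau>\<bar> * (C * norm (z - p)) + b)\<^sup>2" by (intro power_mono) auto
      also have "\<dots> \<le> 2 * (\<bar>\<tau>\<bar> * (C * norm (z - p)))\<^sup>2 + 2 * b\<^sup>2"
        using sum_squares_bound[of "\<bar>\<tau>\<bar> * (C * norm (z - p))" b] by (simp add: power2_sum)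
      also have "\<dots> = 2 * C\<^sup>2 * (\<tau>\<^sup>2 * (norm (z - p))\<^sup>2) + 2 * b\<^sup>2" by (simp add: power_mult_distrib)
      also have "\<dots> \<le> M * (\<tau>\<^sup>2 * (norm (z - p))\<^sup>2) + M"
        unfolding M_def by (intro add_mono mult_right_mono) auto
      finally have "(cmod (of_real \<tau> * S z + R z))\<^sup>2 \<le> M + M * \<tau>\<^sup>2 * (norm (z - p))\<^sup>2" by simp
      from mult_right_mono[OF this, of "(cmod (peak p \<tau> z))\<^sup>2"]
      show "(cmod (formal_adjoint (test_form \<tau>) L z))\<^sup>2 \<le> (M + M * \<tau>\<^sup>2 * (norm (z - p))\<^sup>2) * (cmod (peak p \<tau> z))\<^sup>2"
        by (simp add: fe norm_mult power_mult_distrib mult.commute)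
    qed (auto simp: M_def)
    then show ?thesis by (simp add: distrib_left mult.assoc)
  qed
  moreover have "M \<ge> 0" by (simp add: M_def)
  ultimately show "\<exists>C\<ge>0. \<forall>\<tau>>0. (L2_norm \<Omega> (formal_adjoint (test_form \<tau>) L))\<^sup>2 \<le> C * (peak_mass \<Omega> p \<tau> + \<tau>\<^sup>2 * peak_moment \<Omega> p \<tau>)"
    by blast
qed simp

end

section \<open>A strictly convex boundary point\<close>

text \<open>A point of largest norm in the closure. A direction in which \<open>\<rho>\<close> decreases leads into \<open>\<Omega>\<close>, where
the norm cannot exceed that of \<open>p\<close>; so the half space on which the differential of \<open>\<rho>\<close> is negative
lies in that on which the product with \<open>p\<close> is at most zero. This makes the two linear functionals
positive multiples of each other.\<close>

lemma strictly_convex_boundary_point: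
  fixes \<Omega> :: "'a::euclidean_space set"
  assumes "bounded_domain \<Omega>" "Ck_boundary 2 \<Omega>"
  shows "\<exists>p U (\<rho> :: 'a \<Rightarrow> real) c. p \<noteq> 0 \<and> (\<forall>z\<in>\<Omega>. norm z \<le> norm p) \<and> open U \<and> p \<in> U \<and> Ck_on 2 U \<rho> \<and>
    \<Omega> \<inter> U = {x\<in>U. \<rho> x < 0} \<and> \<rho> p \<le> 0 \<and> c > 0 \<and> (\<forall>v. frechet_derivative \<rho> (at p) v = c * (v \<bullet> p))"
proof -
  have \<Omega>: "\<Omega> \<noteq> {}" "open \<Omega>" "bounded \<Omega>" using assms(1) by (auto simp: bounded_domain_def)
  have "\<exists>p\<in>closure \<Omega>. \<forall>z\<in>closure \<Omega>. norm z \<le> norm p"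
    using \<Omega> by (intro continuous_attains_sup continuous_intros) auto
  then obtain p where p: "p \<in> closure \<Omega>" "\<And>z. z \<in> \<Omega> \<Longrightarrow> norm z \<le> norm p"
    using closure_subset by blast
  have nin: "p \<notin> \<Omega>"
  proof
    assume "p \<in> \<Omega>"
    then obtain e where e: "e > 0" "ball p e \<subseteq> \<Omega>" using \<Omega>(2) open_contains_ball by blast
    obtain b where b: "norm b = 1" "norm (p + (e / 2) *\<^sub>R b) > norm p"
    proof (cases "p = 0")
      case True
      obtain b :: 'a where "b \<in> Basis" using nonempty_Basis by blast
      then show ?thesis using that[of b] e True by simp
    next
      case False
      have "norm (p + (e / 2) *\<^sub>R ((1 / norm p) *\<^sub>R p)) = norm p + e / 2"
      proof -
        have "p + (e / 2) *\<^sub>R ((1 / norm p) *\<^sub>R p) = (1 + e / (2 * norm p)) *\<^sub>R p"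
          by (simp add: scaleR_add_left)
        then show ?thesis using e False by (simp add: field_simps)
      qed
      then show ?thesis using that[of "(1 / norm p) *\<^sub>R p"] e False by simp
    qed
    have "p + (e / 2) *\<^sub>R b \<in> ball p e" using b e by (simp add: dist_norm)
    then show False using p(2)[of "p + (e / 2) *\<^sub>R b"] e b by auto
  qed
  have "p \<noteq> 0"
  proof
    assume "p = 0"
    then have "\<Omega> \<subseteq> {p}" using p(2) by auto
    then show False using \<Omega>(1) nin by auto
  qed
  have "p \<in> frontier \<Omega>" using p(1) nin \<Omega>(2) by (simp add: frontier_def interior_open)
  then obtain U and \<rho> :: "'a \<Rightarrow> real" where U: "open U" "p \<in> U" "Ck_on 2 U \<rho>" "\<Omega> \<inter> U = {x\<in>U. \<rho> x < 0}"
    "\<forall>x\<in>U. frechet_derivative \<rho> (at x) \<noteq> (\<lambda>v. 0)"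
    using assms(2) unfolding Ck_boundary_def by blast
  have U1: "Ck_on (Suc 0) U \<rho>" using Ck_on_Suc_imp[of "Suc 0" U \<rho>] U(3) by (simp only: numeral_2_eq_2)
  have \<rho>p: "\<rho> p \<le> 0"
  proof (rule ccontr)
    assume "\<not> \<rho> p \<le> 0"
    have "continuous_on U \<rho>" using Ck_on_Suc_imp[OF U1] by simp
    then have "open {x\<in>U. 0 < \<rho> x}"
      using continuous_open_preimage[of U \<rho> "{0<..}"] U(1) by (simp add: vimage_def Int_def)
    moreover have "\<Omega> \<inter> {x\<in>U. 0 < \<rho> x} = {}"
    proof -
      have "\<rho> x < 0" if "x \<in> \<Omega>" "x \<in> U" for x using U(4) that by blast
      then show ?thesis by force
    qed
    ultimately have "closure \<Omega> \<inter> {x\<in>U. 0 < \<rho> x} = {}" using open_Int_closure_eq_empty by blast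
    then show False using p(1) U(2) \<open>\<not> \<rho> p \<le> 0\<close> by auto
  qed
  define D where "D = frechet_derivative \<rho> (at p)"
  have D: "(\<rho> has_derivative D) (at p)" unfolding D_def using U1 U(2) by (auto intro: differentiableD)
  have lin: "linear D" using D has_derivative_linear by blast
  have neg: "v \<bullet> p \<le> 0" if "D v < 0" for v
  proof -
    have "((\<lambda>s. p + s *\<^sub>R v) has_derivative (\<lambda>s. s *\<^sub>R v)) (at 0)"
      by (auto intro!: derivative_eq_intros)
    then have "((\<lambda>s. \<rho> (p + s *\<^sub>R v)) has_derivative (\<lambda>s. D (s *\<^sub>R v))) (at 0)"
      by (rule has_derivative_compose) (use D in simp)
    moreover have "(\<lambda>s. D (s *\<^sub>R v)) = (*) (D v)"
      by (simp add: fun_eq_iff linear_scale[OF lin])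
    ultimately have "DERIV (\<lambda>s. \<rho> (p + s *\<^sub>R v)) 0 :> D v"
      by (simp add: has_field_derivative_def)
    from DERIV_neg_dec_right[OF this that] obtain d where d: "d > 0" "\<And>h. h > 0 \<Longrightarrow> h < d \<Longrightarrow> \<rho> (p + h *\<^sub>R v) < \<rho> p"
      by auto
    have "((\<lambda>s. p + s *\<^sub>R v) \<longlongrightarrow> p + 0 *\<^sub>R v) (at_right 0)" by (intro tendsto_intros)
    then have "\<forall>\<^sub>F s in at_right 0. p + s *\<^sub>R v \<in> U" using U(1,2) by (intro topological_tendstoD) auto
    then obtain d' where d': "d' > 0" "\<And>h. h > 0 \<Longrightarrow> h < d' \<Longrightarrow> p + h *\<^sub>R v \<in> U"
      by (auto simp: eventually_at_right_field)
    define h where "h = min d d' / 2"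
    have h: "h > 0" "h < d" "h < d'" using d(1) d'(1) by (auto simp: h_def)
    have "p + h *\<^sub>R v \<in> U" using d'(2) h by blast
    moreover have "\<rho> (p + h *\<^sub>R v) < 0" using d(2)[OF h(1,2)] \<rho>p by simp
    ultimately have "p + h *\<^sub>R v \<in> \<Omega>" using U(4) by blast
    from p(2)[OF this] have "(p + h *\<^sub>R v) \<bullet> (p + h *\<^sub>R v) \<le> p \<bullet> p" by (simp add: norm_le)
    then have "2 * h * (v \<bullet> p) + h\<^sup>2 * (v \<bullet> v) \<le> 0"
      by (simp add: inner_add_left inner_add_right inner_commute power2_eq_square algebra_simps)
    then have "2 * h * (v \<bullet> p) \<le> 0" by (smt (verit) inner_ge_zero mult_nonneg_nonneg zero_le_power2)
    then show ?thesis using h(1) by (simp add: mult_le_0_iff)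
  qed
  obtain w where w: "D w < 0"
  proof -
    have "D \<noteq> (\<lambda>v. 0)" using U(2,5) by (simp add: D_def)
    then obtain x where "D x \<noteq> 0" by auto
    then consider "D x < 0" | "D (- x) < 0" using linear_neg[OF lin, of x] by fastforce
    then show ?thesis using that by cases auto
  qed
  have ker1: "v \<bullet> p \<le> 0" if "D v = 0" for v
  proof (rule ccontr)
    assume v: "\<not> v \<bullet> p \<le> 0"
    \<comment> \<open>A step so short that adding \<open>s w\<close> cannot change the sign of the product with \<open>p\<close>.\<close>
    define s where "s = (v \<bullet> p) / (2 * (\<bar>w \<bullet> p\<bar> + 1))"
    have s: "s > 0" using v by (simp add: s_def)
    have "D (v + s *\<^sub>R w) = s * D w" using that by (simp add: linear_add[OF lin] linear_scale[OF lin])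
    then have "D (v + s *\<^sub>R w) < 0" using s w by (simp add: mult_pos_neg)
    from neg[OF this] have "v \<bullet> p + s * (w \<bullet> p) \<le> 0" by (simp add: inner_add_left)
    moreover have "s * \<bar>w \<bullet> p\<bar> \<le> (v \<bullet> p) / 2"
    proof -
      have "s * \<bar>w \<bullet> p\<bar> \<le> s * (\<bar>w \<bullet> p\<bar> + 1)" using s by simp
      also have "\<dots> = (v \<bullet> p) / 2" by (simp add: s_def field_simps add_nonneg_eq_0_iff)
      finally show ?thesis .
    qed
    moreover have "- (s * \<bar>w \<bullet> p\<bar>) \<le> s * (w \<bullet> p)" using s
      by (metis abs_ge_minus_self abs_mult abs_of_pos minus_le_iff)
    ultimately show False using v by linarith
  qed
  have ker: "v \<bullet> p = 0" if "D v = 0" for v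
    using ker1[OF that] ker1[of "- v"] that linear_neg[OF lin, of v] by simp
  have pp: "p \<bullet> p > 0" using \<open>p \<noteq> 0\<close> by simp
  have Dp: "D p > 0"
  proof (rule ccontr)
    assume "\<not> D p > 0"
    then consider "D p = 0" | "D p < 0" by linarith
    then show False using ker[of p] neg[of p] pp by cases auto
  qed
  have "D v = (D p / (p \<bullet> p)) * (v \<bullet> p)" for v
  proof -
    have "D (v - (D v / D p) *\<^sub>R p) = 0" using Dp by (simp add: linear_diff[OF lin] linear_scale[OF lin])
    from ker[OF this] have "v \<bullet> p = (D v / D p) * (p \<bullet> p)" by (simp add: inner_diff_left)
    then show ?thesis using Dp pp by (simp add: field_simps)
  qed
  moreover have "D p / (p \<bullet> p) > 0" using Dp pp by simp
  ultimately show ?thesis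
    using \<open>p \<noteq> 0\<close> p(2) U(1-4) \<rho>p unfolding D_def by blast
qed

section \<open>Growth of the mass\<close>

text \<open>An interior cone at \<open>p\<close> with axis \<open>- p\<close>, from the first order expansion of \<open>\<rho>\<close> at \<open>p\<close>: on these
balls the linear part is at most \<open>- 3/4\<close> of \<open>c s |p|\<^sup>2\<close>, and the remainder is at most \<open>5/16\<close> of it.\<close>

lemma interior_balls_at_peak:
  fixes \<Omega> :: "'a::euclidean_space set" and \<rho> :: "'a \<Rightarrow> real"
  assumes p: "p \<noteq> 0" and U: "open U" "p \<in> U" "Ck_on (Suc 0) U \<rho>" "\<Omega> \<inter> U = {x\<in>U. \<rho> x < 0}" "\<rho> p \<le> 0"
    and c: "c > 0" "\<And>v. frechet_derivative \<rho> (at p) v = c * (v \<bullet> p)"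
  shows "\<exists>s0>0. \<forall>s. 0 < s \<and> s < s0 \<longrightarrow> ball (p - s *\<^sub>R p) (norm p / 4 * s) \<subseteq> \<Omega>"
proof -
  let ?a = "norm p"
  have a: "?a > 0" using p by simp
  have D: "(\<rho> has_derivative frechet_derivative \<rho> (at p)) (at p)"
    using U(2,3) by (auto intro: differentiableD)
  moreover have "frechet_derivative \<rho> (at p) = (\<lambda>v. c * (v \<bullet> p))" using c(2) by (rule ext)
  ultimately have "(\<rho> has_derivative (\<lambda>v. c * (v \<bullet> p))) (at p within UNIV)" by simp
  then have "\<forall>e>0. \<exists>d>0. \<forall>y\<in>UNIV. norm (y - p) < d \<longrightarrow>
      norm (\<rho> y - \<rho> p - c * ((y - p) \<bullet> p)) \<le> e * norm (y - p)"
    unfolding has_derivative_within_alt by blast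
  moreover have "c * ?a / 4 > 0" using c(1) a by simp
  ultimately have "\<exists>d>0. \<forall>y\<in>UNIV. norm (y - p) < d \<longrightarrow>
      norm (\<rho> y - \<rho> p - c * ((y - p) \<bullet> p)) \<le> (c * ?a / 4) * norm (y - p)"
    by blast
  then obtain d where d: "d > 0" "\<And>y. norm (y - p) < d \<Longrightarrow> \<bar>\<rho> y - \<rho> p - c * ((y - p) \<bullet> p)\<bar> \<le> (c * ?a / 4) * norm (y - p)"
    by auto
  obtain d' where d': "d' > 0" "ball p d' \<subseteq> U" using U(1,2) open_contains_ball by blast
  define s0 where "s0 = min d d' / (2 * ?a)"
  have "s0 > 0" using d(1) d'(1) a by (simp add: s0_def)
  moreover have "ball (p - s *\<^sub>R p) (?a / 4 * s) \<subseteq> \<Omega>" if s: "0 < s" "s < s0" for s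
  proof
    fix y assume "y \<in> ball (p - s *\<^sub>R p) (?a / 4 * s)"
    then have w: "norm (y - p + s *\<^sub>R p) < ?a / 4 * s" by (simp add: dist_norm norm_minus_commute algebra_simps)
    have "norm (y - p) \<le> norm (y - p + s *\<^sub>R p) + norm (s *\<^sub>R p)"
      using norm_triangle_ineq4[of "y - p + s *\<^sub>R p" "s *\<^sub>R p"] by simp
    then have n: "norm (y - p) \<le> 5 / 4 * (s * ?a)" using w s by (simp add: mult.commute)
    have "s * ?a < min d d' / 2" using s(2) a by (simp add: s0_def field_simps)
    moreover have "0 < s * ?a" using s a by simp
    ultimately have n2: "norm (y - p) < d" "norm (y - p) < d'" using n by linarith+
    have "y \<in> U" using d'(2) n2(2) by (auto simp: dist_norm norm_minus_commute)
    have "(y - p) \<bullet> p = (y - p + s *\<^sub>R p) \<bullet> p - s * ?a\<^sup>2"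
      by (simp add: inner_add_left power2_norm_eq_inner)
    moreover have "(y - p + s *\<^sub>R p) \<bullet> p \<le> (?a / 4 * s) * ?a"
      by (rule order_trans[OF norm_cauchy_schwarz mult_right_mono[OF less_imp_le[OF w]]]) simp
    moreover have "(?a / 4 * s) * ?a = (1 / 4) * (s * ?a\<^sup>2)" by (simp add: power2_eq_square)
    ultimately have i: "(y - p) \<bullet> p \<le> - (3 / 4) * (s * ?a\<^sup>2)" by linarith
    have "\<rho> y \<le> \<rho> p + c * ((y - p) \<bullet> p) + (c * ?a / 4) * norm (y - p)" using d(2)[OF n2(1)] by linarith
    also have "\<dots> \<le> 0 + c * (- (3 / 4) * (s * ?a\<^sup>2)) + (c * ?a / 4) * (5 / 4 * (s * ?a))"
      using U(5) i n c(1) a by (intro add_mono mult_left_mono) auto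
    also have "\<dots> = - (7 / 16) * (c * s * ?a\<^sup>2)" by (simp add: power2_eq_square algebra_simps)
    also have "\<dots> < 0" using c(1) s a by simp
    finally show "y \<in> \<Omega>" using U(4) \<open>y \<in> U\<close> by blast
  qed
  ultimately show ?thesis by blast
qed

text \<open>Take the interior ball at scale \<open>s = 1/\<tau>\<close>. There \<open>|z - p| \<le> (5/4) |p| / \<tau>\<close>, so that \<open>|E|\<^sup>2\<close> is at least
\<open>exp (- 5/2 |p|\<^sup>2)\<close>, while the volume of the ball is a multiple of \<open>1/\<tau>\<close> to the power of the real
dimension.\<close>

lemma peak_mass_lower:
  fixes \<Omega> :: "(complex^'n::finite) set"
  assumes \<Omega>: "bounded \<Omega>" "open \<Omega>" and p: "p \<noteq> 0"
    and s0: "s0 > 0" "\<And>s. 0 < s \<Longrightarrow> s < s0 \<Longrightarrow> ball (p - s *\<^sub>R p) (norm p / 4 * s) \<subseteq> \<Omega>"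
  shows "\<exists>c>0. \<exists>T>0. \<forall>\<tau>\<ge>T. c / \<tau> ^ DIM(complex^'n) \<le> peak_mass \<Omega> p \<tau>"
proof -
  let ?a = "norm p" and ?N = "DIM(complex^'n)"
  have a: "?a > 0" using p by simp
  define m where "m = exp (- (5 / 2) * ?a\<^sup>2)"
  define c where "c = m * (unit_ball_vol (real ?N) * (?a / 4) ^ ?N)"
  have "c > 0" using a by (simp add: c_def m_def)
  have "c / \<tau> ^ ?N \<le> peak_mass \<Omega> p \<tau>" if \<tau>: "\<tau> \<ge> 2 / s0" for \<tau>
  proof -
    have t: "\<tau> > 0" using that s0(1) by (meson divide_pos_pos less_le_trans zero_less_numeral)
    define s where "s = 1 / \<tau>"
    have "2 \<le> \<tau> * s0" using \<tau> s0(1) by (simp add: field_simps)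
    then have s: "0 < s" "s < s0" using t s0(1) by (auto simp: s_def field_simps)
    let ?B = "ball (p - s *\<^sub>R p) (?a / 4 * s)"
    have sub: "?B \<subseteq> \<Omega>" by (rule s0(2)[OF s])
    have low: "m \<le> (cmod (peak p \<tau> z))\<^sup>2" if "z \<in> ?B" for z
    proof -
      have w: "norm (z - p + s *\<^sub>R p) < ?a / 4 * s" using that by (simp add: dist_norm norm_minus_commute algebra_simps)
      have "norm (z - p) \<le> norm (z - p + s *\<^sub>R p) + norm (s *\<^sub>R p)"
        using norm_triangle_ineq4[of "z - p + s *\<^sub>R p" "s *\<^sub>R p"] by simp
      then have n: "norm (z - p) \<le> 5 / 4 * (s * ?a)" using w s by (simp add: mult.commute)
      have "\<bar>(z - p) \<bullet> p\<bar> \<le> norm (z - p) * ?a" by (rule Cauchy_Schwarz_ineq2)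
      also have "\<dots> \<le> 5 / 4 * (s * ?a) * ?a" using n a by (intro mult_right_mono) auto
      finally have "- (5 / 4 * s * ?a\<^sup>2) \<le> (z - p) \<bullet> p" by (simp add: power2_eq_square abs_le_iff)
      then have "2 * \<tau> * (- (5 / 4 * s * ?a\<^sup>2)) \<le> 2 * \<tau> * ((z - p) \<bullet> p)" using t by (intro mult_left_mono) auto
      then have "- (5 / 2) * ?a\<^sup>2 \<le> 2 * \<tau> * ((z - p) \<bullet> p)" using t by (simp add: s_def)
      then show ?thesis unfolding m_def cmod_peak_power2 by simp
    qed
    have Bm: "?B \<in> sets lebesgue" by simp
    have "c / \<tau> ^ ?N = m * measure lebesgue ?B"
      using s(1) a by (simp add: content_ball c_def s_def power_mult_distrib power_divide measure_completion)
    also have "\<dots> = m * measure (lebesgue_on \<Omega>) ?B"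
      using sub finite_measure_lebesgue_on(2)[OF \<Omega>] by (simp add: measure_restrict_space)
    also have "\<dots> = (LINT z|lebesgue_on \<Omega>. m * indicat_real ?B z)"
    proof -
      have "?B \<in> sets (lebesgue_on \<Omega>)"
        using sub Bm finite_measure_lebesgue_on(2)[OF \<Omega>] by (simp add: sets_restrict_space_iff)
      moreover have "?B \<inter> space (lebesgue_on \<Omega>) = ?B" using sub by (auto simp: space_restrict_space)
      ultimately show ?thesis by simp
    qed
    also have "\<dots> \<le> peak_mass \<Omega> p \<tau>"
      unfolding peak_mass_def
      by (intro Bochner_Integration.integral_mono' peak_integrable[OF \<Omega>]) (auto simp: indicator_def low)
    finally show ?thesis .
  qed
  moreover have "2 / s0 > 0" using s0(1) by simp
  ultimately show ?thesis using \<open>c > 0\<close> by blast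
qed

text \<open>With \<open>x = - \<tau> Re h\<close>, strict convexity gives \<open>|z - p|\<^sup>2 \<le> 2 x / \<tau>\<close>, and \<open>x \<le> exp x\<close> trades this factor for
half of the exponential decay.\<close>

lemma peak_moment_le:
  assumes \<Omega>: "bounded \<Omega>" "open \<Omega>" and p: "\<And>z. z \<in> \<Omega> \<Longrightarrow> norm z \<le> norm p" and \<tau>: "\<tau> > 0"
  shows "peak_moment \<Omega> p \<tau> \<le> 2 / \<tau> * peak_mass \<Omega> p (\<tau> / 2)"
proof -
  have "peak_moment \<Omega> p \<tau> \<le> (LINT z|lebesgue_on \<Omega>. 2 / \<tau> * (cmod (peak p (\<tau> / 2) z))\<^sup>2)"
    unfolding peak_moment_def
  proof (rule Bochner_Integration.integral_mono)
    fix z assume "z \<in> space (lebesgue_on \<Omega>)"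
    then have "norm z \<le> norm p" using p by (simp add: space_restrict_space)
    have le_exp: "x \<le> exp x" for x :: real using exp_ge_add_one_self[of x] by linarith
    define x where "x = - (\<tau> * ((z - p) \<bullet> p))"
    have "(norm (z - p))\<^sup>2 \<le> - 2 * ((z - p) \<bullet> p)" using inner_le_of_norm_le[OF \<open>norm z \<le> norm p\<close>] by simp
    also have "\<dots> = 2 / \<tau> * x" using \<tau> by (simp add: x_def)
    also have "\<dots> \<le> 2 / \<tau> * exp x" using \<tau> le_exp by (intro mult_left_mono) auto
    finally have "(norm (z - p))\<^sup>2 * exp (- (2 * x)) \<le> 2 / \<tau> * exp x * exp (- (2 * x))"
      by (rule mult_right_mono) simp
    also have "\<dots> = 2 / \<tau> * exp (- x)" by (simp add: mult.assoc exp_add[symmetric])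
    finally show "(norm (z - p))\<^sup>2 * (cmod (peak p \<tau> z))\<^sup>2 \<le> 2 / \<tau> * (cmod (peak p (\<tau> / 2) z))\<^sup>2"
      by (simp add: cmod_peak_power2 x_def mult.assoc)
  qed (use peak_integrable[OF \<Omega>] in auto)
  then show ?thesis by (simp add: peak_mass_def)
qed

text \<open>Otherwise \<open>f\<close> would lose a factor \<open>2\<close> to the power \<open>N + 1\<close> at every doubling of \<open>\<tau>\<close> beyond some
point, and so decay faster than \<open>\<tau>\<close> to the power \<open>- N\<close>.\<close>

lemma doubling_scales:
  fixes f :: "real \<Rightarrow> real"
  assumes "c > 0" "T > 0" "\<And>\<tau>. \<tau> \<ge> T \<Longrightarrow> c / \<tau> ^ N \<le> f \<tau>"
  shows "\<exists>\<tau>\<ge>S. f (\<tau> / 2) \<le> 2 ^ Suc N * f \<tau>"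
proof (rule ccontr)
  assume "\<not> ?thesis"
  then have no: "f \<tau> < f (\<tau> / 2) / 2 ^ Suc N" if "\<tau> \<ge> S" for \<tau>
    using that by (simp add: less_divide_eq not_le mult.commute) (metis not_less)
  define R where "R = max S T"
  have R: "R \<ge> S" "R \<ge> T" "R > 0" using assms(2) by (auto simp: R_def)
  have R2: "R \<le> R * 2 ^ m" for m
    using R(3) by (simp add: mult_le_cancel_left1)
  have up: "f (R * 2 ^ m) \<le> f R / (2 ^ Suc N) ^ m" for m
  proof (induction m)
    case (Suc m)
    have "f (R * 2 ^ Suc m) < f (R * 2 ^ Suc m / 2) / 2 ^ Suc N" using R(1) R2[of "Suc m"] by (intro no) (rule order_trans)
    also have "R * 2 ^ Suc m / 2 = R * 2 ^ m" by simp
    also have "f (R * 2 ^ m) / 2 ^ Suc N \<le> f R / (2 ^ Suc N) ^ m / 2 ^ Suc N" using Suc by (intro divide_right_mono) auto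
    also have "\<dots> = f R / (2 ^ Suc N) ^ Suc m" by (simp add: field_simps)
    finally show ?case by simp
  qed simp
  have "2 ^ m \<le> f R * R ^ N / c" for m
  proof -
    have "c / (R * 2 ^ m) ^ N \<le> f R / (2 ^ Suc N) ^ m" using assms(3)[of "R * 2 ^ m"] up[of m] R R2[of m] by simp
    moreover have "((2::real) ^ Suc N) ^ m = (2 ^ m) ^ N * 2 ^ m" by (simp add: power_mult_distrib power_mult[symmetric] mult.commute)
    ultimately have "c / (R ^ N * (2 ^ m) ^ N) \<le> f R / ((2 ^ m) ^ N * 2 ^ m)" by (simp add: power_mult_distrib mult.commute)
    then have "c * 2 ^ m \<le> f R * R ^ N" using R(3) by (simp add: field_simps)
    then show ?thesis using assms(1) by (simp add: field_simps)
  qed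
  moreover obtain m where "f R * R ^ N / c < 2 ^ m" using real_arch_pow[of 2 "f R * R ^ N / c"] by auto
  ultimately show False by (meson not_le)
qed

section \<open>The lower bound for the constants\<close>

text \<open>Contract \<open>\<partial>\<rho>\<close> into the basis form of a set \<open>M\<close> of \<open>r + 2\<close> indices containing some \<open>n\<close> with
\<open>p\<^sub>n \<noteq> 0\<close>. The coefficient at \<open>M - {n}\<close> is then nonzero at \<open>p\<close>. Since \<open>\<partial>\<rho>\<close> is a multiple of
\<open>cnj p\<close> at \<open>p\<close>, both contractions in the conclusion are double contractions with one vector.\<close>

lemma tangential_coefficients:
  fixes \<rho> :: "complex^'n::{finite,linorder} \<Rightarrow> real" and p :: "(complex, 'n) vec"
  assumes p: "p \<noteq> 0" and U: "open U" "p \<in> U" "Ck_on 2 U \<rho>"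
    and c: "c > 0" "\<And>v. frechet_derivative \<rho> (at p) v = c * (v \<bullet> p)"
    and r: "Suc (Suc r) \<le> CARD('n)"
  shows "\<exists>A K J n. compact K \<and> K \<subseteq> U \<and> p $ n \<noteq> 0 \<and> card J = Suc r \<and> A J p \<noteq> 0 \<and>
    (\<forall>J. Ck_on (Suc 0) UNIV (A J)) \<and> (\<forall>J x. x \<notin> K \<longrightarrow> A J x = 0) \<and>
    (\<forall>L. contract (\<lambda>k. cnj (p $ k)) (\<lambda>J. A J p) L = 0) \<and>
    (\<forall>L z. contract (\<lambda>k. d_z k (\<lambda>z. complex_of_real (\<rho> z)) z) (\<lambda>J. A J z) L = 0)"
proof -
  let ?\<rho> = "\<lambda>z. complex_of_real (\<rho> z)"
  obtain n where n: "p $ n \<noteq> 0" using p by (metis vec_eq_iff zero_index)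
  obtain M where M: "card M = Suc (Suc r)" "n \<in> M"
  proof -
    have "r + 1 \<le> card (- {n})" using r by (simp add: Compl_eq_Diff_UNIV card_Diff_singleton)
    then obtain M0 where "M0 \<subseteq> - {n}" "card M0 = r + 1" by (metis obtain_subset_with_card_n)
    moreover from this have "card (insert n M0) = Suc (Suc r)" by (subst card_insert_disjoint) auto
    ultimately show ?thesis using that[of "insert n M0"] by simp
  qed
  obtain e where e: "e > 0" "cball p e \<subseteq> U" using U(1,2) open_contains_cball by blast
  define A where "A J z = contracted_basis_form (\<lambda>k. d_z k ?\<rho> z) M J * complex_of_real (bump p e z)" for J z
  have U1: "Ck_on (Suc 0) U \<rho>" using Ck_on_Suc_imp[of "Suc 0" U \<rho>] U(3) by (simp only: numeral_2_eq_2)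
  have \<rho>d: "\<rho> differentiable (at p)" using U1 U(2) by simp
  have \<rho>2: "Ck_on (Suc 0) U (\<lambda>z. d_z k ?\<rho> z)" for k
  proof -
    have "Ck_on (Suc (Suc 0)) U ?\<rho>" using U(3) by (intro Ck_on_of_real U(1)) (simp only: numeral_2_eq_2)
    then have D: "Ck_on (Suc 0) U (\<lambda>z. frechet_derivative ?\<rho> (at z) v)" for v by simp
    have "d_z k ?\<rho> z = (1 / 2) * frechet_derivative ?\<rho> (at z) (axis k 1) + (- \<i> / 2) * frechet_derivative ?\<rho> (at z) (axis k \<i>)" for z
      by (simp add: d_z_def field_simps)
    moreover have "Ck_on (Suc 0) U (\<lambda>z. (1 / 2) * frechet_derivative ?\<rho> (at z) (axis k 1) + (- \<i> / 2) * frechet_derivative ?\<rho> (at z) (axis k \<i>))"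
      by (intro Ck_on_add Ck_on_mult Ck_on_const U(1) D)
    ultimately show ?thesis by simp
  qed
  have \<rho>p: "d_z k ?\<rho> p = of_real (c / 2) * cnj (p $ k)" for k
  proof -
    have "axis k 1 \<bullet> p = Re (p $ k)" "axis k \<i> \<bullet> p = Im (p $ k)"
      by (simp_all add: inner_axis' inner_complex_def)
    then show ?thesis
      by (simp add: d_z_def frechet_derivative_of_real[OF \<rho>d] c(2) complex_eq_iff)
  qed
  have lin: "contracted_basis_form (\<lambda>k. a * x k) M J = a * contracted_basis_form x M J" for a x J
    by (simp add: contracted_basis_form_def contract_def sum_distrib_left algebra_simps)
  have scale: "contract y (\<lambda>J. X J * a) L = contract y X L * a" for y X a L
    by (simp add: contract_def sum_distrib_right mult.assoc)
  have scale2: "contract y (\<lambda>J. a * X J) L = a * contract y X L" for y X a L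
    by (simp add: contract_def sum_distrib_left algebra_simps)
  have 1: "card (M - {n}) = Suc r" using M by simp
  have 2: "A (M - {n}) p \<noteq> 0"
    using n c(1) bump_center_pos[OF e(1), of p] norm_insertion_sign[of n M]
    by (auto simp: A_def contracted_basis_form_remove[OF M(2)] \<rho>p)
  have 3: "Ck_on (Suc 0) UNIV (A J)" for J
  proof -
    have "Ck_on (Suc 0) U (\<lambda>z. contracted_basis_form (\<lambda>k. d_z k ?\<rho> z) M J)"
      unfolding contracted_basis_form_def contract_def
      by (intro Ck_on_sum Ck_on_mult Ck_on_const U(1) \<rho>2)
    then show ?thesis
      unfolding A_def[abs_def]
    proof (rule Ck_on_cutoff[OF U(1) closed_cball e(2)])
      show "Ck_on (Suc 0) UNIV (\<lambda>z. complex_of_real (bump p e z))"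
        by (intro Ck_on_of_real open_UNIV bump_smooth)
      show "complex_of_real (bump p e z) = 0" if "z \<notin> cball p e" for z
        using that e(1) bump_eq_0[of e z p] by (simp add: dist_norm norm_minus_commute)
    qed
  qed
  have 4: "A J z = 0" if "z \<notin> cball p e" for J z
    using that e(1) bump_eq_0[of e z p] by (simp add: A_def dist_norm norm_minus_commute)
  have 5: "contract (\<lambda>k. cnj (p $ k)) (\<lambda>J. A J p) L = 0" for L
    unfolding A_def \<rho>p lin scale scale2 contract_contracted_basis_form by simp
  have 6: "contract (\<lambda>k. d_z k ?\<rho> z) (\<lambda>J. A J z) L = 0" for L z
    unfolding A_def scale contract_contracted_basis_form by simp
  show ?thesis
    by (rule exI[of _ A], rule exI[of _ "cball p e"], rule exI[of _ "M - {n}"], rule exI[of _ n])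
      (use 1 2 3 4 5 6 e(2) n in auto)
qed

text \<open>At \<open>\<epsilon> = \<delta>/\<tau>\<close> the term \<open>\<epsilon> C2 \<tau>\<^sup>2 D\<close> is at most \<open>\<delta> C2 E I\<close>, which a small \<open>\<delta>\<close> makes a fraction of \<open>c0 I\<close>;
the other terms that do not involve \<open>C\<close> are \<open>O(I/\<tau>)\<close>. If \<open>\<epsilon>\<^sup>2 C \<epsilon>\<close> were eventually below a small
\<open>\<eta>\<close>, the last term would also be only a fraction of \<open>c0 I\<close>, and the estimate would fail.\<close>

lemma critical_scaling:
  fixes C :: "real \<Rightarrow> real" and I D :: "real \<Rightarrow> real"
  assumes c0: "c0 > 0" and nn: "C0 \<ge> 0" "C1 \<ge> 0" "C2 \<ge> 0" "C3 \<ge> 0" "E \<ge> 0"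
    and C: "\<And>\<epsilon>. \<epsilon> > 0 \<Longrightarrow> C \<epsilon> > 0"
    and est: "\<And>\<tau> \<epsilon>. \<tau> > 0 \<Longrightarrow> \<epsilon> > 0 \<Longrightarrow> c0 * I \<tau> - C0 * D \<tau> \<le>
        \<epsilon> * (C1 * I \<tau> + C2 * (I \<tau> + \<tau>\<^sup>2 * D \<tau>)) + C \<epsilon> * (C3 * (I \<tau> / \<tau>\<^sup>2))"
    and scales: "\<And>S. \<exists>\<tau>\<ge>S. I \<tau> > 0 \<and> D \<tau> \<le> E / \<tau> * I \<tau>"
  shows "Limsup (at_right 0) (\<lambda>\<epsilon>. ereal (\<epsilon>\<^sup>2 * C \<epsilon>)) > 0"
proof (rule ccontr)
  assume "\<not> ?thesis"
  then have L: "Limsup (at_right 0) (\<lambda>\<epsilon>. ereal (\<epsilon>\<^sup>2 * C \<epsilon>)) \<le> 0" by simp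
  define \<delta> where "\<delta> = c0 / 4 / (C2 * E + 1)"
  have nonzero_divide_mult_cancel: "a / x * x = a" if "x \<noteq> 0" for a x :: real using that by simp
  have CE: "C2 * E \<ge> 0" using nn by simp
  have \<delta>: "\<delta> > 0" using c0 CE by (simp add: \<delta>_def)
  have \<delta>b: "\<delta> * (C2 * E) \<le> c0 / 4"
  proof -
    have "\<delta> * (C2 * E) \<le> \<delta> * (C2 * E + 1)" using \<delta> by simp
    also have "\<dots> = c0 / 4"
      unfolding \<delta>_def by (rule nonzero_divide_mult_cancel) (use CE in linarith)
    finally show ?thesis .
  qed
  \<comment> \<open>Chosen, like \<open>\<delta>\<close>, so that the corresponding term is at most a quarter of \<open>c0 I\<close>.\<close>
  define \<eta> where "\<eta> = c0 / 4 * \<delta>\<^sup>2 / (C3 + 1)"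
  have \<eta>: "\<eta> > 0" using c0 \<delta> nn by (simp add: \<eta>_def)
  have \<eta>b: "\<eta> * C3 / \<delta>\<^sup>2 \<le> c0 / 4"
  proof -
    have "\<eta> * C3 / \<delta>\<^sup>2 \<le> \<eta> * (C3 + 1) / \<delta>\<^sup>2" using \<eta> by (intro divide_right_mono) auto
    also have "\<eta> * (C3 + 1) = c0 / 4 * \<delta>\<^sup>2"
      unfolding \<eta>_def by (rule nonzero_divide_mult_cancel) (use nn in linarith)
    also have "c0 / 4 * \<delta>\<^sup>2 / \<delta>\<^sup>2 = c0 / 4" using \<delta> by simp
    finally show ?thesis .
  qed
  have "Limsup (at_right 0) (\<lambda>\<epsilon>. ereal (\<epsilon>\<^sup>2 * C \<epsilon>)) < ereal \<eta>"
    using L \<eta> by (meson ereal_less(2) le_less_trans)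
  then have "\<forall>\<^sub>F \<epsilon> in at_right 0. ereal (\<epsilon>\<^sup>2 * C \<epsilon>) < ereal \<eta>" by (rule Limsup_lessD)
  then obtain e0 where e0: "e0 > 0" "\<And>\<epsilon>. 0 < \<epsilon> \<Longrightarrow> \<epsilon> < e0 \<Longrightarrow> \<epsilon>\<^sup>2 * C \<epsilon> < \<eta>"
    by (auto simp: eventually_at_right_field)
  define B where "B = C0 * E + \<delta> * (C1 + C2)"
  have B: "B \<ge> 0" using nn \<delta> by (simp add: B_def)
  \<comment> \<open>Large enough for the \<open>O(1/\<tau>)\<close> terms to be at most \<open>c0 / 8\<close> and for \<open>\<delta>/\<tau>\<close> to be below \<open>e0\<close>.\<close>
  obtain \<tau> where \<tau>: "\<tau> \<ge> max 1 (max (8 * B / c0) (2 * \<delta> / e0))" "I \<tau> > 0" "D \<tau> \<le> E / \<tau> * I \<tau>"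
    using scales by blast
  have t: "\<tau> > 0" using \<tau>(1) by linarith
  define \<epsilon> where "\<epsilon> = \<delta> / \<tau>"
  have \<epsilon>: "\<epsilon> > 0" using \<delta> t by (simp add: \<epsilon>_def)
  have "\<epsilon> < e0"
  proof -
    have "2 * \<delta> / e0 \<le> \<tau>" using \<tau>(1) by simp
    then have "2 * \<delta> \<le> \<tau> * e0" using e0(1) by (simp add: field_simps)
    then have "\<delta> < \<tau> * e0" using \<delta> by linarith
    then show ?thesis using t by (simp add: \<epsilon>_def field_simps)
  qed
  from e0(2)[OF \<epsilon> this] have C\<epsilon>: "C \<epsilon> \<le> \<eta> / \<epsilon>\<^sup>2" using \<epsilon> by (simp add: field_simps)
  have Bt: "B / \<tau> \<le> c0 / 8"
  proof -
    have "8 * B / c0 \<le> \<tau>" using \<tau>(1) by simp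
    then have "8 * B \<le> \<tau> * c0" using c0 by (simp add: field_simps)
    then show ?thesis using t by (simp add: field_simps)
  qed
  have "c0 * I \<tau> \<le> C0 * D \<tau> + \<epsilon> * (C1 * I \<tau> + C2 * (I \<tau> + \<tau>\<^sup>2 * D \<tau>)) + C \<epsilon> * (C3 * (I \<tau> / \<tau>\<^sup>2))"
    using est[OF t \<epsilon>] by simp
  also have "\<dots> \<le> C0 * (E / \<tau> * I \<tau>) + \<epsilon> * (C1 * I \<tau> + C2 * (I \<tau> + \<tau>\<^sup>2 * (E / \<tau> * I \<tau>))) + \<eta> / \<epsilon>\<^sup>2 * (C3 * (I \<tau> / \<tau>\<^sup>2))"
    using nn \<epsilon> \<tau>(2,3) C\<epsilon> by (intro add_mono mult_left_mono mult_right_mono) auto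
  also have "\<dots> = (B / \<tau> + \<delta> * (C2 * E) + \<eta> * C3 / \<delta>\<^sup>2) * I \<tau>"
    using t \<delta> by (simp add: \<epsilon>_def B_def field_simps power2_eq_square)
  also have "\<dots> \<le> (c0 / 8 + c0 / 4 + c0 / 4) * I \<tau>"
    using Bt \<delta>b \<eta>b \<tau>(2) by (intro mult_right_mono add_mono) auto
  also have "\<dots> < c0 * I \<tau>" using c0 \<tau>(2) by (intro mult_strict_right_mono) auto
  finally show False by simp
qed

theorem theorem1p5:
  fixes \<Omega> :: "(complex^'n::{finite,linorder}) set" and q :: nat and C :: "real \<Rightarrow> real"
  assumes "bounded_domain \<Omega>" and "Ck_boundary 2 \<Omega>"
    and "1 \<le> q" and "q \<le> CARD('n) - 1"
    and "\<And>\<epsilon>. \<epsilon> > 0 \<Longrightarrow> C \<epsilon> > 0"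
    and "\<And>\<epsilon> f g h. \<epsilon> > 0 \<Longrightarrow> has_dbar \<Omega> q f g \<Longrightarrow> has_dbar_adjoint \<Omega> q f h \<Longrightarrow>
           \<epsilon> * ((form_L2_norm \<Omega> (q + 1) g)\<^sup>2 + (form_L2_norm \<Omega> (q - 1) h)\<^sup>2)
             + C \<epsilon> * (form_W_neg1_norm \<Omega> q f)\<^sup>2 \<ge> (form_L2_norm \<Omega> q f)\<^sup>2"
  shows "Limsup (at_right 0) (\<lambda>\<epsilon>. ereal (\<epsilon>\<^sup>2 * C \<epsilon>)) > 0"
proof -
  have \<Omega>: "bounded \<Omega>" "open \<Omega>" using assms(1) by (auto simp: bounded_domain_def)
  obtain r where q: "q = Suc r" using assms(3) by (cases q) auto
  have r: "Suc (Suc r) \<le> CARD('n)" using assms(4) q by simp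
  obtain p U \<rho> c where p: "p \<noteq> 0" "\<forall>z\<in>\<Omega>. norm z \<le> norm p"
    and U: "open U" "p \<in> U" "Ck_on 2 U \<rho>" "\<Omega> \<inter> U = {x\<in>U. \<rho> x < 0}" "\<rho> p \<le> (0::real)"
    and c: "c > 0" "\<forall>v. frechet_derivative \<rho> (at p) v = c * (v \<bullet> p)"
    using strictly_convex_boundary_point[OF assms(1,2)] by blast
  have U1: "Ck_on (Suc 0) U \<rho>" using Ck_on_Suc_imp[of "Suc 0" U \<rho>] U(3) by (simp only: numeral_2_eq_2)
  obtain A S J n where S: "compact S" "S \<subseteq> U" and n: "p $ n \<noteq> 0" and J: "card J = Suc r" "A J p \<noteq> 0"
    and A: "\<forall>J. Ck_on (Suc 0) UNIV (A J)" "\<forall>J x. x \<notin> S \<longrightarrow> A J x = 0"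
    and tang: "\<forall>L. contract (\<lambda>k. cnj (p $ k)) (\<lambda>J. A J p) L = 0"
      "\<forall>L z. contract (\<lambda>k. d_z k (\<lambda>z. complex_of_real (\<rho> z)) z) (\<lambda>J. A J z) L = 0"
    using tangential_coefficients[OF p(1) U(1-3) c(1) c(2)[rule_format] r] by blast
  interpret peak_coefficients \<Omega> q A S p
    by unfold_locales (use \<Omega> A S in auto)
  let ?g = "\<lambda>\<tau> J z. \<Sum>k\<in>J. (-1) ^ card {i\<in>J. i < k} * d_zbar k (test_form \<tau> (J - {k})) z"
  have dbar: "has_dbar \<Omega> q (test_form \<tau>) (?g \<tau>)" for \<tau>
    by (rule has_dbar_C1[OF \<Omega> test_form_C1 S(1) test_form_zero])
  have adjoint: "has_dbar_adjoint \<Omega> q (test_form \<tau>) (formal_adjoint (test_form \<tau>))" for \<tau>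
    unfolding q
  proof (rule tangential_in_adjoint_domain[OF \<Omega> _ S _ U(1) U1 U(4)])
    show "Ck_on (Suc 0) UNIV (test_form \<tau> J)" if "card J = Suc r" for J
      using that q by (intro test_form_C1) simp
    show "test_form \<tau> J x = 0" if "card J = Suc r" "x \<notin> S" for J x
      using that q by (intro test_form_zero) simp_all
    show "contract (\<lambda>k. d_z k (\<lambda>z. complex_of_real (\<rho> z)) z) (\<lambda>J. test_form \<tau> J z) L = 0" for L z
    proof -
      have "contract (\<lambda>k. d_z k (\<lambda>z. complex_of_real (\<rho> z)) z) (\<lambda>J. test_form \<tau> J z) L
          = peak p \<tau> z * contract (\<lambda>k. d_z k (\<lambda>z. complex_of_real (\<rho> z)) z) (\<lambda>J. A J z) L"
        by (simp add: contract_def test_form_def sum_distrib_left algebra_simps)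
      then show ?thesis using tang(2) by simp
    qed
  qed
  obtain c0 C0 where c0: "c0 > 0" "C0 \<ge> 0"
    "\<And>\<tau>. c0 * peak_mass \<Omega> p \<tau> - C0 * peak_moment \<Omega> p \<tau> \<le> (form_L2_norm \<Omega> q (test_form \<tau>))\<^sup>2"
    using test_form_norm_lower[of J] J q by auto
  obtain C1 where C1: "C1 \<ge> 0" "\<And>\<tau>. \<tau> > 0 \<Longrightarrow> (form_L2_norm \<Omega> (Suc q) (?g \<tau>))\<^sup>2 \<le> C1 * peak_mass \<Omega> p \<tau>"
    using test_form_dbar_upper by blast
  obtain C2 where C2: "C2 \<ge> 0" "\<And>\<tau>. \<tau> > 0 \<Longrightarrow> (form_L2_norm \<Omega> r (formal_adjoint (test_form \<tau>)))\<^sup>2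
      \<le> C2 * (peak_mass \<Omega> p \<tau> + \<tau>\<^sup>2 * peak_moment \<Omega> p \<tau>)"
    using test_form_adjoint_upper[OF q tang(1)[rule_format]] by blast
  obtain C3 where C3: "C3 \<ge> 0" "\<And>\<tau>. \<tau> > 0 \<Longrightarrow> (form_W_neg1_norm \<Omega> q (test_form \<tau>))\<^sup>2 \<le> C3 * (peak_mass \<Omega> p \<tau> / \<tau>\<^sup>2)"
    using test_form_W_neg1_upper[OF n] by blast
  obtain s0 where s0: "s0 > 0" "\<And>s. 0 < s \<Longrightarrow> s < s0 \<Longrightarrow> ball (p - s *\<^sub>R p) (norm p / 4 * s) \<subseteq> \<Omega>"
    using interior_balls_at_peak[OF p(1) U(1,2) U1 U(4,5) c(1) c(2)[rule_format]] by blast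
  let ?N = "DIM((complex, 'n) vec)"
  obtain m T where m: "m > 0" "T > 0" "\<And>\<tau>. \<tau> \<ge> T \<Longrightarrow> m / \<tau> ^ ?N \<le> peak_mass \<Omega> p \<tau>"
    using peak_mass_lower[OF \<Omega> p(1) s0] by blast
  define E where "E = (2::real) * 2 ^ Suc ?N"
  show ?thesis
  proof (rule critical_scaling[where I = "peak_mass \<Omega> p" and D = "peak_moment \<Omega> p" and E = E,
      OF c0(1,2) C1(1) C2(1) C3(1) _ assms(5)])
    show "0 \<le> E" by (simp add: E_def)
    fix \<tau> \<epsilon> :: real assume \<tau>: "\<tau> > 0" and \<epsilon>: "\<epsilon> > 0"
    have "c0 * peak_mass \<Omega> p \<tau> - C0 * peak_moment \<Omega> p \<tau> \<le> (form_L2_norm \<Omega> q (test_form \<tau>))\<^sup>2" by (rule c0(3))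
    also have "\<dots> \<le> \<epsilon> * ((form_L2_norm \<Omega> (q + 1) (?g \<tau>))\<^sup>2 + (form_L2_norm \<Omega> (q - 1) (formal_adjoint (test_form \<tau>)))\<^sup>2)
        + C \<epsilon> * (form_W_neg1_norm \<Omega> q (test_form \<tau>))\<^sup>2"
      by (rule assms(6)[OF \<epsilon> dbar adjoint])
    also have "\<dots> \<le> \<epsilon> * (C1 * peak_mass \<Omega> p \<tau> + C2 * (peak_mass \<Omega> p \<tau> + \<tau>\<^sup>2 * peak_moment \<Omega> p \<tau>))
        + C \<epsilon> * (C3 * (peak_mass \<Omega> p \<tau> / \<tau>\<^sup>2))"
      using C1(2)[OF \<tau>] C2(2)[OF \<tau>] C3(2)[OF \<tau>] \<epsilon> assms(5)[OF \<epsilon>] q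
      by (intro add_mono mult_left_mono) auto
    finally show "c0 * peak_mass \<Omega> p \<tau> - C0 * peak_moment \<Omega> p \<tau> \<le> \<epsilon> * (C1 * peak_mass \<Omega> p \<tau>
        + C2 * (peak_mass \<Omega> p \<tau> + \<tau>\<^sup>2 * peak_moment \<Omega> p \<tau>)) + C \<epsilon> * (C3 * (peak_mass \<Omega> p \<tau> / \<tau>\<^sup>2))" .
  next
    fix R :: real
    obtain \<tau> where \<tau>: "\<tau> \<ge> max R T" "peak_mass \<Omega> p (\<tau> / 2) \<le> 2 ^ Suc ?N * peak_mass \<Omega> p \<tau>"
      using doubling_scales[OF m, of "max R T"] by blast
    have t: "\<tau> > 0" "\<tau> \<ge> R" "\<tau> \<ge> T" using \<tau>(1) m(2) by auto
    have "0 < m / \<tau> ^ ?N" using m(1) t(1) by simp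
    then have pos: "peak_mass \<Omega> p \<tau> > 0" using m(3)[OF t(3)] by linarith
    have "peak_moment \<Omega> p \<tau> \<le> 2 / \<tau> * peak_mass \<Omega> p (\<tau> / 2)"
      using p(2) by (intro peak_moment_le[OF \<Omega> _ t(1)]) blast
    also have "\<dots> \<le> 2 / \<tau> * (2 ^ Suc ?N * peak_mass \<Omega> p \<tau>)"
      using \<tau>(2) t(1) by (intro mult_left_mono) auto
    also have "\<dots> = E / \<tau> * peak_mass \<Omega> p \<tau>" by (simp add: E_def)
    finally show "\<exists>\<tau>\<ge>R. peak_mass \<Omega> p \<tau> > 0 \<and> peak_moment \<Omega> p \<tau> \<le> E / \<tau> * peak_mass \<Omega> p \<tau>"
      using t(2) pos by blast
  qed
qed

end
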